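(* Let $R$ be a ring and let $(P,Q,\psi)$ be an $R$-system satisfying Condition (FS) whose Cuntz–Pimsner ring $\mathcal{O}_{(P,Q,\psi)}=\bigoplus_{i\in\mathbb{Z}}\mathcal{O}_i$ is well-defined. If $\mathcal{O}_{(P,Q,\psi)}$ is epsilon-strongly $\mathbb{Z}$-graded and $\mathrm{Ann}_{\mathcal{O}_0}(\mathcal{O}_1)\cap(\mathrm{Ann}_{\mathcal{O}_0}(\mathcal{O}_1))^\perp=\{0\}$, then $\mathcal{O}_{(P,Q,\psi)}\cong_{\mathrm{gr}}\mathcal{O}_{(P',Q',\psi')}$ for some ring $R'$ and some $R'$-system $(P',Q',\psi')$ whose Cuntz–Pimsner ring is well-defined and such that: (a) $(P',Q',\psi')$ is a unital $R'$-system; (b) the Cuntz–Pimsner representation $(\iota^{CP}_{P'},\iota^{CP}_{Q'},\iota^{CP}_{R'},\mathcal{O}_{(P',Q',\psi')})$ is semi-full; (c) $(P',Q',\psi')$ satisfies Condition (FS'); (d) the ideal $I^{(k)}_{\psi',\iota^{CP}_{R'}}$ is unital for every $k\ge0$. Conversely, if $(P',Q',\psi')$ is an $R'$-system whose Cuntz–Pimsner ring is well-defined and (a)–(d) hold, then $\mathcal{O}_{(P',Q',\psi')}$ is epsilon-strongly $\mathbb{Z}$-graded.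
   Context: Rings are associative but not necessarily unital. A $\mathbb{Z}$-graded ring is $S=\bigoplus_{i\in\mathbb{Z}}S_i$ with additive subgroups $S_i$ satisfying $S_mS_n\subseteq S_{m+n}$; for additive subsets $X,Y$, $XY$ denotes the additive subgroup generated by all products $xy$. $\cong_{\mathrm{gr}}$ denotes graded ring isomorphism. For rings $A,B$, an $A$-$B$-bimodule $M$ is s-unital if for every $x\in M$ there are $a\in A$, $b\in B$ with $ax=x=xb$, and unital if there are $a\in A$, $b\in B$ with $ax=x=xb$ for all $x\in M$. An ideal is called unital if, regarded as a ring, it has a multiplicative identity. A $\mathbb{Z}$-graded ring $S$ is epsilon-strongly graded if each $S_i$ is a unital $S_iS_{-i}$-$S_{-i}S_i$-bimodule. For a $\mathbb{Z}$-graded ring $A$, $\mathrm{Ann}_{A_0}(A_1)=\{r\in A_0: ra=0\ \forall a\in A_1\}$, and for an ideal $J$ of $A_0$, $J^\perp=\{r\in A_0: rx=xr=0\ \forall x\in J\}$. An $R$-system is a triple $(P,Q,\psi)$ with $P,Q$ $R$-bimodules and $\psi:P\otimes_RQ\to R$ an $R$-bimodule homomorphism. It is unital if $R$ is a unital ring and $P,Q$ are unital $R$-$R$-bimodules. Put $P^{\otimes0}=Q^{\otimes0}=R$, $\psi_0(r\otimes r')=rr'$, $\psi_1=\psi$, and for $n>1$: $Q^{\otimes n}=Q^{\otimes(n-1)}\otimes_RQ$, $P^{\otimes n}=P\otimes_RP^{\otimes(n-1)}$, $\psi_n((p_1\otimes p_2)\otimes(q_2\otimes q_1))=\psi(p_1\psi_{n-1}(p_2\otimes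 q_2)\otimes q_1)$. A covariant representation of $(P,Q,\psi)$ is a tuple $(S,T,\sigma,B)$ with $B$ a ring, $S:P\to B$, $T:Q\to B$ additive maps, $\sigma:R\to B$ a ring homomorphism, such that $S(pr)=S(p)\sigma(r)$, $S(rp)=\sigma(r)S(p)$, $T(qr)=T(q)\sigma(r)$, $T(rq)=\sigma(r)T(q)$ and $\sigma(\psi(p\otimes q))=S(p)T(q)$. It is surjective if $B$ is generated as a ring by $\sigma(R)\cup S(P)\cup T(Q)$, and graded if it is surjective and $B$ carries a $\mathbb{Z}$-grading with $\sigma(R)\subseteq B_0$, $T(Q)\subseteq B_1$, $S(P)\subseteq B_{-1}$. For a graded covariant representation and $k\ge0$, $I^{(k)}_{\psi,\sigma}$ is the ideal of $B_0$ generated by $\{\sigma(\psi_k(p\otimes q)):p\in P^{\otimes k},q\in Q^{\otimes k}\}$; the representation is semi-full if $B_{-k}B_k=I^{(k)}_{\psi,\sigma}$ for all $k\ge0$. For $q\in Q,p\in P$ let $\theta_{q,p}:Q\to Q$, $x\mapsto q\psi(p\otimes x)$, and $\theta_{p,q}:P\to P$, $y\mapsto\psi(y\otimes q)p$. $\mathcal{F}_P(Q)$ (resp. $\mathcal{F}_Q(P)$) is the additive group generated by all $\theta_{q,p}$ (resp. $\theta_{p,q}$). Condition (FS): for all finite sets $\{q_i\}\subseteq Q$, $\{p_j\}\subseteq P$ there are $\Theta\in\mathcal{F}_P(Q)$, $\Phi\in\mathcal{F}_Q(P)$ with $\Theta(q_i)=q_i$, $\Phi(p_j)=p_j$. Condition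 (FS'): there exist $\Theta\in\mathcal{F}_P(Q)$, $\Phi\in\mathcal{F}_Q(P)$ with $\Theta(q)=q$ and $\Phi(p)=p$ for all $q\in Q,p\in P$. Let $\Delta:R\to\mathrm{End}(Q_R)$, $\Delta(r)(q)=rq$. Under (FS), for each covariant representation there is a unique ring homomorphism $\pi_{T,S}:\mathcal{F}_P(Q)\to B$ with $\pi_{T,S}(\theta_{q,p})=T(q)S(p)$. The Toeplitz representation $(\iota_P,\iota_Q,\iota_R,\mathcal{T}_{(P,Q,\psi)})$ is the universal covariant representation; it is graded with $\mathcal{T}_i$ the additive group generated by the elements $\iota_Q^m(q)\iota_P^n(p)$ and $\iota_R(r)\iota_Q^m(q)\iota_P^n(p)$ with $q\in Q^{\otimes m},p\in P^{\otimes n}$, $m-n=i$ (here $\iota_Q^m(q_1\otimes\cdots\otimes q_m)=\iota_Q(q_1)\cdots\iota_Q(q_m)$, similarly for $\iota_P^n$, and $\iota^0=\iota_R$). Assume (FS) and let $\pi=\pi_{\iota_Q,\iota_P}$. An ideal $J\subseteq R$ is $\psi$-compatible if $\Delta(J)\subseteq\mathcal{F}_P(Q)$ and faithful if $J\cap\ker\Delta=\{0\}$. For $\psi$-compatible $J$, $\mathcal{T}(J)$ is the ideal of $\mathcal{T}_{(P,Q,\psi)}$ generated by $\{\iota_R(x)-\pi(\Delta(x)):x\in J\}$, $\mathcal{O}_{(P,Q,\psi)}(J)=\mathcal{T}_{(P,Q,\psi)}/\mathcal{T}(J)$ with quotient map $\rho$ and grading $\rho(\mathcal{T}_i)$, and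 $(\rho\iota_P,\rho\iota_Q,\rho\iota_R,\mathcal{O}(J))$ is the relative Cuntz–Pimsner representation. If there is a unique maximal $\psi$-compatible faithful ideal $J$, the Cuntz–Pimsner ring is (well-defined and equal to) $\mathcal{O}_{(P,Q,\psi)}=\mathcal{O}_{(P,Q,\psi)}(J)$, with Cuntz–Pimsner representation $(\iota^{CP}_P,\iota^{CP}_Q,\iota^{CP}_R,\mathcal{O}_{(P,Q,\psi)})$ the corresponding relative representation. *)

theory Defs
  imports Main
begin

record 'a rng =
  rcarrier :: "'a set"
  radd :: "'a \<Rightarrow> 'a \<Rightarrow> 'a"
  rmul :: "'a \<Rightarrow> 'a \<Rightarrow> 'a"
  rzero :: "'a"
  rneg :: "'a \<Rightarrow> 'a"

definition nu_ring :: "'a rng \<Rightarrow> bool" where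
  "nu_ring A \<longleftrightarrow>
     rzero A \<in> rcarrier A \<and>
     (\<forall>x\<in>rcarrier A. \<forall>y\<in>rcarrier A. radd A x y \<in> rcarrier A \<and> rmul A x y \<in> rcarrier A) \<and>
     (\<forall>x\<in>rcarrier A. rneg A x \<in> rcarrier A) \<and>
     (\<forall>x\<in>rcarrier A. \<forall>y\<in>rcarrier A. \<forall>z\<in>rcarrier A.
        radd A (radd A x y) z = radd A x (radd A y z) \<and>
        rmul A (rmul A x y) z = rmul A x (rmul A y z) \<and>
        rmul A x (radd A y z) = radd A (rmul A x y) (rmul A x z) \<and>
        rmul A (radd A x y) z = radd A (rmul A x z) (rmul A y z)) \<and>
     (\<forall>x\<in>rcarrier A. \<forall>y\<in>rcarrier A. radd A x y = radd A y x) \<and>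
     (\<forall>x\<in>rcarrier A. radd A (rzero A) x = x \<and> radd A (rneg A x) x = rzero A)"

definition rsum :: "'a rng \<Rightarrow> 'a list \<Rightarrow> 'a" where
  "rsum A xs = foldr (radd A) xs (rzero A)"

fun rprod :: "'a rng \<Rightarrow> 'a list \<Rightarrow> 'a" where
  "rprod A [] = rzero A"
| "rprod A [x] = x"
| "rprod A (x # y # ys) = rmul A x (rprod A (y # ys))"

definition addsub_gen :: "'a rng \<Rightarrow> 'a set \<Rightarrow> 'a set" where
  "addsub_gen A S = \<Inter>{H. H \<subseteq> rcarrier A \<and> rzero A \<in> H \<and>
       (\<forall>x\<in>H. \<forall>y\<in>H. radd A x y \<in> H) \<and> (\<forall>x\<in>H. rneg A x \<in> H) \<and> S \<subseteq> H}"

definition prod_set :: "'a rng \<Rightarrow> 'a set \<Rightarrow> 'a set \<Rightarrow> 'a set" where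
  "prod_set A X Y = addsub_gen A {rmul A x y | x y. x \<in> X \<and> y \<in> Y}"

definition is_ideal :: "'a rng \<Rightarrow> 'a set \<Rightarrow> bool" where
  "is_ideal A I \<longleftrightarrow> I \<subseteq> rcarrier A \<and> rzero A \<in> I \<and>
     (\<forall>x\<in>I. \<forall>y\<in>I. radd A x y \<in> I) \<and> (\<forall>x\<in>I. rneg A x \<in> I) \<and>
     (\<forall>x\<in>I. \<forall>a\<in>rcarrier A. rmul A a x \<in> I \<and> rmul A x a \<in> I)"

definition ideal_gen :: "'a rng \<Rightarrow> 'a set \<Rightarrow> 'a set" where
  "ideal_gen A S = \<Inter>{I. is_ideal A I \<and> S \<subseteq> I}"

definition unital_ideal :: "'a rng \<Rightarrow> 'a set \<Rightarrow> bool" where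
  "unital_ideal A I \<longleftrightarrow> (\<exists>e\<in>I. \<forall>x\<in>I. rmul A e x = x \<and> rmul A x e = x)"

definition unital_rng :: "'a rng \<Rightarrow> bool" where
  "unital_rng A \<longleftrightarrow> (\<exists>e\<in>rcarrier A. \<forall>x\<in>rcarrier A. rmul A e x = x \<and> rmul A x e = x)"

definition coset :: "'a rng \<Rightarrow> 'a set \<Rightarrow> 'a \<Rightarrow> 'a set" where
  "coset A I a = {radd A a i | i. i \<in> I}"

definition quot_rng :: "'a rng \<Rightarrow> 'a set \<Rightarrow> 'a set rng" where
  "quot_rng A I = \<lparr> rcarrier = coset A I ` rcarrier A,
     radd = (\<lambda>X Y. coset A I (radd A (SOME x. x \<in> X) (SOME y. y \<in> Y))),
     rmul = (\<lambda>X Y. coset A I (rmul A (SOME x. x \<in> X) (SOME y. y \<in> Y))),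
     rzero = coset A I (rzero A),
     rneg = (\<lambda>X. coset A I (rneg A (SOME x. x \<in> X))) \<rparr>"

record ('r, 'm) bimod =
  mcar :: "'m set"
  madd :: "'m \<Rightarrow> 'm \<Rightarrow> 'm"
  mzero :: "'m"
  mneg :: "'m \<Rightarrow> 'm"
  lact :: "'r \<Rightarrow> 'm \<Rightarrow> 'm"
  ract :: "'m \<Rightarrow> 'r \<Rightarrow> 'm"

definition msum :: "('r, 'm) bimod \<Rightarrow> 'm list \<Rightarrow> 'm" where
  "msum M xs = foldr (madd M) xs (mzero M)"

definition bimodule :: "'r rng \<Rightarrow> ('r, 'm) bimod \<Rightarrow> bool" where
  "bimodule R M \<longleftrightarrow>
     mzero M \<in> mcar M \<and>
     (\<forall>x\<in>mcar M. \<forall>y\<in>mcar M. madd M x y \<in> mcar M) \<and>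
     (\<forall>x\<in>mcar M. mneg M x \<in> mcar M) \<and>
     (\<forall>x\<in>mcar M. \<forall>y\<in>mcar M. \<forall>z\<in>mcar M. madd M (madd M x y) z = madd M x (madd M y z)) \<and>
     (\<forall>x\<in>mcar M. \<forall>y\<in>mcar M. madd M x y = madd M y x) \<and>
     (\<forall>x\<in>mcar M. madd M (mzero M) x = x \<and> madd M (mneg M x) x = mzero M) \<and>
     (\<forall>r\<in>rcarrier R. \<forall>x\<in>mcar M. lact M r x \<in> mcar M \<and> ract M x r \<in> mcar M) \<and>
     (\<forall>r\<in>rcarrier R. \<forall>x\<in>mcar M. \<forall>y\<in>mcar M.
        lact M r (madd M x y) = madd M (lact M r x) (lact M r y) \<and>
        ract M (madd M x y) r = madd M (ract M x r) (ract M y r)) \<and>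
     (\<forall>r\<in>rcarrier R. \<forall>s\<in>rcarrier R. \<forall>x\<in>mcar M.
        lact M (radd R r s) x = madd M (lact M r x) (lact M s x) \<and>
        ract M x (radd R r s) = madd M (ract M x r) (ract M x s) \<and>
        lact M (rmul R r s) x = lact M r (lact M s x) \<and>
        ract M x (rmul R r s) = ract M (ract M x r) s \<and>
        lact M r (ract M x s) = ract M (lact M r x) s)"

text \<open>An $R$-bimodule homomorphism $\psi : P \otimes_R Q \to R$ is represented (via the universal
  property of the tensor product) by an $R$-balanced biadditive map $\psi : P \times Q \to R$
  with $\psi(rp,q) = r\psi(p,q)$ and $\psi(p,qr) = \psi(p,q)r$.\<close>

definition rsystem :: "'r rng \<Rightarrow> ('r,'p) bimod \<Rightarrow> ('r,'q) bimod \<Rightarrow> ('p \<Rightarrow> 'q \<Rightarrow> 'r) \<Rightarrow> bool" where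
  "rsystem R P Q psi \<longleftrightarrow> nu_ring R \<and> bimodule R P \<and> bimodule R Q \<and>
     (\<forall>p\<in>mcar P. \<forall>q\<in>mcar Q. psi p q \<in> rcarrier R) \<and>
     (\<forall>p\<in>mcar P. \<forall>p'\<in>mcar P. \<forall>q\<in>mcar Q. psi (madd P p p') q = radd R (psi p q) (psi p' q)) \<and>
     (\<forall>p\<in>mcar P. \<forall>q\<in>mcar Q. \<forall>q'\<in>mcar Q. psi p (madd Q q q') = radd R (psi p q) (psi p q')) \<and>
     (\<forall>r\<in>rcarrier R. \<forall>p\<in>mcar P. \<forall>q\<in>mcar Q.
        psi (ract P p r) q = psi p (lact Q r q) \<and>
        psi (lact P r p) q = rmul R r (psi p q) \<and>
        psi p (ract Q q r) = rmul R (psi p q) r)"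

definition unital_bimod :: "'r rng \<Rightarrow> ('r,'m) bimod \<Rightarrow> bool" where
  "unital_bimod R M \<longleftrightarrow> (\<exists>a\<in>rcarrier R. \<exists>b\<in>rcarrier R. \<forall>x\<in>mcar M. lact M a x = x \<and> ract M x b = x)"

definition unital_system :: "'r rng \<Rightarrow> ('r,'p) bimod \<Rightarrow> ('r,'q) bimod \<Rightarrow> bool" where
  "unital_system R P Q \<longleftrightarrow> unital_rng R \<and> unital_bimod R P \<and> unital_bimod R Q"

text \<open>$\psi_k$ on elementary tensors $p_1\otimes\cdots\otimes p_k \in P^{\otimes k}$ and
  $x_1\otimes\cdots\otimes x_k \in Q^{\otimes k}$ (lists in this order), $k \ge 1$:
  $\psi_k((p_1\otimes p')\otimes(q'\otimes x_k)) = \psi(p_1\psi_{k-1}(p'\otimes q')\otimes x_k)$.\<close>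

fun psik :: "('p \<Rightarrow> 'q \<Rightarrow> 'r) \<Rightarrow> ('p \<Rightarrow> 'r \<Rightarrow> 'p) \<Rightarrow> 'p list \<Rightarrow> 'q list \<Rightarrow> 'r" where
  "psik psi ra [] qs = undefined"
| "psik psi ra [p] qs = psi p (last qs)"
| "psik psi ra (p # p' # ps) qs = psi (ra p (psik psi ra (p' # ps) (butlast qs))) (last qs)"

text \<open>Values of $\psi_k$ on elementary tensors (these generate the same ideal as all values).\<close>
definition psi_vals :: "'r rng \<Rightarrow> ('r,'p) bimod \<Rightarrow> ('r,'q) bimod \<Rightarrow> ('p \<Rightarrow> 'q \<Rightarrow> 'r) \<Rightarrow> nat \<Rightarrow> 'r set" where
  "psi_vals R P Q psi k = (if k = 0 then {rmul R r r' | r r'. r \<in> rcarrier R \<and> r' \<in> rcarrier R}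
     else {psik psi (ract P) ps qs | ps qs. set ps \<subseteq> mcar P \<and> set qs \<subseteq> mcar Q \<and>
                                       length ps = k \<and> length qs = k})"

definition in_FPQ :: "'r rng \<Rightarrow> ('r,'p) bimod \<Rightarrow> ('r,'q) bimod \<Rightarrow> ('p \<Rightarrow> 'q \<Rightarrow> 'r) \<Rightarrow> ('q \<Rightarrow> 'q) \<Rightarrow> bool" where
  "in_FPQ R P Q psi Th \<longleftrightarrow> (\<exists>l. set l \<subseteq> mcar Q \<times> mcar P \<and>
     (\<forall>x\<in>mcar Q. Th x = msum Q (map (\<lambda>(q,p). ract Q q (psi p x)) l)))"

definition in_FQP :: "'r rng \<Rightarrow> ('r,'p) bimod \<Rightarrow> ('r,'q) bimod \<Rightarrow> ('p \<Rightarrow> 'q \<Rightarrow> 'r) \<Rightarrow> ('p \<Rightarrow> 'p) \<Rightarrow> bool" where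
  "in_FQP R P Q psi Ph \<longleftrightarrow> (\<exists>l. set l \<subseteq> mcar P \<times> mcar Q \<and>
     (\<forall>y\<in>mcar P. Ph y = msum P (map (\<lambda>(p,q). lact P (psi y q) p) l)))"

definition cond_FS :: "'r rng \<Rightarrow> ('r,'p) bimod \<Rightarrow> ('r,'q) bimod \<Rightarrow> ('p \<Rightarrow> 'q \<Rightarrow> 'r) \<Rightarrow> bool" where
  "cond_FS R P Q psi \<longleftrightarrow> (\<forall>qs ps. finite qs \<and> qs \<subseteq> mcar Q \<and> finite ps \<and> ps \<subseteq> mcar P \<longrightarrow>
     (\<exists>Th Ph. in_FPQ R P Q psi Th \<and> in_FQP R P Q psi Ph \<and>
        (\<forall>q\<in>qs. Th q = q) \<and> (\<forall>p\<in>ps. Ph p = p)))"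

definition cond_FS' :: "'r rng \<Rightarrow> ('r,'p) bimod \<Rightarrow> ('r,'q) bimod \<Rightarrow> ('p \<Rightarrow> 'q \<Rightarrow> 'r) \<Rightarrow> bool" where
  "cond_FS' R P Q psi \<longleftrightarrow> (\<exists>Th Ph. in_FPQ R P Q psi Th \<and> in_FQP R P Q psi Ph \<and>
        (\<forall>q\<in>mcar Q. Th q = q) \<and> (\<forall>p\<in>mcar P. Ph p = p))"

definition psi_compatible :: "'r rng \<Rightarrow> ('r,'p) bimod \<Rightarrow> ('r,'q) bimod \<Rightarrow> ('p \<Rightarrow> 'q \<Rightarrow> 'r) \<Rightarrow> 'r set \<Rightarrow> bool" where
  "psi_compatible R P Q psi J \<longleftrightarrow> is_ideal R J \<and> (\<forall>x\<in>J. in_FPQ R P Q psi (lact Q x))"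

definition faithful_ideal :: "'r rng \<Rightarrow> ('r,'q) bimod \<Rightarrow> 'r set \<Rightarrow> bool" where
  "faithful_ideal R Q J \<longleftrightarrow> (\<forall>x\<in>J. (\<forall>q\<in>mcar Q. lact Q x q = mzero Q) \<longrightarrow> x = rzero R)"

definition max_cf_ideal :: "'r rng \<Rightarrow> ('r,'p) bimod \<Rightarrow> ('r,'q) bimod \<Rightarrow> ('p \<Rightarrow> 'q \<Rightarrow> 'r) \<Rightarrow> 'r set \<Rightarrow> bool" where
  "max_cf_ideal R P Q psi J \<longleftrightarrow> psi_compatible R P Q psi J \<and> faithful_ideal R Q J \<and>
     (\<forall>J'. psi_compatible R P Q psi J' \<and> faithful_ideal R Q J' \<and> J \<subseteq> J' \<longrightarrow> J' = J)"

definition cp_well_defined :: "'r rng \<Rightarrow> ('r,'p) bimod \<Rightarrow> ('r,'q) bimod \<Rightarrow> ('p \<Rightarrow> 'q \<Rightarrow> 'r) \<Rightarrow> bool" where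
  "cp_well_defined R P Q psi \<longleftrightarrow> (\<exists>!J. max_cf_ideal R P Q psi J)"

definition cp_ideal :: "'r rng \<Rightarrow> ('r,'p) bimod \<Rightarrow> ('r,'q) bimod \<Rightarrow> ('p \<Rightarrow> 'q \<Rightarrow> 'r) \<Rightarrow> 'r set" where
  "cp_ideal R P Q psi = (THE J. max_cf_ideal R P Q psi J)"

definition free_rng :: "'g set \<Rightarrow> ('g list \<Rightarrow> int) rng" where
  "free_rng G = \<lparr> rcarrier = {f. finite {w. f w \<noteq> 0} \<and> (\<forall>w. f w \<noteq> 0 \<longrightarrow> w \<noteq> [] \<and> set w \<subseteq> G)},
     radd = (\<lambda>f g w. f w + g w),
     rmul = (\<lambda>f g w. \<Sum>i\<le>length w. f (take i w) * g (drop i w)),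
     rzero = (\<lambda>w. 0),
     rneg = (\<lambda>f w. - f w) \<rparr>"

definition fr_gen :: "'g \<Rightarrow> 'g list \<Rightarrow> int" where
  "fr_gen x = (\<lambda>w. if w = [x] then 1 else 0)"

type_synonym ('r,'p,'q) fgen = "'r + 'p + 'q"
type_synonym ('r,'p,'q) felt = "('r,'p,'q) fgen list \<Rightarrow> int"
type_synonym ('r,'p,'q) telt = "('r,'p,'q) felt set"
type_synonym ('r,'p,'q) cpelt = "('r,'p,'q) telt set"

definition gens :: "'r rng \<Rightarrow> ('r,'p) bimod \<Rightarrow> ('r,'q) bimod \<Rightarrow> ('r,'p,'q) fgen set" where
  "gens R P Q = Inl ` rcarrier R \<union> Inr ` Inl ` mcar P \<union> Inr ` Inr ` mcar Q"

definition FR :: "'r rng \<Rightarrow> ('r,'p) bimod \<Rightarrow> ('r,'q) bimod \<Rightarrow> ('r,'p,'q) felt rng" where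
  "FR R P Q = free_rng (gens R P Q)"

definition gR :: "'r \<Rightarrow> ('r,'p,'q) felt" where "gR r = fr_gen (Inl r)"
definition gP :: "'p \<Rightarrow> ('r,'p,'q) felt" where "gP p = fr_gen (Inr (Inl p))"
definition gQ :: "'q \<Rightarrow> ('r,'p,'q) felt" where "gQ q = fr_gen (Inr (Inr q))"

text \<open>Relations of a covariant representation: \<open>\<sigma>\<close> ring hom, \<open>S\<close>, \<open>T\<close> additive and
  bimodule-compatible, \<open>\<sigma>(\<psi>(p\<otimes>q)) = S(p)T(q)\<close>.\<close>
definition toep_rels :: "'r rng \<Rightarrow> ('r,'p) bimod \<Rightarrow> ('r,'q) bimod \<Rightarrow> ('p \<Rightarrow> 'q \<Rightarrow> 'r) \<Rightarrow> ('r,'p,'q) felt set" where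
  "toep_rels R P Q psi = (let F = FR R P Q; sub = (\<lambda>a b. radd F a (rneg F b)) in
       {sub (gR (radd R r s)) (radd F (gR r) (gR s)) | r s. r \<in> rcarrier R \<and> s \<in> rcarrier R}
     \<union> {sub (gR (rmul R r s)) (rmul F (gR r) (gR s)) | r s. r \<in> rcarrier R \<and> s \<in> rcarrier R}
     \<union> {sub (gP (madd P p p')) (radd F (gP p) (gP p')) | p p'. p \<in> mcar P \<and> p' \<in> mcar P}
     \<union> {sub (gQ (madd Q q q')) (radd F (gQ q) (gQ q')) | q q'. q \<in> mcar Q \<and> q' \<in> mcar Q}
     \<union> {sub (gP (ract P p r)) (rmul F (gP p) (gR r)) | p r. p \<in> mcar P \<and> r \<in> rcarrier R}
     \<union> {sub (gP (lact P r p)) (rmul F (gR r) (gP p)) | p r. p \<in> mcar P \<and> r \<in> rcarrier R}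
     \<union> {sub (gQ (ract Q q r)) (rmul F (gQ q) (gR r)) | q r. q \<in> mcar Q \<and> r \<in> rcarrier R}
     \<union> {sub (gQ (lact Q r q)) (rmul F (gR r) (gQ q)) | q r. q \<in> mcar Q \<and> r \<in> rcarrier R}
     \<union> {sub (gR (psi p q)) (rmul F (gP p) (gQ q)) | p q. p \<in> mcar P \<and> q \<in> mcar Q})"

definition toep_ker :: "'r rng \<Rightarrow> ('r,'p) bimod \<Rightarrow> ('r,'q) bimod \<Rightarrow> ('p \<Rightarrow> 'q \<Rightarrow> 'r) \<Rightarrow> ('r,'p,'q) felt set" where
  "toep_ker R P Q psi = ideal_gen (FR R P Q) (toep_rels R P Q psi)"

definition toeplitz :: "'r rng \<Rightarrow> ('r,'p) bimod \<Rightarrow> ('r,'q) bimod \<Rightarrow> ('p \<Rightarrow> 'q \<Rightarrow> 'r) \<Rightarrow> ('r,'p,'q) telt rng" where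
  "toeplitz R P Q psi = quot_rng (FR R P Q) (toep_ker R P Q psi)"

definition iotaR :: "'r rng \<Rightarrow> ('r,'p) bimod \<Rightarrow> ('r,'q) bimod \<Rightarrow> ('p \<Rightarrow> 'q \<Rightarrow> 'r) \<Rightarrow> 'r \<Rightarrow> ('r,'p,'q) telt" where
  "iotaR R P Q psi r = coset (FR R P Q) (toep_ker R P Q psi) (gR r)"
definition iotaP :: "'r rng \<Rightarrow> ('r,'p) bimod \<Rightarrow> ('r,'q) bimod \<Rightarrow> ('p \<Rightarrow> 'q \<Rightarrow> 'r) \<Rightarrow> 'p \<Rightarrow> ('r,'p,'q) telt" where
  "iotaP R P Q psi p = coset (FR R P Q) (toep_ker R P Q psi) (gP p)"
definition iotaQ :: "'r rng \<Rightarrow> ('r,'p) bimod \<Rightarrow> ('r,'q) bimod \<Rightarrow> ('p \<Rightarrow> 'q \<Rightarrow> 'r) \<Rightarrow> 'q \<Rightarrow> ('r,'p,'q) telt" where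
  "iotaQ R P Q psi q = coset (FR R P Q) (toep_ker R P Q psi) (gQ q)"

definition toep_monos :: "'r rng \<Rightarrow> ('r,'p) bimod \<Rightarrow> ('r,'q) bimod \<Rightarrow> ('p \<Rightarrow> 'q \<Rightarrow> 'r) \<Rightarrow> int \<Rightarrow> ('r,'p,'q) telt set" where
  "toep_monos R P Q psi i = (let T = toeplitz R P Q psi in
      {rprod T (map (iotaQ R P Q psi) qs @ map (iotaP R P Q psi) ps) | qs ps.
         set qs \<subseteq> mcar Q \<and> set ps \<subseteq> mcar P \<and> length qs + length ps > 0 \<and> int (length qs) - int (length ps) = i}
    \<union> {rprod T (iotaR R P Q psi r # map (iotaQ R P Q psi) qs @ map (iotaP R P Q psi) ps) | r qs ps.
         r \<in> rcarrier R \<and> set qs \<subseteq> mcar Q \<and> set ps \<subseteq> mcar P \<and> int (length qs) - int (length ps) = i})"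

definition toep_grading :: "'r rng \<Rightarrow> ('r,'p) bimod \<Rightarrow> ('r,'q) bimod \<Rightarrow> ('p \<Rightarrow> 'q \<Rightarrow> 'r) \<Rightarrow> int \<Rightarrow> ('r,'p,'q) telt set" where
  "toep_grading R P Q psi i = addsub_gen (toeplitz R P Q psi) (toep_monos R P Q psi i)"

text \<open>Generators \<open>\<iota>_R(x) - \<pi>(\<Delta>(x))\<close>, \<open>x \<in> J\<close>, where \<open>\<pi>(\<Sigma> \<theta>_{q_i,p_i}) = \<Sigma> \<iota>_Q(q_i)\<iota>_P(p_i)\<close>
  (all representations of \<open>\<Delta>(x)\<close> are used; under (FS) \<open>\<pi>\<close> is well-defined).\<close>
definition TJ_gens :: "'r rng \<Rightarrow> ('r,'p) bimod \<Rightarrow> ('r,'q) bimod \<Rightarrow> ('p \<Rightarrow> 'q \<Rightarrow> 'r) \<Rightarrow> 'r set \<Rightarrow> ('r,'p,'q) telt set" where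
  "TJ_gens R P Q psi J = (let T = toeplitz R P Q psi in
     {radd T (iotaR R P Q psi x)
        (rneg T (rsum T (map (\<lambda>(q,p). rmul T (iotaQ R P Q psi q) (iotaP R P Q psi p)) l))) | x l.
        x \<in> J \<and> set l \<subseteq> mcar Q \<times> mcar P \<and>
        (\<forall>y\<in>mcar Q. lact Q x y = msum Q (map (\<lambda>(q,p). ract Q q (psi p y)) l))})"

definition TJ :: "'r rng \<Rightarrow> ('r,'p) bimod \<Rightarrow> ('r,'q) bimod \<Rightarrow> ('p \<Rightarrow> 'q \<Rightarrow> 'r) \<Rightarrow> 'r set \<Rightarrow> ('r,'p,'q) telt set" where
  "TJ R P Q psi J = ideal_gen (toeplitz R P Q psi) (TJ_gens R P Q psi J)"

definition rel_cp :: "'r rng \<Rightarrow> ('r,'p) bimod \<Rightarrow> ('r,'q) bimod \<Rightarrow> ('p \<Rightarrow> 'q \<Rightarrow> 'r) \<Rightarrow> 'r set \<Rightarrow> ('r,'p,'q) cpelt rng" where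
  "rel_cp R P Q psi J = quot_rng (toeplitz R P Q psi) (TJ R P Q psi J)"

definition rel_rho :: "'r rng \<Rightarrow> ('r,'p) bimod \<Rightarrow> ('r,'q) bimod \<Rightarrow> ('p \<Rightarrow> 'q \<Rightarrow> 'r) \<Rightarrow> 'r set \<Rightarrow> ('r,'p,'q) telt \<Rightarrow> ('r,'p,'q) cpelt" where
  "rel_rho R P Q psi J = coset (toeplitz R P Q psi) (TJ R P Q psi J)"

definition rel_cp_grading :: "'r rng \<Rightarrow> ('r,'p) bimod \<Rightarrow> ('r,'q) bimod \<Rightarrow> ('p \<Rightarrow> 'q \<Rightarrow> 'r) \<Rightarrow> 'r set \<Rightarrow> int \<Rightarrow> ('r,'p,'q) cpelt set" where
  "rel_cp_grading R P Q psi J i = rel_rho R P Q psi J ` toep_grading R P Q psi i"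

definition cp_ring :: "'r rng \<Rightarrow> ('r,'p) bimod \<Rightarrow> ('r,'q) bimod \<Rightarrow> ('p \<Rightarrow> 'q \<Rightarrow> 'r) \<Rightarrow> ('r,'p,'q) cpelt rng" where
  "cp_ring R P Q psi = rel_cp R P Q psi (cp_ideal R P Q psi)"

definition cp_grading :: "'r rng \<Rightarrow> ('r,'p) bimod \<Rightarrow> ('r,'q) bimod \<Rightarrow> ('p \<Rightarrow> 'q \<Rightarrow> 'r) \<Rightarrow> int \<Rightarrow> ('r,'p,'q) cpelt set" where
  "cp_grading R P Q psi = rel_cp_grading R P Q psi (cp_ideal R P Q psi)"

definition cp_iotaR :: "'r rng \<Rightarrow> ('r,'p) bimod \<Rightarrow> ('r,'q) bimod \<Rightarrow> ('p \<Rightarrow> 'q \<Rightarrow> 'r) \<Rightarrow> 'r \<Rightarrow> ('r,'p,'q) cpelt" where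
  "cp_iotaR R P Q psi r = rel_rho R P Q psi (cp_ideal R P Q psi) (iotaR R P Q psi r)"

definition eps_strongly_graded :: "'a rng \<Rightarrow> (int \<Rightarrow> 'a set) \<Rightarrow> bool" where
  "eps_strongly_graded A g \<longleftrightarrow> (\<forall>i. \<exists>a\<in>prod_set A (g i) (g (-i)). \<exists>b\<in>prod_set A (g (-i)) (g i).
      \<forall>x\<in>g i. rmul A a x = x \<and> rmul A x b = x)"

definition ann0 :: "'a rng \<Rightarrow> (int \<Rightarrow> 'a set) \<Rightarrow> 'a set" where
  "ann0 A g = {r \<in> g 0. \<forall>a\<in>g 1. rmul A r a = rzero A}"

definition perp0 :: "'a rng \<Rightarrow> (int \<Rightarrow> 'a set) \<Rightarrow> 'a set \<Rightarrow> 'a set" where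
  "perp0 A g J = {r \<in> g 0. \<forall>x\<in>J. rmul A r x = rzero A \<and> rmul A x r = rzero A}"

definition gr_iso :: "'a rng \<Rightarrow> (int \<Rightarrow> 'a set) \<Rightarrow> 'b rng \<Rightarrow> (int \<Rightarrow> 'b set) \<Rightarrow> bool" where
  "gr_iso A gA B gB \<longleftrightarrow> (\<exists>f. bij_betw f (rcarrier A) (rcarrier B) \<and>
     (\<forall>x\<in>rcarrier A. \<forall>y\<in>rcarrier A. f (radd A x y) = radd B (f x) (f y) \<and> f (rmul A x y) = rmul B (f x) (f y)) \<and>
     (\<forall>i. f ` gA i = gB i))"

definition cp_Ik :: "'r rng \<Rightarrow> ('r,'p) bimod \<Rightarrow> ('r,'q) bimod \<Rightarrow> ('p \<Rightarrow> 'q \<Rightarrow> 'r) \<Rightarrow> nat \<Rightarrow> ('r,'p,'q) cpelt set" where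
  "cp_Ik R P Q psi k = ideal_gen ((cp_ring R P Q psi)\<lparr>rcarrier := cp_grading R P Q psi 0\<rparr>)
        (cp_iotaR R P Q psi ` psi_vals R P Q psi k)"

definition cp_semi_full :: "'r rng \<Rightarrow> ('r,'p) bimod \<Rightarrow> ('r,'q) bimod \<Rightarrow> ('p \<Rightarrow> 'q \<Rightarrow> 'r) \<Rightarrow> bool" where
  "cp_semi_full R P Q psi \<longleftrightarrow> (\<forall>k::nat.
     prod_set (cp_ring R P Q psi) (cp_grading R P Q psi (- int k)) (cp_grading R P Q psi (int k))
       = cp_Ik R P Q psi k)"

end

theory Submission
  imports Defs "HOL-Algebra.FiniteProduct"
begin

text \<open>
  Write \<open>O\<close> for the Cuntz--Pimsner ring and take \<open>R' = O\<^sub>0\<close>, \<open>P' = O\<^bsub>-1\<^esub>\<close>, \<open>Q' = O\<^sub>1\<close> with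
  \<open>\<psi>'\<close> the multiplication. Epsilon-strongness makes \<open>I = O\<^sub>1O\<^bsub>-1\<^esub>\<close> an ideal of \<open>O\<^sub>0\<close> with an
  identity \<open>\<epsilon>\<close>, which acts as a left identity on \<open>O\<^sub>1\<close> and a right identity on \<open>O\<^bsub>-1\<^esub>\<close>; hence (FS')
  holds, every faithful ideal of \<open>O\<^sub>0\<close> lies in \<open>I\<close>, and \<open>I\<close> is the largest compatible faithful ideal.
  The inclusions of \<open>O\<^sub>0\<close>, \<open>O\<^bsub>-1\<^esub>\<close>, \<open>O\<^sub>1\<close> into \<open>O\<close> and the maps of \<open>R\<close>, \<open>P\<close>, \<open>Q\<close> into the new
  Cuntz--Pimsner ring \<open>O'\<close> are both covariant, so the universal properties yield homomorphisms
  \<open>O' \<rightarrow> O\<close> and \<open>O \<rightarrow> O'\<close>. They are mutually inverse because \<open>T(q)S(p) = \<sigma>(qp)\<close> in \<open>O'\<close>. In this way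
  the directness of the gradings is never needed.

  For the converse, (FS') gives \<open>\<Sum> T(q\<^sub>j)S(p\<^sub>j)\<close>, a left identity on \<open>O\<^sub>1\<close>; iterating
  \<open>\<epsilon>\<^bsub>k+1\<^esub> = \<Sum> T(q\<^sub>j)\<epsilon>\<^sub>kS(p\<^sub>j)\<close> gives left identities on \<open>O\<^sub>k\<close>, and similarly right identities on \<open>O\<^bsub>-k\<^esub>\<close>.
  The identity of \<open>O\<^bsub>-k\<^esub>O\<^sub>k = I\<^sup>(\<^sup>k\<^sup>)\<close> serves on the remaining sides.
\<close>

section \<open>Non-unital rings\<close>

text \<open>Taking all of \<open>O_0\<close> as coefficient ring makes each product
  \<open>q p\<close> with \<open>q\<close> in \<open>O_1\<close> and \<open>p\<close> in
  \<open>O_{-1}\<close> a coefficient. Left multiplication by it on \<open>O_1\<close> is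
  \<open>theta_{q,p}\<close>, so the covariance relation over \<open>I\<close> is what forces
  \<open>T(q)S(p) = sigma(q p)\<close> in \<open>O'\<close>. Two points carry the isomorphism. The
  map \<open>O' -> O\<close> needs the inclusions to satisfy that same relation: elements of
  \<open>I\<close> that agree as operators on \<open>O_1\<close> must be equal. This holds because
  the identity of \<open>I\<close> is itself a sum of products \<open>q p\<close>. Moreover
  \<open>O'\<close> is presented with the whole components \<open>O_0\<close>, \<open>O_1\<close>,
  \<open>O_{-1}\<close> as generators, so before \<open>O' -> O -> O'\<close> can be compared with
  the identity, \<open>O -> O'\<close> has to be evaluated on those components; this is done on
  words consisting of letters from \<open>Q\<close> followed by letters from \<open>P\<close>.
  Semi-fullness comes from unitality: then \<open>O_k\<close> is spanned by \<open>Q^k O_0\<close>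
  and \<open>O_{-k}\<close> by \<open>O_0 P^k\<close>, so \<open>O_{-k} O_k\<close> is the ideal of
  \<open>O_0\<close> generated by \<open>P^k Q^k\<close>, that is, by the values of
  \<open>psi_k\<close>.\<close>

notation radd (infixl "\<boxplus>\<index>" 65)
notation rmul (infixl "\<boxdot>\<index>" 70)
notation rneg ("\<boxminus>\<index> _" [81] 80)

section \<open>Additive subgroups, the spans they generate, and induction over spans\<close>

definition is_addsub :: "'a rng \<Rightarrow> 'a set \<Rightarrow> bool" where
  "is_addsub A H \<longleftrightarrow> H \<subseteq> rcarrier A \<and> rzero A \<in> H \<and>
     (\<forall>x\<in>H. \<forall>y\<in>H. radd A x y \<in> H) \<and> (\<forall>x\<in>H. rneg A x \<in> H)"

lemma addsub_gen_alt: "addsub_gen A S = \<Inter>{H. is_addsub A H \<and> S \<subseteq> H}"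
  unfolding addsub_gen_def is_addsub_def by (rule arg_cong[of _ _ Inter]) auto

lemma addsub_gen_least: "is_addsub A H \<Longrightarrow> S \<subseteq> H \<Longrightarrow> addsub_gen A S \<subseteq> H"
  unfolding addsub_gen_alt by auto

lemma addsub_gen_incl: "S \<subseteq> addsub_gen A S"
  unfolding addsub_gen_alt by auto

lemma ideal_gen_least: "is_ideal A I \<Longrightarrow> S \<subseteq> I \<Longrightarrow> ideal_gen A S \<subseteq> I"
  unfolding ideal_gen_def by auto

lemma ideal_gen_incl: "S \<subseteq> ideal_gen A S"
  unfolding ideal_gen_def by auto

lemma is_ideal_addsub: "is_ideal A I \<Longrightarrow> is_addsub A I"
  unfolding is_ideal_def is_addsub_def by auto

text \<open>Multiplication by a fixed element is additive without being a ring homomorphism; the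
  inductions over spans below are stated for such maps.\<close>

definition addhom :: "'a rng \<Rightarrow> 'b rng \<Rightarrow> ('a \<Rightarrow> 'b) \<Rightarrow> bool" where
  "addhom A B f \<longleftrightarrow> (\<forall>x\<in>rcarrier A. f x \<in> rcarrier B) \<and>
     (\<forall>x\<in>rcarrier A. \<forall>y\<in>rcarrier A. f (radd A x y) = radd B (f x) (f y))"

definition rhom :: "'a rng \<Rightarrow> 'b rng \<Rightarrow> ('a \<Rightarrow> 'b) \<Rightarrow> bool" where
  "rhom A B f \<longleftrightarrow> addhom A B f \<and>
     (\<forall>x\<in>rcarrier A. \<forall>y\<in>rcarrier A. f (rmul A x y) = rmul B (f x) (f y))"

lemma rhom_addhom: "rhom A B f \<Longrightarrow> addhom A B f"
  and rhom_mul: "rhom A B f \<Longrightarrow> x \<in> rcarrier A \<Longrightarrow> y \<in> rcarrier A \<Longrightarrow> f (rmul A x y) = rmul B (f x) (f y)"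
  by (auto simp: rhom_def)

lemma addhom_closed: "addhom A B f \<Longrightarrow> x \<in> rcarrier A \<Longrightarrow> f x \<in> rcarrier B"
  and addhom_add: "addhom A B f \<Longrightarrow> x \<in> rcarrier A \<Longrightarrow> y \<in> rcarrier A \<Longrightarrow> f (radd A x y) = radd B (f x) (f y)"
  by (auto simp: addhom_def)

lemma rhom_closed: "rhom A B f \<Longrightarrow> x \<in> rcarrier A \<Longrightarrow> f x \<in> rcarrier B"
  and rhom_add: "rhom A B f \<Longrightarrow> x \<in> rcarrier A \<Longrightarrow> y \<in> rcarrier A \<Longrightarrow> f (radd A x y) = radd B (f x) (f y)"
  by (auto simp: rhom_def addhom_def)

lemma addhom_comp: "addhom A B f \<Longrightarrow> addhom B C g \<Longrightarrow> addhom A C (\<lambda>x. g (f x))"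
  by (auto simp: addhom_def)

lemma rhom_comp: "rhom A B f \<Longrightarrow> rhom B C g \<Longrightarrow> rhom A C (\<lambda>x. g (f x))"
  by (auto simp: rhom_def addhom_def)

lemma addhom_id: "addhom A A (\<lambda>x. x)"
  by (auto simp: addhom_def)

locale nuring =
  fixes A :: "'a rng" (structure)
  assumes nu: "nu_ring A"
begin

lemma zero_closed [simp, intro]: "rzero A \<in> rcarrier A"
  and add_closed [simp, intro]: "x \<in> rcarrier A \<Longrightarrow> y \<in> rcarrier A \<Longrightarrow> x \<boxplus> y \<in> rcarrier A"
  and mul_closed [simp, intro]: "x \<in> rcarrier A \<Longrightarrow> y \<in> rcarrier A \<Longrightarrow> x \<boxdot> y \<in> rcarrier A"
  and neg_closed [simp, intro]: "x \<in> rcarrier A \<Longrightarrow> \<boxminus> x \<in> rcarrier A"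
  and add_assoc: "x \<in> rcarrier A \<Longrightarrow> y \<in> rcarrier A \<Longrightarrow> z \<in> rcarrier A \<Longrightarrow> x \<boxplus> y \<boxplus> z = x \<boxplus> (y \<boxplus> z)"
  and mul_assoc: "x \<in> rcarrier A \<Longrightarrow> y \<in> rcarrier A \<Longrightarrow> z \<in> rcarrier A \<Longrightarrow> x \<boxdot> y \<boxdot> z = x \<boxdot> (y \<boxdot> z)"
  and distl: "x \<in> rcarrier A \<Longrightarrow> y \<in> rcarrier A \<Longrightarrow> z \<in> rcarrier A \<Longrightarrow> x \<boxdot> (y \<boxplus> z) = x \<boxdot> y \<boxplus> x \<boxdot> z"
  and distr: "x \<in> rcarrier A \<Longrightarrow> y \<in> rcarrier A \<Longrightarrow> z \<in> rcarrier A \<Longrightarrow> (x \<boxplus> y) \<boxdot> z = x \<boxdot> z \<boxplus> y \<boxdot> z"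
  and add_comm: "x \<in> rcarrier A \<Longrightarrow> y \<in> rcarrier A \<Longrightarrow> x \<boxplus> y = y \<boxplus> x"
  and zero_add [simp]: "x \<in> rcarrier A \<Longrightarrow> rzero A \<boxplus> x = x"
  and neg_add [simp]: "x \<in> rcarrier A \<Longrightarrow> \<boxminus> x \<boxplus> x = rzero A"
  using nu unfolding nu_ring_def by blast+

lemma add_zero [simp]: "x \<in> rcarrier A \<Longrightarrow> x \<boxplus> rzero A = x"
  using add_comm[of x "rzero A"] by simp

lemma add_neg [simp]: "x \<in> rcarrier A \<Longrightarrow> x \<boxplus> \<boxminus> x = rzero A"
  using add_comm[of x "\<boxminus> x"] by simp

lemma neg_unique: "x \<in> rcarrier A \<Longrightarrow> y \<in> rcarrier A \<Longrightarrow> x \<boxplus> y = rzero A \<Longrightarrow> y = \<boxminus> x"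
  by (metis add_assoc add_zero neg_add neg_closed zero_add)

lemma neg_neg [simp]: "x \<in> rcarrier A \<Longrightarrow> \<boxminus> (\<boxminus> x) = x"
  by (metis neg_unique neg_add neg_closed)

lemma neg_zero [simp]: "\<boxminus> rzero A = rzero A"
  by (metis neg_unique zero_add zero_closed)

text \<open>Applied to the image of zero, this yields preservation of zero by additive maps, which
  \<open>addhom\<close> does not demand.\<close>

lemma idem_zero: "x \<in> rcarrier A \<Longrightarrow> x \<boxplus> x = x \<Longrightarrow> x = rzero A"
  by (metis add_assoc add_zero neg_add neg_closed zero_add add_neg)

lemma diff_zero: "x \<in> rcarrier A \<Longrightarrow> y \<in> rcarrier A \<Longrightarrow> x \<boxplus> \<boxminus> y = rzero A \<longleftrightarrow> x = y"
  by (metis add_neg neg_unique neg_neg neg_closed add_comm)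

lemma add_left_comm: "x \<in> rcarrier A \<Longrightarrow> y \<in> rcarrier A \<Longrightarrow> z \<in> rcarrier A \<Longrightarrow> x \<boxplus> (y \<boxplus> z) = y \<boxplus> (x \<boxplus> z)"
  by (metis add_assoc add_comm)

lemmas add_ac = add_assoc add_comm add_left_comm

lemma add_neg_cancel [simp]: "x \<in> rcarrier A \<Longrightarrow> y \<in> rcarrier A \<Longrightarrow> x \<boxplus> (\<boxminus> x \<boxplus> y) = y"
  and neg_add_cancel [simp]: "x \<in> rcarrier A \<Longrightarrow> y \<in> rcarrier A \<Longrightarrow> \<boxminus> x \<boxplus> (x \<boxplus> y) = y"
  and add_neg_cancel' [simp]: "x \<in> rcarrier A \<Longrightarrow> y \<in> rcarrier A \<Longrightarrow> x \<boxplus> (y \<boxplus> \<boxminus> x) = y"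
  by (simp_all add: add_comm[of y] flip: add_assoc)

lemma neg_add_distrib: "x \<in> rcarrier A \<Longrightarrow> y \<in> rcarrier A \<Longrightarrow> \<boxminus> (x \<boxplus> y) = \<boxminus> x \<boxplus> \<boxminus> y"
  by (rule neg_unique[symmetric]) (simp_all add: add_ac)

lemma addhom_zero:
  assumes "addhom B A f" "nu_ring B" shows "f (rzero B) = rzero A"
proof -
  interpret B: nuring B by standard fact
  show ?thesis using addhom_add[OF assms(1), of "rzero B" "rzero B"] addhom_closed[OF assms(1), of "rzero B"]
    by (intro idem_zero) auto
qed

lemma addhom_neg:
  assumes "addhom B A f" "nu_ring B" "x \<in> rcarrier B" shows "f (rneg B x) = \<boxminus> f x"
proof -
  interpret B: nuring B by standard fact
  show ?thesis using addhom_add[OF assms(1), of x "rneg B x"] addhom_closed[OF assms(1)] assms addhom_zero[OF assms(1,2)]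
    by (intro neg_unique) auto
qed

lemma addhom_lmul: "a \<in> rcarrier A \<Longrightarrow> addhom A A (\<lambda>x. a \<boxdot> x)"
  and addhom_rmul: "a \<in> rcarrier A \<Longrightarrow> addhom A A (\<lambda>x. x \<boxdot> a)"
  by (auto simp: addhom_def distl distr)

lemma mul_zero [simp]: "x \<in> rcarrier A \<Longrightarrow> x \<boxdot> rzero A = rzero A"
  and zero_mul [simp]: "x \<in> rcarrier A \<Longrightarrow> rzero A \<boxdot> x = rzero A"
  using addhom_zero[OF addhom_lmul nu] addhom_zero[OF addhom_rmul nu] by auto

lemma neg_mul: "x \<in> rcarrier A \<Longrightarrow> y \<in> rcarrier A \<Longrightarrow> \<boxminus> x \<boxdot> y = \<boxminus> (x \<boxdot> y)"
  using addhom_neg[OF addhom_rmul nu] by auto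

lemma is_addsub_carrier: "is_addsub A (rcarrier A)"
  by (auto simp: is_addsub_def)

lemma is_addsub_gen: "S \<subseteq> rcarrier A \<Longrightarrow> is_addsub A (addsub_gen A S)"
  using is_addsub_carrier unfolding addsub_gen_alt is_addsub_def by blast

lemma addsub_gen_carrier: "S \<subseteq> rcarrier A \<Longrightarrow> addsub_gen A S \<subseteq> rcarrier A"
  by (intro addsub_gen_least is_addsub_carrier)

lemma addsub_preimage:
  assumes "is_addsub A H" "addhom B A f" "nu_ring B" shows "is_addsub B {x \<in> rcarrier B. f x \<in> H}"
proof -
  interpret B: nuring B by standard fact
  show ?thesis using assms by (auto simp: is_addsub_def addhom_zero addhom_neg addhom_add)
qed

lemma addsub_equalizer:
  assumes "addhom B A f" "addhom B A g" "nu_ring B" shows "is_addsub B {x \<in> rcarrier B. f x = g x}"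
proof -
  interpret B: nuring B by standard fact
  show ?thesis using assms by (auto simp: is_addsub_def addhom_zero addhom_neg addhom_add)
qed

text \<open>The set where two additive maps agree is a subgroup, so it contains a span once it
  contains the generators. With multiplications as the maps, this reduces ring identities to words
  or to products.\<close>

lemma addsub_gen_eqI:
  assumes "x \<in> addsub_gen A S" "S \<subseteq> rcarrier A" "nu_ring B" "addhom A B f" "addhom A B g"
    "\<And>x. x \<in> S \<Longrightarrow> f x = g x"
  shows "f x = g x"
proof -
  interpret B: nuring B by standard fact
  show ?thesis
    using addsub_gen_least[OF B.addsub_equalizer[OF assms(4,5) nu], of S] assms by auto
qed

lemma addsub_gen_memI:
  assumes "x \<in> addsub_gen A S" "S \<subseteq> rcarrier A" "nu_ring B" "addhom A B f" "is_addsub B H"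
    "\<And>x. x \<in> S \<Longrightarrow> f x \<in> H"
  shows "f x \<in> H"
proof -
  interpret B: nuring B by standard fact
  show ?thesis
    using addsub_gen_least[OF B.addsub_preimage[OF assms(5,4) nu], of S] assms by auto
qed

lemma addsub_image:
  assumes "is_addsub B H" "addhom B A f" "nu_ring B" shows "is_addsub A (f ` H)"
proof -
  interpret B: nuring B by standard fact
  have H: "H \<subseteq> rcarrier B" using assms by (auto simp: is_addsub_def)
  show ?thesis unfolding is_addsub_def
  proof (intro conjI ballI)
    show "f ` H \<subseteq> rcarrier A" using H assms(2) by (auto simp: addhom_def)
    show "rzero A \<in> f ` H" using assms addhom_zero[OF assms(2,3)] by (auto simp: is_addsub_def image_iff intro!: bexI[of _ "rzero B"])
    fix x assume "x \<in> f ` H"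
    then obtain a where a: "a \<in> H" "x = f a" by auto
    show "\<boxminus> x \<in> f ` H" using a H assms(1) addhom_neg[OF assms(2,3), of a] by (auto simp: is_addsub_def intro!: image_eqI[of _ _ "rneg B a"])
    fix y assume "y \<in> f ` H"
    then obtain b where b: "b \<in> H" "y = f b" by auto
    show "x \<boxplus> y \<in> f ` H" using a b H assms(1) addhom_add[OF assms(2), of a b] by (auto simp: is_addsub_def subset_iff intro!: image_eqI[of _ _ "radd B a b"])
  qed
qed

text \<open>Preimages of subgroups give one inclusion, images the other. It carries the span that
  defines the Toeplitz grading along the quotient map.\<close>

lemma addsub_gen_image:
  assumes "S \<subseteq> rcarrier B" "addhom B A f" "nu_ring B"
  shows "f ` addsub_gen B S = addsub_gen A (f ` S)"
proof
  interpret B: nuring B by standard fact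
  have fS: "f ` S \<subseteq> rcarrier A" using assms by (auto simp: addhom_def)
  show "f ` addsub_gen B S \<subseteq> addsub_gen A (f ` S)"
    using B.addsub_gen_memI[OF _ assms(1) nu assms(2) is_addsub_gen[OF fS]] addsub_gen_incl[of "f ` S" A] by auto
  show "addsub_gen A (f ` S) \<subseteq> f ` addsub_gen B S"
    by (intro addsub_gen_least addsub_image[OF B.is_addsub_gen] assms image_mono addsub_gen_incl)
qed

lemma prods_carrier: "X \<subseteq> rcarrier A \<Longrightarrow> Y \<subseteq> rcarrier A \<Longrightarrow> {x \<boxdot> y | x y. x \<in> X \<and> y \<in> Y} \<subseteq> rcarrier A"
  by auto

lemma is_addsub_prod_set: "X \<subseteq> rcarrier A \<Longrightarrow> Y \<subseteq> rcarrier A \<Longrightarrow> is_addsub A (prod_set A X Y)"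
  unfolding prod_set_def by (intro is_addsub_gen prods_carrier)

lemma prod_setI: "x \<in> X \<Longrightarrow> y \<in> Y \<Longrightarrow> x \<boxdot> y \<in> prod_set A X Y"
  unfolding prod_set_def by (rule subsetD[OF addsub_gen_incl]) auto

lemma prod_set_least: "is_addsub A H \<Longrightarrow> (\<And>x y. x \<in> X \<Longrightarrow> y \<in> Y \<Longrightarrow> x \<boxdot> y \<in> H) \<Longrightarrow> prod_set A X Y \<subseteq> H"
  unfolding prod_set_def by (intro addsub_gen_least) auto

lemma prod_set_eqI:
  assumes "z \<in> prod_set A X Y" "X \<subseteq> rcarrier A" "Y \<subseteq> rcarrier A" "nu_ring B" "addhom A B f" "addhom A B g"
    "\<And>x y. x \<in> X \<Longrightarrow> y \<in> Y \<Longrightarrow> f (x \<boxdot> y) = g (x \<boxdot> y)"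
  shows "f z = g z"
  using assms(1) unfolding prod_set_def
  by (rule addsub_gen_eqI[OF _ _ assms(4-6)]) (use assms(2,3,7) in auto)

lemma prod_set_memI:
  assumes "z \<in> prod_set A X Y" "X \<subseteq> rcarrier A" "Y \<subseteq> rcarrier A" "nu_ring B" "addhom A B f" "is_addsub B H"
    "\<And>x y. x \<in> X \<Longrightarrow> y \<in> Y \<Longrightarrow> f (x \<boxdot> y) \<in> H"
  shows "f z \<in> H"
  using assms(1) unfolding prod_set_def
  by (rule addsub_gen_memI[OF _ _ assms(4-6)]) (use assms(2,3,7) in auto)

lemma rsum_Nil [simp]: "rsum A [] = rzero A"
  and rsum_Cons [simp]: "rsum A (x # xs) = x \<boxplus> rsum A xs"
  by (auto simp: rsum_def)

lemma rsum_closed: "set xs \<subseteq> rcarrier A \<Longrightarrow> rsum A xs \<in> rcarrier A"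
  by (induction xs) auto

lemma rsum_in_addsub: "is_addsub A H \<Longrightarrow> set xs \<subseteq> H \<Longrightarrow> rsum A xs \<in> H"
  by (induction xs) (auto simp: is_addsub_def)

lemma addhom_rsum:
  assumes "addhom B A f" "nu_ring B" "set xs \<subseteq> rcarrier B" shows "f (rsum B xs) = rsum A (map f xs)"
proof -
  interpret B: nuring B by standard fact
  show ?thesis using assms(3)
    by (induction xs) (use assms(1,2) in \<open>auto simp: addhom_zero addhom_add B.rsum_closed\<close>)
qed

lemma rsum_append: "set xs \<subseteq> rcarrier A \<Longrightarrow> set ys \<subseteq> rcarrier A \<Longrightarrow> rsum A (xs @ ys) = rsum A xs \<boxplus> rsum A ys"
  by (induction xs) (auto simp: add_assoc rsum_closed)

text \<open>The finite sums of products already form a subgroup: a minus sign is moved into the left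
  factor, where \<open>X\<close> absorbs it.\<close>

lemma prod_set_list:
  assumes X: "is_addsub A X" and Y: "Y \<subseteq> rcarrier A" and z: "z \<in> prod_set A X Y"
  shows "\<exists>l. set l \<subseteq> X \<times> Y \<and> z = rsum A (map (\<lambda>(x,y). x \<boxdot> y) l)"
proof -
  let ?m = "map (\<lambda>(x,y). x \<boxdot> y)"
  let ?H = "{rsum A (?m l) | l. set l \<subseteq> X \<times> Y}"
  have XA: "X \<subseteq> rcarrier A" using X by (auto simp: is_addsub_def)
  have c: "set (?m l) \<subseteq> rcarrier A" if "set l \<subseteq> X \<times> Y" for l using that XA Y by auto
  have ng: "\<boxminus> (rsum A (?m l)) = rsum A (?m (map (\<lambda>(x,y). (\<boxminus> x, y)) l))" if "set l \<subseteq> X \<times> Y" for l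
    using that
  proof (induction l)
    case (Cons a l)
    obtain x y where "a = (x, y)" "x \<in> rcarrier A" "y \<in> rcarrier A" using Cons.prems XA Y by (cases a) auto
    then show ?case using Cons rsum_closed[OF c, of l] by (simp add: neg_add_distrib neg_mul)
  qed simp
  have "is_addsub A ?H" unfolding is_addsub_def
  proof (intro conjI ballI)
    show "?H \<subseteq> rcarrier A" using rsum_closed[OF c] by blast
    show "rzero A \<in> ?H" by (auto intro!: exI[of _ "[]"])
    fix x assume "x \<in> ?H"
    then obtain l where l: "set l \<subseteq> X \<times> Y" "x = rsum A (?m l)" by auto
    show "\<boxminus> x \<in> ?H" unfolding l ng[OF l(1)] using l(1) X
      by (fastforce simp: is_addsub_def intro!: exI[of _ "map (\<lambda>(x,y). (\<boxminus> x, y)) l"])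
    fix y assume "y \<in> ?H"
    then obtain l' where l': "set l' \<subseteq> X \<times> Y" "y = rsum A (?m l')" by auto
    show "x \<boxplus> y \<in> ?H" using l l' rsum_append[OF c c, OF l(1) l'(1)] by (auto intro!: exI[of _ "l @ l'"])
  qed
  moreover have "x \<boxdot> y \<in> ?H" if "x \<in> X" "y \<in> Y" for x y
  proof -
    have "x \<boxdot> y \<in> rcarrier A" using that XA Y by auto
    then show ?thesis using that XA Y by (auto intro!: exI[of _ "[(x,y)]"])
  qed
  ultimately have "prod_set A X Y \<subseteq> ?H" by (rule prod_set_least)
  then show ?thesis using z by auto
qed

lemma is_ideal_carrier: "is_ideal A (rcarrier A)"
  by (auto simp: is_ideal_def)

lemma is_ideal_gen: "S \<subseteq> rcarrier A \<Longrightarrow> is_ideal A (ideal_gen A S)"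
proof -
  assume S: "S \<subseteq> rcarrier A"
  then have "ideal_gen A S \<subseteq> rcarrier A" by (intro ideal_gen_least is_ideal_carrier)
  then show ?thesis unfolding is_ideal_def by (auto simp: ideal_gen_def is_ideal_def)
qed

lemma is_ideal_kernel:
  assumes "rhom A B f" "nu_ring B" shows "is_ideal A {x \<in> rcarrier A. f x = rzero B}"
proof -
  interpret B: nuring B by standard fact
  note h = rhom_addhom[OF assms(1)]
  have z: "f (rzero A) = rzero B" using B.addhom_zero[OF h nu] .
  show ?thesis using assms z B.addhom_neg[OF h nu]
    by (auto simp: is_ideal_def addhom_add[OF h] rhom_mul[OF assms(1)] addhom_closed[OF h])
qed

lemma rprod_closed: "xs \<noteq> [] \<Longrightarrow> set xs \<subseteq> rcarrier A \<Longrightarrow> rprod A xs \<in> rcarrier A"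
  by (induction xs rule: induct_list012) auto

lemma rprod_Cons: "xs \<noteq> [] \<Longrightarrow> rprod A (x # xs) = x \<boxdot> rprod A xs"
  by (cases xs) auto

lemma rprod_append: "xs \<noteq> [] \<Longrightarrow> ys \<noteq> [] \<Longrightarrow> set xs \<subseteq> rcarrier A \<Longrightarrow> set ys \<subseteq> rcarrier A \<Longrightarrow>
    rprod A (xs @ ys) = rprod A xs \<boxdot> rprod A ys"
proof (induction xs)
  case (Cons x xs)
  then show ?case
    by (cases "xs = []") (simp_all add: rprod_Cons mul_assoc rprod_closed)
qed simp

lemma rhom_rprod:
  assumes "rhom A B f" "xs \<noteq> []" "set xs \<subseteq> rcarrier A" shows "f (rprod A xs) = rprod B (map f xs)"
  using assms(2,3)
proof (induction xs)
  case (Cons x xs)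
  then show ?case
    by (cases xs) (simp_all add: rhom_mul[OF assms(1)] rprod_closed)
qed auto

subsection \<open>Quotients\<close>

context
  fixes I assumes I: "is_ideal A I"
begin

lemma ideal_carrier: "x \<in> I \<Longrightarrow> x \<in> rcarrier A"
  using I by (auto simp: is_ideal_def)

lemma coset_self: "a \<in> rcarrier A \<Longrightarrow> a \<in> coset A I a"
  using I by (auto simp: coset_def is_ideal_def intro!: exI[of _ "rzero A"])

lemma coset_eq: 
  assumes "a \<in> rcarrier A" "b \<in> rcarrier A" shows "coset A I a = coset A I b \<longleftrightarrow> a \<boxplus> \<boxminus> b \<in> I"
proof
  assume "coset A I a = coset A I b"
  then have "a \<in> coset A I b" using coset_self assms by auto
  then obtain i where i: "i \<in> I" "a = b \<boxplus> i" by (auto simp: coset_def)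
  then have "a \<boxplus> \<boxminus> b = i" using assms ideal_carrier by (metis add_assoc add_comm add_neg add_zero neg_closed)
  then show "a \<boxplus> \<boxminus> b \<in> I" using i by simp
next
  have *: "coset A I a \<subseteq> coset A I b" if ab: "a \<in> rcarrier A" "b \<in> rcarrier A" and d: "a \<boxplus> \<boxminus> b \<in> I" for a b
  proof
    fix x assume "x \<in> coset A I a"
    then obtain i where i: "i \<in> I" "x = a \<boxplus> i" by (auto simp: coset_def)
    have "x = b \<boxplus> ((a \<boxplus> \<boxminus> b) \<boxplus> i)" using i ab ideal_carrier[OF i(1)]
      by (simp add: add_ac)
    moreover have "(a \<boxplus> \<boxminus> b) \<boxplus> i \<in> I" using I d i by (auto simp: is_ideal_def)
    ultimately show "x \<in> coset A I b" by (auto simp: coset_def)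
  qed
  assume d: "a \<boxplus> \<boxminus> b \<in> I"
  then have "\<boxminus> (a \<boxplus> \<boxminus> b) \<in> I" using I by (auto simp: is_ideal_def)
  then have "b \<boxplus> \<boxminus> a \<in> I" using assms by (simp add: neg_add_distrib add_comm)
  then show "coset A I a = coset A I b" using * d assms by blast
qed

lemma coset_eqI:
  assumes "a \<in> rcarrier A" "b \<in> rcarrier A" "i \<in> I" "a = b \<boxplus> i" shows "coset A I a = coset A I b"
proof -
  have "a \<boxplus> \<boxminus> b = i" using assms ideal_carrier by (metis add_assoc add_comm add_neg add_zero neg_closed)
  then show ?thesis using coset_eq assms by auto
qed

text \<open>The operations of \<open>quot_rng\<close> act on representatives picked by
  \<open>SOME\<close>; this controls the choice up to \<open>I\<close>.\<close>

lemma some_coset: 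
  assumes "a \<in> rcarrier A" shows "\<exists>i\<in>I. (SOME x. x \<in> coset A I a) = a \<boxplus> i"
  using someI[of "\<lambda>x. x \<in> coset A I a", OF coset_self[OF assms]] by (auto simp: coset_def)

lemma quot_simps:
  assumes "a \<in> rcarrier A" "b \<in> rcarrier A"
  shows "radd (quot_rng A I) (coset A I a) (coset A I b) = coset A I (a \<boxplus> b)"
    and "rmul (quot_rng A I) (coset A I a) (coset A I b) = coset A I (a \<boxdot> b)"
    and "rneg (quot_rng A I) (coset A I a) = coset A I (\<boxminus> a)"
proof -
  obtain i j where ij: "i \<in> I" "j \<in> I" "(SOME x. x \<in> coset A I a) = a \<boxplus> i" "(SOME x. x \<in> coset A I b) = b \<boxplus> j"
    using some_coset assms by metis
  have c: "i \<in> rcarrier A" "j \<in> rcarrier A" using ij ideal_carrier by auto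
  \<comment> \<open>The third element is the excess of the product of the representatives
    \<open>a + i\<close> and \<open>b + j\<close> over \<open>a b\<close>.\<close>
  have I': "i \<boxplus> j \<in> I" "\<boxminus> i \<in> I" "(a \<boxdot> j \<boxplus> i \<boxdot> b) \<boxplus> i \<boxdot> j \<in> I" using ij I assms c by (auto simp: is_ideal_def)
  show "radd (quot_rng A I) (coset A I a) (coset A I b) = coset A I (a \<boxplus> b)"
    using I' c assms by (simp add: quot_rng_def ij) (rule coset_eqI[of _ _ "i \<boxplus> j"]; simp add: add_ac)
  show "rneg (quot_rng A I) (coset A I a) = coset A I (\<boxminus> a)"
    using I' c assms by (simp add: quot_rng_def ij) (rule coset_eqI[of _ _ "\<boxminus> i"]; simp add: neg_add_distrib)
  show "rmul (quot_rng A I) (coset A I a) (coset A I b) = coset A I (a \<boxdot> b)"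
    using I' c assms by (simp add: quot_rng_def ij) (rule coset_eqI[of _ _ "(a \<boxdot> j \<boxplus> i \<boxdot> b) \<boxplus> i \<boxdot> j"]; simp add: distl distr add_ac)
qed

lemma quot_carrier: "rcarrier (quot_rng A I) = coset A I ` rcarrier A"
  and quot_zero: "rzero (quot_rng A I) = coset A I (rzero A)"
  by (auto simp: quot_rng_def)

lemma nu_ring_quot: "nu_ring (quot_rng A I)"
  unfolding nu_ring_def quot_carrier quot_zero
  by (simp add: quot_simps add_ac mul_assoc distl distr)

lemma rhom_coset: "rhom A (quot_rng A I) (coset A I)"
  by (auto simp: rhom_def addhom_def quot_simps quot_carrier)

lemma quot_universal:
  assumes "rhom A B f" "nu_ring B" "\<And>i. i \<in> I \<Longrightarrow> f i = rzero B"
  shows "\<exists>h. rhom (quot_rng A I) B h \<and> (\<forall>a\<in>rcarrier A. h (coset A I a) = f a)"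
proof -
  interpret B: nuring B by standard fact
  \<comment> \<open>The chosen representative differs from \<open>a\<close> by an element of
    \<open>I\<close>, which \<open>f\<close> kills, so the choice does not matter.\<close>
  define h where "h X = f (SOME x. x \<in> X)" for X
  note fh = rhom_addhom[OF assms(1)]
  have h: "h (coset A I a) = f a" if a: "a \<in> rcarrier A" for a
  proof -
    obtain i where "i \<in> I" "(SOME x. x \<in> coset A I a) = a \<boxplus> i" using some_coset[OF a] by auto
    then show ?thesis using a assms(3)[of i] ideal_carrier addhom_closed[OF fh a] by (simp add: h_def addhom_add[OF fh])
  qed
  then have "rhom (quot_rng A I) B h"
    using addhom_closed[OF fh] by (auto simp: rhom_def addhom_def quot_carrier quot_simps addhom_add[OF fh] rhom_mul[OF assms(1)])
  with h show ?thesis by auto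
qed

end

end

section \<open>The free ring\<close>

text \<open>The word \<open>u\<close> as a monomial; \<open>free_rng\<close> is the ring of
  noncommutative integer polynomials without constant term.\<close>

definition fsingle :: "'g list \<Rightarrow> 'g list \<Rightarrow> int" where
  "fsingle u = (\<lambda>w. if w = u then 1 else 0)"

lemma fr_gen_single: "fr_gen x = fsingle [x]"
  by (simp add: fr_gen_def fsingle_def)

lemma free_sel:
  "rcarrier (free_rng G) = {f. finite {w. f w \<noteq> 0} \<and> (\<forall>w. f w \<noteq> 0 \<longrightarrow> w \<noteq> [] \<and> set w \<subseteq> G)}"
  "radd (free_rng G) = (\<lambda>f g w. f w + g w)"
  "rmul (free_rng G) = (\<lambda>f g w. \<Sum>i\<le>length w. f (take i w) * g (drop i w))"
  "rzero (free_rng G) = (\<lambda>w. 0)"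
  "rneg (free_rng G) = (\<lambda>f w. - f w)"
  by (simp_all add: free_rng_def)

lemma fsingle_carrier: "w \<noteq> [] \<Longrightarrow> set w \<subseteq> G \<Longrightarrow> fsingle w \<in> rcarrier (free_rng G)"
  by (auto simp: free_sel fsingle_def)

lemma fsingle_mul: "rmul (free_rng G) (fsingle u) (fsingle v) = fsingle (u @ v)"
proof
  fix w
  \<comment> \<open>Of all cuts of \<open>w\<close>, only the one after \<open>length u\<close>
    letters can give a nonzero term.\<close>
  have *: "fsingle u (take i w) * fsingle v (drop i w) = (if i = length u \<and> w = u @ v then 1 else 0)" if "i \<le> length w" for i
  proof -
    have "take i w = u \<and> drop i w = v \<longleftrightarrow> i = length u \<and> w = u @ v"
      using that by (metis append_eq_conv_conj append_take_drop_id length_take min.absorb2)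
    then show ?thesis by (auto simp: fsingle_def)
  qed
  have "(\<Sum>i\<le>length w. fsingle u (take i w) * fsingle v (drop i w)) = (\<Sum>i\<le>length w. if i = length u \<and> w = u @ v then 1 else 0)"
    by (rule sum.cong) (auto simp: *)
  also have "\<dots> = fsingle (u @ v) w"
    by (cases "w = u @ v") (auto simp: fsingle_def)
  finally show "rmul (free_rng G) (fsingle u) (fsingle v) w = fsingle (u @ v) w" by (simp add: free_sel)
qed

lemma free_mul_closed:
  assumes "f \<in> rcarrier (free_rng G)" "g \<in> rcarrier (free_rng G)"
  shows "rmul (free_rng G) f g \<in> rcarrier (free_rng G)"
proof -
  let ?h = "rmul (free_rng G) f g"
  have s: "\<exists>u v. w = u @ v \<and> f u \<noteq> 0 \<and> g v \<noteq> 0" if h: "?h w \<noteq> 0" for w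
  proof -
    from h have "\<exists>i. f (take i w) * g (drop i w) \<noteq> 0" by (rule contrapos_np) (auto simp: free_sel intro!: sum.neutral)
    then show ?thesis by (metis append_take_drop_id mult_eq_0_iff)
  qed
  have "{w. ?h w \<noteq> 0} \<subseteq> (\<lambda>(u,v). u @ v) ` ({u. f u \<noteq> 0} \<times> {v. g v \<noteq> 0})"
    using s by fastforce
  moreover have "finite ((\<lambda>(u,v). u @ v) ` ({u. f u \<noteq> 0} \<times> {v. g v \<noteq> 0}))"
    using assms by (auto simp: free_sel)
  ultimately have "finite {w. ?h w \<noteq> 0}" by (rule finite_subset)
  moreover have "w \<noteq> [] \<and> set w \<subseteq> G" if h: "?h w \<noteq> 0" for w
  proof -
    obtain u v where "w = u @ v" "f u \<noteq> 0" "g v \<noteq> 0" using s[OF h] by auto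
    then show ?thesis using assms by (auto simp: free_sel)
  qed
  ultimately show ?thesis unfolding free_sel(1) by blast
qed

lemma free_mul_assoc:
  "rmul (free_rng G) (rmul (free_rng G) f g) h = rmul (free_rng G) f (rmul (free_rng G) g h)"
proof
  fix w :: "'a list"
  let ?n = "length w"
  have "rmul (free_rng G) (rmul (free_rng G) f g) h w
    = (\<Sum>i\<le>?n. \<Sum>j\<le>i. f (take j w) * g (drop j (take i w)) * h (drop i w))"
    by (auto simp: free_sel sum_distrib_right min_def intro!: sum.cong)
  also have "\<dots> = (\<Sum>(i,j)\<in>(SIGMA i:{..?n}. {..i}). f (take j w) * g (drop j (take i w)) * h (drop i w))"
    by (subst sum.Sigma) auto
  \<comment> \<open>Both sums run over the ways to cut \<open>w\<close> into three pieces, described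
    first by the cut positions \<open>j \<le> i\<close>, then by the lengths \<open>j\<close> and
    \<open>k = i - j\<close> of the first two pieces.\<close>
  also have "\<dots> = (\<Sum>(j,k)\<in>(SIGMA j:{..?n}. {..?n - j}). f (take j w) * (g (take k (drop j w)) * h (drop (k + j) w)))"
    by (rule sum.reindex_bij_witness[of _ "\<lambda>(j,k). (k + j, j)" "\<lambda>(i,j). (j, i - j)"])
      (auto simp: drop_take mult.assoc)
  also have "\<dots> = rmul (free_rng G) f (rmul (free_rng G) g h) w"
    by (subst sum.Sigma[symmetric]) (auto simp: free_sel sum_distrib_left intro!: sum.cong)
  finally show "rmul (free_rng G) (rmul (free_rng G) f g) h w = rmul (free_rng G) f (rmul (free_rng G) g h) w" .
qed

lemma free_add_closed:
  assumes "f \<in> rcarrier (free_rng G)" "g \<in> rcarrier (free_rng G)"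
  shows "radd (free_rng G) f g \<in> rcarrier (free_rng G)"
proof -
  have "finite ({w. f w \<noteq> 0} \<union> {w. g w \<noteq> 0})" using assms by (auto simp: free_sel)
  then have "finite {w. f w + g w \<noteq> 0}" by (rule rev_finite_subset) auto
  moreover have "w \<noteq> [] \<and> set w \<subseteq> G" if "f w + g w \<noteq> 0" for w
    using that assms by (cases "f w = 0") (auto simp: free_sel)
  ultimately show ?thesis unfolding free_sel by blast
qed

lemma nu_ring_free: "nu_ring (free_rng G)"
  unfolding nu_ring_def
proof (intro conjI ballI)
  show "rzero (free_rng G) \<in> rcarrier (free_rng G)" by (simp add: free_sel)
  show "rneg (free_rng G) x \<in> rcarrier (free_rng G)" if "x \<in> rcarrier (free_rng G)" for x
    using that by (auto simp: free_sel)
qed (auto simp: free_mul_closed free_add_closed free_mul_assoc, 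
     auto simp: free_sel algebra_simps sum.distrib)

lemma free_span: "rcarrier (free_rng G) = addsub_gen (free_rng G) {fsingle w | w. w \<noteq> [] \<and> set w \<subseteq> G}"
  (is "_ = addsub_gen ?F ?S")
proof
  interpret F: nuring "?F" by (standard, rule nu_ring_free)
  have S: "?S \<subseteq> rcarrier ?F" using fsingle_carrier by auto
  show "addsub_gen ?F ?S \<subseteq> rcarrier ?F" using F.addsub_gen_carrier[OF S] .
  note H = F.is_addsub_gen[OF S]
  \<comment> \<open>A span is closed under sums and negation, so integer multiples of a monomial are
    obtained by induction on a natural number followed by a case on the sign.\<close>
  have mult: "(\<lambda>v. int n * fsingle w v) \<in> addsub_gen ?F ?S" if "w \<noteq> []" "set w \<subseteq> G" for w n
  proof (induction n)
    case 0 then show ?case using H by (simp add: is_addsub_def free_sel)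
  next
    case (Suc n)
    have "fsingle w \<in> addsub_gen ?F ?S" using addsub_gen_incl[of ?S ?F] that by auto
    with Suc have "radd ?F (\<lambda>v. int n * fsingle w v) (fsingle w) \<in> addsub_gen ?F ?S" using H by (simp add: is_addsub_def)
    then show ?case by (simp add: free_sel algebra_simps)
  qed
  have mulz: "(\<lambda>v. c * fsingle w v) \<in> addsub_gen ?F ?S" if "w \<noteq> []" "set w \<subseteq> G" for w c
  proof (cases c rule: int_cases2)
    case (nonneg n) then show ?thesis using mult[OF that] by simp
  next
    case (nonpos n)
    have "rneg ?F (\<lambda>v. int n * fsingle w v) \<in> addsub_gen ?F ?S" using mult[OF that] H by (simp add: is_addsub_def)
    then show ?thesis using nonpos by (simp add: free_sel)
  qed
  have "f \<in> addsub_gen ?F ?S" if "finite W" "f \<in> rcarrier ?F" "{w. f w \<noteq> 0} = W" for f W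
    using that
  proof (induction W arbitrary: f rule: finite_induct)
    case empty
    then have "f = (\<lambda>w. 0)" by auto
    then show ?case using H by (simp add: is_addsub_def free_sel)
  next
    \<comment> \<open>Deleting the coefficient of \<open>w\<close> shrinks the support to
      \<open>W\<close>; the removed term is added back at the end.\<close>
    case (insert w W)
    let ?g = "f(w := 0)"
    have g: "{v. ?g v \<noteq> 0} = W" using insert.prems(2) insert.hyps(2) by auto
    then have "?g \<in> rcarrier ?F" using insert.prems(1) insert.hyps(1) by (auto simp: free_sel split: if_splits)
    then have "?g \<in> addsub_gen ?F ?S" using insert.IH g by blast
    moreover have "w \<noteq> []" "set w \<subseteq> G" using insert.prems by (auto simp: free_sel)
    ultimately have "radd ?F ?g (\<lambda>v. f w * fsingle w v) \<in> addsub_gen ?F ?S"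
      using mulz[of w "f w"] H by (simp add: is_addsub_def)
    moreover have "radd ?F ?g (\<lambda>v. f w * fsingle w v) = f" by (auto simp: free_sel fsingle_def)
    ultimately show ?case by simp
  qed
  then show "rcarrier ?F \<subseteq> addsub_gen ?F ?S" by (auto simp: free_sel(1))
qed

text \<open>Additively, the free ring is the free abelian group on nonempty words. The additive
  group of \<open>B\<close> is rewritten as a multiplicative \<open>comm_group\<close>, so that
  \<open>finprod\<close> of integer powers supplies the sum of the multiples of
  \<open>E w\<close>.\<close>

lemma free_additive_extension:
  assumes B: "nu_ring B" and E: "\<And>w. w \<noteq> [] \<Longrightarrow> set w \<subseteq> G \<Longrightarrow> E w \<in> rcarrier B"
  shows "\<exists>\<phi>. addhom (free_rng G) B \<phi> \<and> (\<forall>w. w \<noteq> [] \<longrightarrow> set w \<subseteq> G \<longrightarrow> \<phi> (fsingle w) = E w)"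
proof -
  interpret B: nuring B by (standard, rule B)
  define M where "M = \<lparr>carrier = rcarrier B, monoid.mult = radd B, one = rzero B\<rparr>"
  have M: "carrier M = rcarrier B" "monoid.mult M = radd B" "one M = rzero B" by (simp_all add: M_def)
  interpret M: comm_group M
    by (rule comm_groupI) (auto simp: M B.add_ac, use B.add_neg B.neg_closed in blast)
  let ?t = "\<lambda>f w. E w [^]\<^bsub>M\<^esub> (f w :: int)"
  define \<phi> where "\<phi> f = finprod M (?t f) {w. f w \<noteq> 0}" for f
  have ew: "E w \<in> carrier M" if "w \<noteq> []" "set w \<subseteq> G" for w using E that by (simp add: M)
  \<comment> \<open>Words with coefficient zero contribute the neutral factor, so \<open>f\<close>,
    \<open>g\<close> and their sum can be evaluated over one common finite set.\<close>
  have ext: "\<phi> f = finprod M (?t f) W" if "finite W" "{w. f w \<noteq> 0} \<subseteq> W" "W \<subseteq> {w. w \<noteq> [] \<and> set w \<subseteq> G}" for f W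
    unfolding \<phi>_def using that ew
    by (intro M.finprod_mono_neutral_cong_left) (auto intro!: M.int_pow_closed)
  have "addhom (free_rng G) B \<phi>" unfolding addhom_def
  proof (intro conjI ballI)
    fix f assume f: "f \<in> rcarrier (free_rng G)"
    have "\<phi> f \<in> carrier M" unfolding \<phi>_def
      by (rule M.finprod_closed) (use f ew in \<open>auto simp: free_sel intro!: M.int_pow_closed\<close>)
    then show "\<phi> f \<in> rcarrier B" by (simp add: M)
    fix g assume g: "g \<in> rcarrier (free_rng G)"
    let ?W = "{w. f w \<noteq> 0} \<union> {w. g w \<noteq> 0}"
    have W: "finite ?W" "?W \<subseteq> {w. w \<noteq> [] \<and> set w \<subseteq> G}" using f g by (auto simp: free_sel)
    have "\<phi> (radd (free_rng G) f g) = finprod M (\<lambda>w. ?t f w \<otimes>\<^bsub>M\<^esub> ?t g w) ?W"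
      using W ew by (subst ext[of ?W]) (auto simp: free_sel subset_iff M.int_pow_mult intro!: M.finprod_cong' M.m_closed M.int_pow_closed)
    also have "\<dots> = \<phi> f \<otimes>\<^bsub>M\<^esub> \<phi> g"
      using W ew by (subst (1 2) ext[of ?W]) (auto simp: subset_iff intro!: M.finprod_multf M.int_pow_closed)
    finally show "\<phi> (radd (free_rng G) f g) = radd B (\<phi> f) (\<phi> g)" by (simp add: M)
  qed
  moreover have "\<phi> (fsingle w) = E w" if "w \<noteq> []" "set w \<subseteq> G" for w
  proof -
    have "{v. fsingle w v \<noteq> 0} = {w}" by (auto simp: fsingle_def)
    then show ?thesis using ew[OF that] by (simp add: \<phi>_def fsingle_def)
  qed
  ultimately show ?thesis by blast
qed

lemma free_universal:
  assumes B: "nu_ring B" and e: "\<And>x. x \<in> G \<Longrightarrow> e x \<in> rcarrier B"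
  shows "\<exists>\<phi>. rhom (free_rng G) B \<phi> \<and> (\<forall>x\<in>G. \<phi> (fr_gen x) = e x)"
proof -
  interpret B: nuring B by (standard, rule B)
  let ?F = "free_rng G"
  interpret F: nuring ?F by (standard, rule nu_ring_free)
  let ?S = "{fsingle w | w. w \<noteq> [] \<and> set w \<subseteq> G}"
  have S: "?S \<subseteq> rcarrier ?F" using fsingle_carrier by auto
  let ?E = "\<lambda>w. rprod B (map e w)"
  have ec: "set w \<subseteq> G \<Longrightarrow> set (map e w) \<subseteq> rcarrier B" for w using e by auto
  obtain \<phi> where \<phi>: "addhom ?F B \<phi>" "\<And>w. w \<noteq> [] \<Longrightarrow> set w \<subseteq> G \<Longrightarrow> \<phi> (fsingle w) = ?E w"
    using free_additive_extension[OF B, of G ?E] B.rprod_closed ec by (metis map_is_Nil_conv)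
  have c: "\<phi> f \<in> rcarrier B" if "f \<in> rcarrier ?F" for f using \<phi>(1) that by (auto simp: addhom_def)
  \<comment> \<open>Multiplicativity is spread over one argument at a time: here the right factor is
    a single word and the left one runs over the span of words.\<close>
  have m1: "\<phi> (rmul ?F f (fsingle v)) = rmul B (\<phi> f) (\<phi> (fsingle v))"
    if f: "f \<in> rcarrier ?F" and v: "v \<noteq> []" "set v \<subseteq> G" for f v
  proof (rule F.addsub_gen_eqI[OF f[unfolded free_span] S B])
    have vc: "fsingle v \<in> rcarrier ?F" using fsingle_carrier v by auto
    show "addhom ?F B (\<lambda>f. \<phi> (rmul ?F f (fsingle v)))"
      by (rule addhom_comp[OF F.addhom_rmul[OF vc] \<phi>(1)])
    show "addhom ?F B (\<lambda>f. rmul B (\<phi> f) (\<phi> (fsingle v)))"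
      by (rule addhom_comp[OF \<phi>(1) B.addhom_rmul[OF c[OF vc]]])
    fix f assume "f \<in> ?S"
    then obtain u where "f = fsingle u" "u \<noteq> []" "set u \<subseteq> G" by auto
    then show "\<phi> (rmul ?F f (fsingle v)) = rmul B (\<phi> f) (\<phi> (fsingle v))"
      using v by (simp add: fsingle_mul \<phi>(2) B.rprod_append ec[simplified])
  qed
  have "\<phi> (rmul ?F f g) = rmul B (\<phi> f) (\<phi> g)" if f: "f \<in> rcarrier ?F" and g: "g \<in> rcarrier ?F" for f g
    by (rule F.addsub_gen_eqI[OF g[unfolded free_span] S B addhom_comp[OF F.addhom_lmul[OF f] \<phi>(1)]
          addhom_comp[OF \<phi>(1) B.addhom_lmul[OF c[OF f]]]]) (use m1[OF f] in auto)
  then have "rhom ?F B \<phi>" using \<phi>(1) by (auto simp: rhom_def)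
  moreover have "\<phi> (fr_gen x) = e x" if "x \<in> G" for x using \<phi>(2)[of "[x]"] that by (simp add: fr_gen_single)
  ultimately show ?thesis by blast
qed

lemma free_generated:
  assumes "is_addsub (free_rng G) H" "\<And>x y. x \<in> H \<Longrightarrow> y \<in> H \<Longrightarrow> rmul (free_rng G) x y \<in> H"
    "\<And>x. x \<in> G \<Longrightarrow> fr_gen x \<in> H"
  shows "rcarrier (free_rng G) \<subseteq> H"
proof -
  have "fsingle w \<in> H" if "w \<noteq> []" "set w \<subseteq> G" for w
    using that
  proof (induction w)
    case (Cons x w)
    then show ?case
      using assms(2)[of "fsingle [x]" "fsingle w"] assms(3)[of x] 
      by (cases "w = []") (auto simp: fr_gen_single fsingle_mul)
  qed auto
  then show ?thesis unfolding free_span using assms(1) by (intro addsub_gen_least) auto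
qed

section \<open>Relative Cuntz--Pimsner rings\<close>

definition cov_rep :: "'r rng \<Rightarrow> ('r,'p) bimod \<Rightarrow> ('r,'q) bimod \<Rightarrow> ('p \<Rightarrow> 'q \<Rightarrow> 'r) \<Rightarrow> 'b rng \<Rightarrow>
    ('r \<Rightarrow> 'b) \<Rightarrow> ('p \<Rightarrow> 'b) \<Rightarrow> ('q \<Rightarrow> 'b) \<Rightarrow> bool" where
  "cov_rep R P Q psi B \<sigma> S T \<longleftrightarrow> rhom R B \<sigma> \<and>
     (\<forall>p\<in>mcar P. S p \<in> rcarrier B) \<and> (\<forall>q\<in>mcar Q. T q \<in> rcarrier B) \<and>
     (\<forall>p\<in>mcar P. \<forall>p'\<in>mcar P. S (madd P p p') = radd B (S p) (S p')) \<and>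
     (\<forall>q\<in>mcar Q. \<forall>q'\<in>mcar Q. T (madd Q q q') = radd B (T q) (T q')) \<and>
     (\<forall>p\<in>mcar P. \<forall>r\<in>rcarrier R. S (ract P p r) = rmul B (S p) (\<sigma> r) \<and> S (lact P r p) = rmul B (\<sigma> r) (S p)) \<and>
     (\<forall>q\<in>mcar Q. \<forall>r\<in>rcarrier R. T (ract Q q r) = rmul B (T q) (\<sigma> r) \<and> T (lact Q r q) = rmul B (\<sigma> r) (T q)) \<and>
     (\<forall>p\<in>mcar P. \<forall>q\<in>mcar Q. \<sigma> (psi p q) = rmul B (S p) (T q))"

text \<open>Quantifies over all presentations \<open>l\<close> of the left multiplication by
  \<open>x\<close>, exactly as \<open>TJ_gens\<close> does, so the map \<open>\<pi>\<close> never
  has to be constructed and factoring through the quotient is this very condition.\<close>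

definition cp_covariant :: "('r,'p) bimod \<Rightarrow> ('r,'q) bimod \<Rightarrow> ('p \<Rightarrow> 'q \<Rightarrow> 'r) \<Rightarrow> 'r set \<Rightarrow> 'b rng \<Rightarrow>
    ('r \<Rightarrow> 'b) \<Rightarrow> ('p \<Rightarrow> 'b) \<Rightarrow> ('q \<Rightarrow> 'b) \<Rightarrow> bool" where
  "cp_covariant P Q psi J B \<sigma> S T \<longleftrightarrow> (\<forall>x\<in>J. \<forall>l. set l \<subseteq> mcar Q \<times> mcar P \<longrightarrow>
     (\<forall>y\<in>mcar Q. lact Q x y = msum Q (map (\<lambda>(q,p). ract Q q (psi p y)) l)) \<longrightarrow>
     \<sigma> x = rsum B (map (\<lambda>(q,p). rmul B (T q) (S p)) l))"

abbreviation gev :: "('r \<Rightarrow> 'b) \<Rightarrow> ('p \<Rightarrow> 'b) \<Rightarrow> ('q \<Rightarrow> 'b) \<Rightarrow> ('r,'p,'q) fgen \<Rightarrow> 'b" where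
  "gev \<sigma> S T \<equiv> case_sum \<sigma> (case_sum S T)"

abbreviation gdeg :: "('r,'p,'q) fgen \<Rightarrow> int" where
  "gdeg \<equiv> case_sum (\<lambda>_. 0) (case_sum (\<lambda>_. -1) (\<lambda>_. 1))"

abbreviation qp_word :: "'q list \<Rightarrow> 'p list \<Rightarrow> ('r,'p,'q) fgen list" where
  "qp_word qs ps \<equiv> map (Inr \<circ> Inr) qs @ map (Inr \<circ> Inl) ps"

text \<open>The words whose values span degree \<open>i\<close>: letters from \<open>Q\<close>, then
  letters from \<open>P\<close>, possibly after one coefficient. The empty word is excluded because
  no identity is available as its value; \<open>rprod\<close> would return zero.\<close>

definition normal_words :: "'r rng \<Rightarrow> ('r,'p) bimod \<Rightarrow> ('r,'q) bimod \<Rightarrow> int \<Rightarrow> ('r,'p,'q) fgen list set" where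
  "normal_words R P Q i =
     {qp_word qs ps | qs ps. set qs \<subseteq> mcar Q \<and> set ps \<subseteq> mcar P \<and> length qs + length ps > 0 \<and>
        int (length qs) - int (length ps) = i}
   \<union> {Inl r # qp_word qs ps | r qs ps. r \<in> rcarrier R \<and> set qs \<subseteq> mcar Q \<and> set ps \<subseteq> mcar P \<and>
        int (length qs) - int (length ps) = i}"

lemma normal_words_gens: "w \<in> normal_words R P Q i \<Longrightarrow> w \<noteq> [] \<and> set w \<subseteq> gens R P Q"
  by (auto simp: normal_words_def gens_def image_iff subset_eq)

lemma normal_wordsI:
  "set qs \<subseteq> mcar Q \<Longrightarrow> set ps \<subseteq> mcar P \<Longrightarrow> length qs + length ps > 0 \<Longrightarrow>
     int (length qs) - int (length ps) = i \<Longrightarrow> qp_word qs ps \<in> normal_words R P Q i"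
  "r \<in> rcarrier R \<Longrightarrow> set qs \<subseteq> mcar Q \<Longrightarrow> set ps \<subseteq> mcar P \<Longrightarrow>
     int (length qs) - int (length ps) = i \<Longrightarrow> Inl r # qp_word qs ps \<in> normal_words R P Q i"
  unfolding normal_words_def by blast+

lemma gens_cases:
  assumes "x \<in> gens R P Q"
  obtains r where "x = Inl r" "r \<in> rcarrier R" | p where "x = Inr (Inl p)" "p \<in> mcar P"
    | q where "x = Inr (Inr q)" "q \<in> mcar Q"
  using assms by (auto simp: gens_def)

lemma image_compr2: "f ` {h x y | x y. Z x y} = {f (h x y) | x y. Z x y}"
  and image_compr3: "f ` {k x y z | x y z. W x y z} = {f (k x y z) | x y z. W x y z}"
  by auto

text \<open>Separates a monomial into a word and its evaluation, so that the same words can be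
  evaluated in the quotients as well.\<close>

lemma toep_monos_words:
  "toep_monos R P Q psi i =
    (\<lambda>w. rprod (toeplitz R P Q psi) (map (gev (iotaR R P Q psi) (iotaP R P Q psi) (iotaQ R P Q psi)) w)) ` normal_words R P Q i"
  unfolding toep_monos_def normal_words_def Let_def image_Un image_compr2 image_compr3 by (simp add: comp_def)

section \<open>The Toeplitz ring as a free ring modulo the covariance relations\<close>

locale rsys =
  fixes R :: "'r rng" and P :: "('r,'p) bimod" and Q :: "('r,'q) bimod" and psi :: "'p \<Rightarrow> 'q \<Rightarrow> 'r"
  assumes sys: "rsystem R P Q psi"
begin

sublocale R: nuring R
  using sys by unfold_locales (simp add: rsystem_def)

lemma bimod_closed:
  "p \<in> mcar P \<Longrightarrow> p' \<in> mcar P \<Longrightarrow> madd P p p' \<in> mcar P"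
  "q \<in> mcar Q \<Longrightarrow> q' \<in> mcar Q \<Longrightarrow> madd Q q q' \<in> mcar Q"
  "p \<in> mcar P \<Longrightarrow> r \<in> rcarrier R \<Longrightarrow> ract P p r \<in> mcar P"
  "p \<in> mcar P \<Longrightarrow> r \<in> rcarrier R \<Longrightarrow> lact P r p \<in> mcar P"
  "q \<in> mcar Q \<Longrightarrow> r \<in> rcarrier R \<Longrightarrow> ract Q q r \<in> mcar Q"
  "q \<in> mcar Q \<Longrightarrow> r \<in> rcarrier R \<Longrightarrow> lact Q r q \<in> mcar Q"
  "p \<in> mcar P \<Longrightarrow> q \<in> mcar Q \<Longrightarrow> psi p q \<in> rcarrier R"
  "mzero Q \<in> mcar Q" "mzero P \<in> mcar P"
  using sys by (simp_all add: rsystem_def bimodule_def)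

abbreviation "F \<equiv> FR R P Q"
abbreviation "K \<equiv> toep_ker R P Q psi"
abbreviation "TT \<equiv> toeplitz R P Q psi"
abbreviation "tR \<equiv> iotaR R P Q psi"
abbreviation "tP \<equiv> iotaP R P Q psi"
abbreviation "tQ \<equiv> iotaQ R P Q psi"

sublocale F: nuring F
  by unfold_locales (simp add: FR_def nu_ring_free)

lemma free_gen_closed:
  "r \<in> rcarrier R \<Longrightarrow> gR r \<in> rcarrier F"
  "p \<in> mcar P \<Longrightarrow> gP p \<in> rcarrier F"
  "q \<in> mcar Q \<Longrightarrow> gQ q \<in> rcarrier F"
  unfolding FR_def gR_def gP_def gQ_def fr_gen_single by (auto intro!: fsingle_carrier simp: gens_def)

lemma toep_rels_carrier: "toep_rels R P Q psi \<subseteq> rcarrier F"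
  unfolding toep_rels_def Let_def
  by (auto intro!: F.add_closed F.mul_closed F.neg_closed free_gen_closed bimod_closed)

lemma toep_ker_ideal: "is_ideal F K"
  unfolding toep_ker_def by (rule F.is_ideal_gen[OF toep_rels_carrier])

lemma toep_ker_rels: "x \<in> toep_rels R P Q psi \<Longrightarrow> x \<in> K"
  using ideal_gen_incl[of "toep_rels R P Q psi" F] by (auto simp: toep_ker_def)

sublocale TT: nuring TT
  unfolding toeplitz_def by unfold_locales (rule F.nu_ring_quot[OF toep_ker_ideal])

lemma toep_proj: "rhom F TT (coset F K)"
  unfolding toeplitz_def by (rule F.rhom_coset[OF toep_ker_ideal])

lemma toep_carrier: "rcarrier TT = coset F K ` rcarrier F"
  unfolding toeplitz_def by (rule F.quot_carrier[OF toep_ker_ideal])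

lemma toep_eqI:
  "a \<in> rcarrier F \<Longrightarrow> b \<in> rcarrier F \<Longrightarrow> radd F a (rneg F b) \<in> toep_rels R P Q psi \<Longrightarrow> coset F K a = coset F K b"
  using F.coset_eq[OF toep_ker_ideal] toep_ker_rels by blast

lemma toep_relsI:
  "r \<in> rcarrier R \<Longrightarrow> r' \<in> rcarrier R \<Longrightarrow> radd F (gR (radd R r r')) (rneg F (radd F (gR r) (gR r'))) \<in> toep_rels R P Q psi"
  "r \<in> rcarrier R \<Longrightarrow> r' \<in> rcarrier R \<Longrightarrow> radd F (gR (rmul R r r')) (rneg F (rmul F (gR r) (gR r'))) \<in> toep_rels R P Q psi"
  "p \<in> mcar P \<Longrightarrow> p' \<in> mcar P \<Longrightarrow> radd F (gP (madd P p p')) (rneg F (radd F (gP p) (gP p'))) \<in> toep_rels R P Q psi"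
  "q \<in> mcar Q \<Longrightarrow> q' \<in> mcar Q \<Longrightarrow> radd F (gQ (madd Q q q')) (rneg F (radd F (gQ q) (gQ q'))) \<in> toep_rels R P Q psi"
  "p \<in> mcar P \<Longrightarrow> r \<in> rcarrier R \<Longrightarrow> radd F (gP (ract P p r)) (rneg F (rmul F (gP p) (gR r))) \<in> toep_rels R P Q psi"
  "p \<in> mcar P \<Longrightarrow> r \<in> rcarrier R \<Longrightarrow> radd F (gP (lact P r p)) (rneg F (rmul F (gR r) (gP p))) \<in> toep_rels R P Q psi"
  "q \<in> mcar Q \<Longrightarrow> r \<in> rcarrier R \<Longrightarrow> radd F (gQ (ract Q q r)) (rneg F (rmul F (gQ q) (gR r))) \<in> toep_rels R P Q psi"
  "q \<in> mcar Q \<Longrightarrow> r \<in> rcarrier R \<Longrightarrow> radd F (gQ (lact Q r q)) (rneg F (rmul F (gR r) (gQ q))) \<in> toep_rels R P Q psi"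
  "p \<in> mcar P \<Longrightarrow> q \<in> mcar Q \<Longrightarrow> radd F (gR (psi p q)) (rneg F (rmul F (gP p) (gQ q))) \<in> toep_rels R P Q psi"
  unfolding toep_rels_def Let_def
  subgoal by (rule UnI1, rule UnI1, rule UnI1, rule UnI1, rule UnI1, rule UnI1, rule UnI1, rule UnI1, rule CollectI, intro exI conjI, rule refl, assumption+)
  subgoal by (rule UnI1, rule UnI1, rule UnI1, rule UnI1, rule UnI1, rule UnI1, rule UnI1, rule UnI2, rule CollectI, intro exI conjI, rule refl, assumption+)
  subgoal by (rule UnI1, rule UnI1, rule UnI1, rule UnI1, rule UnI1, rule UnI1, rule UnI2, rule CollectI, intro exI conjI, rule refl, assumption+)
  subgoal by (rule UnI1, rule UnI1, rule UnI1, rule UnI1, rule UnI1, rule UnI2, rule CollectI, intro exI conjI, rule refl, assumption+)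
  subgoal by (rule UnI1, rule UnI1, rule UnI1, rule UnI1, rule UnI2, rule CollectI, intro exI conjI, rule refl, assumption+)
  subgoal by (rule UnI1, rule UnI1, rule UnI1, rule UnI2, rule CollectI, intro exI conjI, rule refl, assumption+)
  subgoal by (rule UnI1, rule UnI1, rule UnI2, rule CollectI, intro exI conjI, rule refl, assumption+)
  subgoal by (rule UnI1, rule UnI2, rule CollectI, intro exI conjI, rule refl, assumption+)
  subgoal by (rule UnI2, rule CollectI, intro exI conjI, rule refl, assumption+)
  done

lemma toep_cov: "cov_rep R P Q psi TT tR tP tQ"
proof -
  note c = free_gen_closed bimod_closed
  have m: "rmul TT (coset F K a) (coset F K b) = coset F K (rmul F a b)"
    "radd TT (coset F K a) (coset F K b) = coset F K (radd F a b)"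
    if "a \<in> rcarrier F" "b \<in> rcarrier F" for a b using that toep_proj by (auto simp: rhom_def addhom_def)
  have m': "coset F K a \<in> rcarrier TT" if "a \<in> rcarrier F" for a using rhom_closed[OF toep_proj that] .
  show ?thesis
    unfolding cov_rep_def rhom_def addhom_def iotaR_def iotaP_def iotaQ_def
    by (intro conjI ballI; (simp add: m m' c)?; rule toep_eqI; (rule toep_relsI)?; simp add: c)
qed

lemma toep_universal:
  assumes B: "nu_ring B" and cov: "cov_rep R P Q psi B \<sigma> S T"
  shows "\<exists>h. rhom TT B h \<and> (\<forall>r\<in>rcarrier R. h (tR r) = \<sigma> r) \<and>
    (\<forall>p\<in>mcar P. h (tP p) = S p) \<and> (\<forall>q\<in>mcar Q. h (tQ q) = T q)"
proof -
  interpret B: nuring B by (standard, rule B)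
  have cl: "gev \<sigma> S T x \<in> rcarrier B" if "x \<in> gens R P Q" for x
    using that cov by (auto simp: gens_def cov_rep_def rhom_def addhom_def)
  obtain \<phi> where \<phi>: "rhom F B \<phi>" "\<And>x. x \<in> gens R P Q \<Longrightarrow> \<phi> (fr_gen x) = gev \<sigma> S T x"
    using free_universal[OF B, of "gens R P Q" "gev \<sigma> S T"] cl unfolding FR_def by blast
  have g: "r \<in> rcarrier R \<Longrightarrow> \<phi> (gR r) = \<sigma> r" "p \<in> mcar P \<Longrightarrow> \<phi> (gP p) = S p" "q \<in> mcar Q \<Longrightarrow> \<phi> (gQ q) = T q" for r p q
    using \<phi>(2)[of "Inl r"] \<phi>(2)[of "Inr (Inl p)"] \<phi>(2)[of "Inr (Inr q)"] by (auto simp: gens_def gR_def gP_def gQ_def)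
  have sub: "\<phi> (radd F a (rneg F b)) = rzero B" if "a \<in> rcarrier F" "b \<in> rcarrier F" "\<phi> a = \<phi> b" for a b
    using that rhom_addhom[OF \<phi>(1)] rhom_closed[OF \<phi>(1)] B.addhom_neg[OF rhom_addhom[OF \<phi>(1)] F.nu]
    by (simp add: addhom_add)
  have "\<phi> x = rzero B" if "x \<in> toep_rels R P Q psi" for x
    using that unfolding toep_rels_def Let_def
    by (elim UnE CollectE exE conjE; hypsubst; intro sub)
      (use cov in \<open>simp_all add: free_gen_closed bimod_closed g cov_rep_def rhom_mul[OF \<phi>(1)] rhom_add[OF \<phi>(1)] rhom_mul[of R B \<sigma>] rhom_add[of R B \<sigma>]\<close>)
  then have "K \<subseteq> {x \<in> rcarrier F. \<phi> x = rzero B}"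
    unfolding toep_ker_def using toep_rels_carrier by (intro ideal_gen_least F.is_ideal_kernel[OF \<phi>(1) B]) auto
  then have k: "\<And>x. x \<in> K \<Longrightarrow> \<phi> x = rzero B" by auto
  obtain h where "rhom TT B h" "\<forall>a\<in>rcarrier F. h (coset F K a) = \<phi> a"
    using F.quot_universal[OF toep_ker_ideal \<phi>(1) B k] unfolding toeplitz_def by blast
  then show ?thesis using g free_gen_closed unfolding iotaR_def iotaP_def iotaQ_def by metis
qed

lemma toep_generated:
  assumes "is_addsub TT H" "\<And>x y. x \<in> H \<Longrightarrow> y \<in> H \<Longrightarrow> rmul TT x y \<in> H"
    "\<And>r. r \<in> rcarrier R \<Longrightarrow> tR r \<in> H" "\<And>p. p \<in> mcar P \<Longrightarrow> tP p \<in> H" "\<And>q. q \<in> mcar Q \<Longrightarrow> tQ q \<in> H"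
  shows "rcarrier TT \<subseteq> H"
proof -
  let ?H = "{x \<in> rcarrier F. coset F K x \<in> H}"
  have "is_addsub F ?H" by (rule TT.addsub_preimage[OF assms(1) rhom_addhom[OF toep_proj] F.nu])
  then have "rcarrier (free_rng (gens R P Q)) \<subseteq> ?H"
    by (intro free_generated)
      (use assms(2-5) free_gen_closed in \<open>auto simp: FR_def[symmetric] rhom_mul[OF toep_proj] iotaR_def iotaP_def iotaQ_def gR_def gP_def gQ_def elim!: gens_cases\<close>)
  then show ?thesis unfolding toep_carrier FR_def by auto
qed

end

text \<open>\<open>J\<close> stays a parameter because the facts are applied both to a given system
  with its maximal ideal and to the new system over the degree-zero ring with its own ideal.\<close>

locale relcp = rsys R P Q psi
  for R :: "'r rng" and P :: "('r,'p) bimod" and Q :: "('r,'q) bimod" and psi :: "'p \<Rightarrow> 'q \<Rightarrow> 'r" +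
  fixes J :: "'r set"
  assumes J: "J \<subseteq> rcarrier R"
begin

abbreviation "B \<equiv> rel_cp R P Q psi J"
abbreviation "\<rho> \<equiv> rel_rho R P Q psi J"
abbreviation "\<sigma> r \<equiv> \<rho> (tR r)"
abbreviation "S p \<equiv> \<rho> (tP p)"
abbreviation "T q \<equiv> \<rho> (tQ q)"
abbreviation "g \<equiv> rel_cp_grading R P Q psi J"
abbreviation "ev \<equiv> gev \<sigma> S T"
definition wp :: "('r,'p,'q) fgen list \<Rightarrow> ('r,'p,'q) cpelt" where "wp w = rprod B (map ev w)"

lemma toep_gen_closed:
  "r \<in> rcarrier R \<Longrightarrow> tR r \<in> rcarrier TT" "p \<in> mcar P \<Longrightarrow> tP p \<in> rcarrier TT" "q \<in> mcar Q \<Longrightarrow> tQ q \<in> rcarrier TT"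
  using toep_cov by (auto simp: cov_rep_def rhom_def addhom_def)

lemma TJ_gens_carrier: "TJ_gens R P Q psi J \<subseteq> rcarrier TT"
  unfolding TJ_gens_def Let_def using J
  by (auto intro!: TT.add_closed TT.neg_closed TT.rsum_closed toep_gen_closed TT.mul_closed)

lemma TJ_ideal: "is_ideal TT (TJ R P Q psi J)"
  unfolding TJ_def by (rule TT.is_ideal_gen[OF TJ_gens_carrier])

sublocale B: nuring B
  unfolding rel_cp_def by unfold_locales (rule TT.nu_ring_quot[OF TJ_ideal])

lemma proj: "rhom TT B \<rho>"
  unfolding rel_cp_def rel_rho_def by (rule TT.rhom_coset[OF TJ_ideal])

lemma cov: "cov_rep R P Q psi B \<sigma> S T"
  using toep_cov proj unfolding cov_rep_def by (simp add: rhom_def addhom_def)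

lemma sum_closed_TT: "set l \<subseteq> mcar Q \<times> mcar P \<Longrightarrow> set (map (\<lambda>(q,p). rmul TT (tQ q) (tP p)) l) \<subseteq> rcarrier TT"
  using toep_gen_closed by auto

lemma covariant: "cp_covariant P Q psi J B \<sigma> S T"
  unfolding cp_covariant_def
proof (intro ballI allI impI)
  fix x l assume x: "x \<in> J" and l: "set l \<subseteq> mcar Q \<times> mcar P"
    "\<forall>y\<in>mcar Q. lact Q x y = msum Q (map (\<lambda>(q,p). ract Q q (psi p y)) l)"
  let ?m = "map (\<lambda>(q,p). rmul TT (tQ q) (tP p)) l"
  have "radd TT (tR x) (rneg TT (rsum TT ?m)) \<in> TJ R P Q psi J"
    unfolding TJ_def by (rule subsetD[OF ideal_gen_incl]) (use x l in \<open>auto simp: TJ_gens_def Let_def\<close>)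
  then have "\<rho> (tR x) = \<rho> (rsum TT ?m)"
    unfolding rel_rho_def using TT.coset_eq[OF TJ_ideal toep_gen_closed(1)[OF subsetD[OF J x]] TT.rsum_closed[OF sum_closed_TT[OF l(1)]]] by simp
  also have "\<dots> = rsum B (map \<rho> ?m)" by (rule B.addhom_rsum[OF rhom_addhom[OF proj] TT.nu sum_closed_TT[OF l(1)]])
  also have "map \<rho> ?m = map (\<lambda>(q,p). rmul B (T q) (S p)) l"
    using l(1) toep_gen_closed by (auto simp: rhom_mul[OF proj])
  finally show "\<sigma> x = rsum B (map (\<lambda>(q,p). rmul B (T q) (S p)) l)" .
qed

text \<open>The map out of the Toeplitz ring kills a generator of \<open>TJ\<close> precisely
  because the target satisfies \<open>cp_covariant\<close> for that element and that list.\<close>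

lemma universal:
  assumes C: "nu_ring C" and cov: "cov_rep R P Q psi C \<sigma>' S' T'" and cpc: "cp_covariant P Q psi J C \<sigma>' S' T'"
  shows "\<exists>h. rhom B C h \<and> (\<forall>r\<in>rcarrier R. h (\<sigma> r) = \<sigma>' r) \<and>
    (\<forall>p\<in>mcar P. h (S p) = S' p) \<and> (\<forall>q\<in>mcar Q. h (T q) = T' q)"
proof -
  interpret C: nuring C by (standard, rule C)
  obtain k where k: "rhom TT C k" and kg: "\<And>r. r\<in>rcarrier R \<Longrightarrow> k (tR r) = \<sigma>' r"
    "\<And>p. p\<in>mcar P \<Longrightarrow> k (tP p) = S' p" "\<And>q. q\<in>mcar Q \<Longrightarrow> k (tQ q) = T' q"
    using toep_universal[OF C cov] by blast
  note ka = rhom_addhom[OF k]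
  have "k x = rzero C" if "x \<in> TJ_gens R P Q psi J" for x
  proof -
    from that obtain x' l where x': "x' \<in> J" and l: "set l \<subseteq> mcar Q \<times> mcar P"
      "\<forall>y\<in>mcar Q. lact Q x' y = msum Q (map (\<lambda>(q,p). ract Q q (psi p y)) l)"
      and x: "x = radd TT (tR x') (rneg TT (rsum TT (map (\<lambda>(q,p). rmul TT (tQ q) (tP p)) l)))"
      unfolding TJ_gens_def Let_def by blast
    let ?m = "map (\<lambda>(q,p). rmul TT (tQ q) (tP p)) l"
    have "k (rsum TT ?m) = rsum C (map k ?m)" by (rule C.addhom_rsum[OF ka TT.nu sum_closed_TT[OF l(1)]])
    also have "map k ?m = map (\<lambda>(q,p). rmul C (T' q) (S' p)) l"
      using l(1) toep_gen_closed by (auto simp: rhom_mul[OF k] kg)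
    also have "rsum C \<dots> = k (tR x')" using cpc x' l J by (auto simp: cp_covariant_def kg)
    finally have e: "k (rsum TT ?m) = k (tR x')" .
    have "tR x' \<in> rcarrier TT" "rsum TT ?m \<in> rcarrier TT"
      using toep_gen_closed J x' TT.rsum_closed[OF sum_closed_TT[OF l(1)]] by auto
    then show ?thesis unfolding x using addhom_closed[OF ka] by (simp add: addhom_add[OF ka] C.addhom_neg[OF ka TT.nu] e)
  qed
  then have "TJ R P Q psi J \<subseteq> {x \<in> rcarrier TT. k x = rzero C}"
    unfolding TJ_def using TJ_gens_carrier by (intro ideal_gen_least TT.is_ideal_kernel[OF k C]) auto
  then have z: "\<And>x. x \<in> TJ R P Q psi J \<Longrightarrow> k x = rzero C" by auto
  obtain h where "rhom B C h" "\<forall>a\<in>rcarrier TT. h (\<rho> a) = k a"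
    using TT.quot_universal[OF TJ_ideal k C z] unfolding rel_cp_def rel_rho_def by blast
  then show ?thesis using kg toep_gen_closed by auto
qed

lemma generated:
  assumes "is_addsub B H" "\<And>x y. x \<in> H \<Longrightarrow> y \<in> H \<Longrightarrow> rmul B x y \<in> H"
    "\<And>r. r \<in> rcarrier R \<Longrightarrow> \<sigma> r \<in> H" "\<And>p. p \<in> mcar P \<Longrightarrow> S p \<in> H" "\<And>q. q \<in> mcar Q \<Longrightarrow> T q \<in> H"
  shows "rcarrier B \<subseteq> H"
proof -
  let ?H = "{x \<in> rcarrier TT. \<rho> x \<in> H}"
  have "is_addsub TT ?H" by (rule B.addsub_preimage[OF assms(1) rhom_addhom[OF proj] TT.nu])
  then have "rcarrier TT \<subseteq> ?H"
    by (intro toep_generated) (use assms(2-5) toep_gen_closed in \<open>auto simp: rhom_mul[OF proj]\<close>)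
  moreover have "rcarrier B = \<rho> ` rcarrier TT" unfolding rel_cp_def rel_rho_def by (rule TT.quot_carrier[OF TJ_ideal])
  ultimately show ?thesis by auto
qed

lemma gen_closed:
  "r \<in> rcarrier R \<Longrightarrow> \<sigma> r \<in> rcarrier B" "p \<in> mcar P \<Longrightarrow> S p \<in> rcarrier B" "q \<in> mcar Q \<Longrightarrow> T q \<in> rcarrier B"
  using cov by (auto simp: cov_rep_def rhom_def addhom_def)

lemma gen_rules:
  "r \<in> rcarrier R \<Longrightarrow> s \<in> rcarrier R \<Longrightarrow> rmul B (\<sigma> r) (\<sigma> s) = \<sigma> (rmul R r s)"
  "p \<in> mcar P \<Longrightarrow> r \<in> rcarrier R \<Longrightarrow> rmul B (S p) (\<sigma> r) = S (ract P p r)"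
  "p \<in> mcar P \<Longrightarrow> r \<in> rcarrier R \<Longrightarrow> rmul B (\<sigma> r) (S p) = S (lact P r p)"
  "q \<in> mcar Q \<Longrightarrow> r \<in> rcarrier R \<Longrightarrow> rmul B (T q) (\<sigma> r) = T (ract Q q r)"
  "q \<in> mcar Q \<Longrightarrow> r \<in> rcarrier R \<Longrightarrow> rmul B (\<sigma> r) (T q) = T (lact Q r q)"
  "p \<in> mcar P \<Longrightarrow> q \<in> mcar Q \<Longrightarrow> rmul B (S p) (T q) = \<sigma> (psi p q)"
  using cov by (simp_all add: cov_rep_def rhom_def)

lemma gen_add:
  "r \<in> rcarrier R \<Longrightarrow> r' \<in> rcarrier R \<Longrightarrow> \<sigma> (radd R r r') = radd B (\<sigma> r) (\<sigma> r')"
  "p \<in> mcar P \<Longrightarrow> p' \<in> mcar P \<Longrightarrow> S (madd P p p') = radd B (S p) (S p')"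
  "q \<in> mcar Q \<Longrightarrow> q' \<in> mcar Q \<Longrightarrow> T (madd Q q q') = radd B (T q) (T q')"
  using cov by (simp_all add: cov_rep_def rhom_def addhom_def)

lemma T_msum: "set xs \<subseteq> mcar Q \<Longrightarrow> T (msum Q xs) = rsum B (map T xs)"
proof (induction xs)
  case Nil
  \<comment> \<open>That \<open>T\<close> sends zero to zero is not among the axioms in
    \<open>cov_rep\<close>; it follows because the image of zero is additively idempotent.\<close>
  have "madd Q (mzero Q) (mzero Q) = mzero Q" using sys by (simp add: rsystem_def bimodule_def)
  then have "radd B (T (mzero Q)) (T (mzero Q)) = T (mzero Q)"
    using gen_add(3)[of "mzero Q" "mzero Q"] bimod_closed(8) by simp
  then show ?case using B.idem_zero gen_closed(3) bimod_closed(8) by (simp add: msum_def)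
next
  case (Cons x xs)
  have "msum Q xs \<in> mcar Q" using Cons.prems by (induction xs) (auto simp: msum_def bimod_closed)
  then show ?case using Cons by (simp add: msum_def gen_add)
qed

lemma S_msum: "set xs \<subseteq> mcar P \<Longrightarrow> S (msum P xs) = rsum B (map S xs)"
proof (induction xs)
  case Nil
  have "madd P (mzero P) (mzero P) = mzero P" using sys by (simp add: rsystem_def bimodule_def)
  then have "radd B (S (mzero P)) (S (mzero P)) = S (mzero P)"
    using gen_add(2)[of "mzero P" "mzero P"] bimod_closed(9) by simp
  then show ?case using B.idem_zero gen_closed(2) bimod_closed(9) by (simp add: msum_def)
next
  case (Cons x xs)
  have "msum P xs \<in> mcar P" using Cons.prems by (induction xs) (auto simp: msum_def bimod_closed)
  then show ?case using Cons by (simp add: msum_def gen_add)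
qed

section \<open>Words, their values, and the grading they span\<close>

lemma ev_closed: "x \<in> gens R P Q \<Longrightarrow> ev x \<in> rcarrier B"
  by (elim gens_cases) (auto simp: gen_closed)

lemma wp_closed: "w \<noteq> [] \<Longrightarrow> set w \<subseteq> gens R P Q \<Longrightarrow> wp w \<in> rcarrier B"
  unfolding wp_def by (rule B.rprod_closed) (auto intro: ev_closed)

lemma wp_append: "v \<noteq> [] \<Longrightarrow> w \<noteq> [] \<Longrightarrow> set v \<subseteq> gens R P Q \<Longrightarrow> set w \<subseteq> gens R P Q \<Longrightarrow> wp (v @ w) = rmul B (wp v) (wp w)"
  unfolding wp_def map_append by (rule B.rprod_append) (auto intro: ev_closed)

lemma wp_Cons: "w \<noteq> [] \<Longrightarrow> wp (x # w) = rmul B (ev x) (wp w)"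
  by (simp add: wp_def B.rprod_Cons)

lemma wp_single [simp]: "wp [x] = ev x"
  by (simp add: wp_def)

lemma wp_normal_carrier: "wp ` normal_words R P Q i \<subseteq> rcarrier B"
  using wp_closed normal_words_gens by blast

lemma grading_eq: "g i = addsub_gen B (wp ` normal_words R P Q i)"
proof -
  let ?tw = "\<lambda>w. rprod TT (map (gev tR tP tQ) w)"
  have tc: "set (map (gev tR tP tQ) w) \<subseteq> rcarrier TT" if "set w \<subseteq> gens R P Q" for w
    using that toep_gen_closed by (auto simp: gens_def)
  have "\<rho> (?tw w) = wp w" if "w \<in> normal_words R P Q i" for w
  proof -
    have w: "w \<noteq> []" "set w \<subseteq> gens R P Q" using normal_words_gens[OF that] by auto
    have "\<rho> (?tw w) = rprod B (map \<rho> (map (gev tR tP tQ) w))"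
      by (rule TT.rhom_rprod[OF proj]) (use w tc[OF w(2)] in auto)
    also have "map \<rho> (map (gev tR tP tQ) w) = map ev w" by (auto split: sum.split)
    finally show ?thesis unfolding wp_def .
  qed
  then have "\<rho> ` ?tw ` normal_words R P Q i = wp ` normal_words R P Q i" by (simp add: image_image)
  moreover have "?tw ` normal_words R P Q i \<subseteq> rcarrier TT"
    using TT.rprod_closed tc normal_words_gens by (metis (no_types, lifting) image_subsetI map_is_Nil_conv)
  ultimately show ?thesis
    unfolding rel_cp_grading_def toep_grading_def toep_monos_words
    by (simp add: B.addsub_gen_image[OF _ rhom_addhom[OF proj] TT.nu])
qed

lemma grading_addsub: "is_addsub B (g i)"
  unfolding grading_eq by (rule B.is_addsub_gen[OF wp_normal_carrier])

lemma grading_carrier: "g i \<subseteq> rcarrier B"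
  using grading_addsub by (auto simp: is_addsub_def)

lemma wp_in_grading: "w \<in> normal_words R P Q i \<Longrightarrow> wp w \<in> g i"
  unfolding grading_eq by (rule subsetD[OF addsub_gen_incl]) auto

lemma grading_least:
  assumes "addhom B C f" "nu_ring C" "is_addsub C H" "\<And>w. w \<in> normal_words R P Q i \<Longrightarrow> f (wp w) \<in> H" "x \<in> g i"
  shows "f x \<in> H"
  using assms(5) unfolding grading_eq
  by (rule B.addsub_gen_memI[OF _ wp_normal_carrier assms(2,1,3)]) (use assms(4) in auto)

text \<open>Rewrites two adjacent letters into one. The case of no further letters is separate,
  since the value of a one-letter word is not a product.\<close>

lemma wp_merge:
  assumes "a \<in> gens R P Q" "b \<in> gens R P Q" "rmul B (ev a) (ev b) = ev c" "set v \<subseteq> gens R P Q"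
  shows "rmul B (ev a) (wp (b # v)) = wp (c # v)"
proof (cases "v = []")
  case True
  then show ?thesis using assms by simp
next
  case False
  have "rmul B (ev a) (rmul B (ev b) (wp v)) = rmul B (rmul B (ev a) (ev b)) (wp v)"
    using B.mul_assoc[of "ev a" "ev b" "wp v"] assms ev_closed wp_closed[OF False assms(4)] by metis
  with False show ?thesis using assms(3) by (simp add: wp_Cons)
qed

text \<open>Normal words are stable under left multiplication by a letter: a coefficient or a letter
  of \<open>Q\<close> is prepended, or merged with a leading coefficient; \<open>p\<close> meeting
  \<open>q\<close> collapses to \<open>psi p q\<close>; and \<open>p\<close> meeting a coefficient
  \<open>r\<close> becomes \<open>p r\<close>, which leads back to words without
  coefficient.\<close>

lemma gen_mul_normal:
  assumes x: "x \<in> gens R P Q" and w: "w \<in> normal_words R P Q i"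
  shows "rmul B (ev x) (wp w) \<in> wp ` normal_words R P Q (gdeg x + i)"
proof -
  have gens: "r \<in> rcarrier R \<Longrightarrow> Inl r \<in> gens R P Q" "p \<in> mcar P \<Longrightarrow> Inr (Inl p) \<in> gens R P Q"
    "q \<in> mcar Q \<Longrightarrow> Inr (Inr q) \<in> gens R P Q" for r p q by (auto simp: gens_def)
  have vg: "set (qp_word qs ps :: ('r,'p,'q) fgen list) \<subseteq> gens R P Q" if "set qs \<subseteq> mcar Q" "set ps \<subseteq> mcar P" for qs ps
    using that by (auto simp: gens_def)
  have Pcase: "rmul B (S p) (wp (qp_word qs ps)) \<in> wp ` normal_words R P Q (-1 + i)"
    if h: "p \<in> mcar P" "set qs \<subseteq> mcar Q" "set ps \<subseteq> mcar P" "length qs + length ps > 0" "int (length qs) - int (length ps) = i"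
    for p qs ps
  proof (cases qs)
    case Nil
    have "rmul B (S p) (wp (qp_word qs ps)) = wp (qp_word [] (p # ps))" using h Nil by (simp add: wp_Cons)
    then show ?thesis using h Nil by (intro image_eqI[OF _ normal_wordsI(1)[of "[]" Q "p # ps"]]) auto
  next
    case (Cons q qs')
    have "rmul B (ev (Inr (Inl p))) (wp (Inr (Inr q) # qp_word qs' ps)) = wp (Inl (psi p q) # qp_word qs' ps)"
      by (rule wp_merge) (use h Cons vg gens in \<open>auto simp: gen_rules\<close>)
    then show ?thesis using h Cons by (intro image_eqI[OF _ normal_wordsI(2)[of "psi p q" R qs' Q ps P]]) (auto simp: bimod_closed)
  qed
  from w consider (a) qs ps where "w = qp_word qs ps" "set qs \<subseteq> mcar Q" "set ps \<subseteq> mcar P" "length qs + length ps > 0"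
      "int (length qs) - int (length ps) = i"
    | (b) r qs ps where "w = Inl r # qp_word qs ps" "r \<in> rcarrier R" "set qs \<subseteq> mcar Q" "set ps \<subseteq> mcar P"
      "int (length qs) - int (length ps) = i"
    unfolding normal_words_def by blast
  then show ?thesis
  proof cases
    case a
    have ne: "w \<noteq> []" using a by auto
    note xw = wp_Cons[OF ne, of x, symmetric]
    from x show ?thesis
    proof (cases rule: gens_cases)
      case (1 r)
      then show ?thesis using a normal_wordsI(2)[of r R qs Q ps P i] unfolding xw by (intro imageI) auto
    next
      case (2 p)
      then show ?thesis using Pcase a by auto
    next
      case (3 q)
      then show ?thesis using a normal_wordsI(1)[of "q # qs" Q ps P "1 + i" R] unfolding xw by (intro imageI) auto
    qed
  next
    case b
    let ?v = "qp_word qs ps :: ('r,'p,'q) fgen list"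
    from x show ?thesis
    proof (cases rule: gens_cases)
      case (1 s)
      have "rmul B (ev (Inl s)) (wp (Inl r # ?v)) = wp (Inl (rmul R s r) # ?v)"
        by (rule wp_merge) (use 1 b gens vg in \<open>auto simp: gen_rules\<close>)
      then show ?thesis using b 1 normal_wordsI(2)[of "rmul R s r" R qs Q ps P i] by auto
    next
      case (2 p)
      have e: "rmul B (ev (Inr (Inl p))) (wp (Inl r # ?v)) = wp (Inr (Inl (ract P p r)) # ?v)"
        by (rule wp_merge) (use 2 b gens vg in \<open>auto simp: gen_rules\<close>)
      show ?thesis
      proof (cases "?v = []")
        \<comment> \<open>Nothing follows the coefficient here, so the result is the single letter
          \<open>p r\<close>; \<open>Pcase\<close> covers only a nonempty remainder.\<close>
        case True
        then have "[Inr (Inl (ract P p r))] \<in> normal_words R P Q (-1 + i)"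
          using b 2 normal_wordsI(1)[of "[]" Q "[ract P p r]" P "-1" R] by (auto simp: bimod_closed)
        then show ?thesis using e b(1) 2 True by (auto simp del: wp_single)
      next
        case False
        then have "wp (Inr (Inl (ract P p r)) # ?v) \<in> wp ` normal_words R P Q (-1 + i)"
          unfolding wp_Cons[OF False] using Pcase[OF bimod_closed(3)[OF 2(2) b(2)] b(3,4) _ b(5)] by simp
        then show ?thesis using e b 2 by simp
      qed
    next
      case (3 q)
      have "rmul B (ev (Inr (Inr q))) (wp (Inl r # ?v)) = wp (Inr (Inr (ract Q q r)) # ?v)"
        by (rule wp_merge) (use 3 b gens vg in \<open>auto simp: gen_rules\<close>)
      then show ?thesis using b 3 normal_wordsI(1)[of "ract Q q r # qs" Q ps P "1 + i" R] by (auto simp: bimod_closed)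
    qed
  qed
qed

lemma gen_mul_grading:
  assumes "x \<in> gens R P Q" "y \<in> g i" shows "rmul B (ev x) y \<in> g (gdeg x + i)"
  by (rule grading_least[OF B.addhom_lmul[OF ev_closed[OF assms(1)]] B.nu grading_addsub _ assms(2)])
    (use gen_mul_normal[OF assms(1)] wp_in_grading in fastforce)

lemma gen_grading:
  "r \<in> rcarrier R \<Longrightarrow> \<sigma> r \<in> g 0" "p \<in> mcar P \<Longrightarrow> S p \<in> g (-1)" "q \<in> mcar Q \<Longrightarrow> T q \<in> g 1"
  using wp_in_grading[OF normal_wordsI(2)[of r R "[]" Q "[]" P]] wp_in_grading[OF normal_wordsI(1)[of "[]" Q "[p]" P]]
    wp_in_grading[OF normal_wordsI(1)[of "[q]" Q "[]" P]] by auto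

text \<open>The right factor stays an arbitrary element of degree \<open>j\<close>; the letters of a
  word on the left are multiplied onto it one by one, the last letter first, each shifting the
  degree by \<open>gdeg\<close>.\<close>

lemma grading_mul:
  assumes x: "x \<in> g i" and y: "y \<in> g j" shows "rmul B x y \<in> g (i + j)"
proof -
  have yc: "y \<in> rcarrier B" using y grading_carrier by auto
  have w: "rmul B (wp w) y \<in> g (sum_list (map gdeg w) + j)" if "w \<noteq> []" "set w \<subseteq> gens R P Q" for w
    using that
  proof (induction w)
    case (Cons a w)
    show ?case
    proof (cases "w = []")
      case True
      then show ?thesis using gen_mul_grading[OF _ y, of a] Cons by simp
    next
      case False
      have "rmul B (rmul B (ev a) (wp w)) y = rmul B (ev a) (rmul B (wp w) y)"
        by (rule B.mul_assoc) (use Cons.prems yc wp_closed[OF False] ev_closed in auto)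
      then show ?thesis using gen_mul_grading[of a "rmul B (wp w) y"] Cons False by (auto simp: wp_Cons add.assoc)
    qed
  qed simp
  have d: "sum_list (map gdeg w) = i" if "w \<in> normal_words R P Q i" for w
    using that by (auto simp: normal_words_def sum_list_triv comp_def)
  show ?thesis
    by (rule grading_least[OF B.addhom_rmul[OF yc] B.nu grading_addsub _ x]) (use w d normal_words_gens in metis)
qed

text \<open>The degree of a word is the sum of the degrees of its letters, so only the images of the
  generators need to be located.\<close>

lemma graded_hom:
  assumes f: "rhom B C f" and C: "nu_ring C" and G: "\<And>i. is_addsub C (G i)"
    and Gm: "\<And>i j x y. x \<in> G i \<Longrightarrow> y \<in> G j \<Longrightarrow> rmul C x y \<in> G (i + j)"
    and gen: "\<And>r. r \<in> rcarrier R \<Longrightarrow> f (\<sigma> r) \<in> G 0" "\<And>p. p \<in> mcar P \<Longrightarrow> f (S p) \<in> G (-1)"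
      "\<And>q. q \<in> mcar Q \<Longrightarrow> f (T q) \<in> G 1"
    and x: "x \<in> g i"
  shows "f x \<in> G i"
proof (rule grading_least[OF rhom_addhom[OF f] C G _ x])
  have a: "f (ev a) \<in> G (gdeg a)" if "a \<in> gens R P Q" for a using that gen by (elim gens_cases) auto
  have w: "f (wp w) \<in> G (sum_list (map gdeg w))" if "w \<noteq> []" "set w \<subseteq> gens R P Q" for w
    using that
  proof (induction w)
    case (Cons a w)
    show ?case
    proof (cases "w = []")
      case True
      then show ?thesis using a Cons by simp
    next
      case False
      then have "f (wp (a # w)) = rmul C (f (ev a)) (f (wp w))"
        using Cons.prems ev_closed wp_closed[OF False] by (simp add: wp_Cons rhom_mul[OF f])
      then show ?thesis using Gm[OF a Cons.IH] Cons.prems False by simp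
    qed
  qed simp
  fix w :: "('r,'p,'q) fgen list" assume "w \<in> normal_words R P Q i"
  moreover from this have "sum_list (map gdeg w) = i" by (auto simp: normal_words_def sum_list_triv comp_def)
  ultimately show "f (wp w) \<in> G i" using w normal_words_gens by metis
qed

end

section \<open>Unital systems\<close>

lemma (in nuring) nu_ring_subring:
  assumes H: "is_addsub A H" and m: "\<And>x y. x \<in> H \<Longrightarrow> y \<in> H \<Longrightarrow> x \<boxdot> y \<in> H"
  shows "nu_ring (A\<lparr>rcarrier := H\<rparr>)"
proof -
  have c: "\<And>x. x \<in> H \<Longrightarrow> x \<in> rcarrier A" "rzero A \<in> H" "\<And>x y. x \<in> H \<Longrightarrow> y \<in> H \<Longrightarrow> x \<boxplus> y \<in> H"
    "\<And>x. x \<in> H \<Longrightarrow> \<boxminus> x \<in> H" using H by (auto simp: is_addsub_def)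
  show ?thesis unfolding nu_ring_def by (simp add: c m add_ac mul_assoc distl distr)
qed

context relcp
begin

lemma grading_prod_set: "prod_set B (g i) (g j) \<subseteq> g (i + j)"
  by (rule B.prod_set_least[OF grading_addsub grading_mul])

lemma nu_ring_degree_zero: "nu_ring (B\<lparr>rcarrier := g 0\<rparr>)"
  using B.nu_ring_subring[OF grading_addsub] grading_mul[of _ 0 _ 0] by simp

lemma prod_set_carrier: "x \<in> prod_set B (g i) (g j) \<Longrightarrow> x \<in> rcarrier B"
  using grading_prod_set grading_carrier by blast

lemma addsub_degree_zero: "is_addsub (B\<lparr>rcarrier := g 0\<rparr>) H \<Longrightarrow> is_addsub B H"
  using grading_carrier[of 0] by (auto simp: is_addsub_def)

text \<open>By associativity a degree-zero factor is absorbed by the neighbouring factor without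
  changing its degree. Since \<open>i\<close> may be negative, both orders of the two components are
  covered.\<close>

lemma prod_set_opposite_ideal: "is_ideal (B\<lparr>rcarrier := g 0\<rparr>) (prod_set B (g (-i)) (g i))"
proof -
  let ?I = "prod_set B (g (-i)) (g i)"
  have I: "is_addsub B ?I" by (intro B.is_addsub_prod_set grading_carrier)
  have sub: "?I \<subseteq> g 0" using grading_prod_set[of "-i" i] by simp
  have "rmul B a x \<in> ?I \<and> rmul B x a \<in> ?I" if x: "x \<in> ?I" and a: "a \<in> g 0" for x a
  proof
    have ac: "a \<in> rcarrier B" using a grading_carrier by auto
    have c: "y \<in> g j \<Longrightarrow> y \<in> rcarrier B" for y j using grading_carrier by auto
    show "rmul B a x \<in> ?I"
    proof (rule B.prod_set_memI[OF x grading_carrier grading_carrier B.nu B.addhom_lmul[OF ac] I])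
      fix y z assume yz: "y \<in> g (-i)" "z \<in> g i"
      have "rmul B a (rmul B y z) = rmul B (rmul B a y) z" using ac yz c by (simp add: B.mul_assoc)
      then show "rmul B a (rmul B y z) \<in> ?I" using grading_mul[OF a yz(1)] yz(2) by (simp add: B.prod_setI)
    qed
    show "rmul B x a \<in> ?I"
    proof (rule B.prod_set_memI[OF x grading_carrier grading_carrier B.nu B.addhom_rmul[OF ac] I])
      fix y z assume yz: "y \<in> g (-i)" "z \<in> g i"
      have "rmul B (rmul B y z) a = rmul B y (rmul B z a)" using ac yz c by (simp add: B.mul_assoc)
      then show "rmul B (rmul B y z) a \<in> ?I" using grading_mul[OF yz(2) a] yz(1) by (simp add: B.prod_setI)
    qed
  qed
  then show ?thesis using I sub unfolding is_ideal_def is_addsub_def by auto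
qed

end

locale unital_relcp = relcp R P Q psi J
  for R :: "'r rng" and P :: "('r,'p) bimod" and Q :: "('r,'q) bimod" and psi :: "'p \<Rightarrow> 'q \<Rightarrow> 'r" and J +
  assumes unital: "unital_system R P Q"
begin

definition u :: 'r where "u = (SOME e. e \<in> rcarrier R \<and> (\<forall>x\<in>rcarrier R. rmul R e x = x \<and> rmul R x e = x))"

lemma u: "u \<in> rcarrier R" "x \<in> rcarrier R \<Longrightarrow> rmul R u x = x" "x \<in> rcarrier R \<Longrightarrow> rmul R x u = x"
proof -
  have "\<exists>e. e \<in> rcarrier R \<and> (\<forall>x\<in>rcarrier R. rmul R e x = x \<and> rmul R x e = x)"
    using unital by (auto simp: unital_system_def unital_rng_def)
  from someI_ex[OF this, folded u_def]
  show "u \<in> rcarrier R" "x \<in> rcarrier R \<Longrightarrow> rmul R u x = x" "x \<in> rcarrier R \<Longrightarrow> rmul R x u = x" by auto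
qed

text \<open>The elements \<open>a\<close>, \<open>b\<close> witnessing unitality of \<open>M\<close>
  may differ from \<open>u\<close>, but \<open>u x = u (a x) = (u a) x = a x = x\<close>, and
  likewise on the right.\<close>

lemma unital_bimod_unit:
  assumes "bimodule R M" "unital_bimod R M" "x \<in> mcar M"
  shows "lact M u x = x" "ract M x u = x"
proof -
  obtain a b where ab: "a \<in> rcarrier R" "b \<in> rcarrier R" "lact M a x = x" "ract M x b = x"
    using assms(2,3) by (auto simp: unital_bimod_def)
  have "lact M u (lact M a x) = lact M (rmul R u a) x" "ract M (ract M x b) u = ract M x (rmul R b u)"
    using assms(1,3) ab(1,2) u(1) by (simp_all add: bimodule_def)
  then show "lact M u x = x" "ract M x u = x" using ab u by auto
qed

lemma unit_bimod:
  "p \<in> mcar P \<Longrightarrow> lact P u p = p" "p \<in> mcar P \<Longrightarrow> ract P p u = p"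
  "q \<in> mcar Q \<Longrightarrow> lact Q u q = q" "q \<in> mcar Q \<Longrightarrow> ract Q q u = q"
  using unital sys unital_bimod_unit[of P] unital_bimod_unit[of Q] by (auto simp: unital_system_def rsystem_def)

abbreviation "idn \<equiv> \<sigma> u"

lemma one_closed: "idn \<in> rcarrier B"
  using gen_closed u by auto

text \<open>The elements fixed by \<open>idn\<close> from the left form a subring that contains all
  generators, because \<open>u\<close> acts as the identity on \<open>R\<close>, \<open>P\<close>
  and \<open>Q\<close>.\<close>

lemma one_mul: "x \<in> rcarrier B \<Longrightarrow> rmul B idn x = x"
proof -
  have "is_addsub B {x \<in> rcarrier B. rmul B idn x = x}"
    by (rule B.addsub_equalizer[OF B.addhom_lmul[OF one_closed] addhom_id B.nu])
  then have "rcarrier B \<subseteq> {x \<in> rcarrier B. rmul B idn x = x}"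
    by (rule generated) (auto simp: gen_closed gen_rules u unit_bimod one_closed simp flip: B.mul_assoc)
  then show "x \<in> rcarrier B \<Longrightarrow> rmul B idn x = x" by auto
qed

lemma mul_one: "x \<in> rcarrier B \<Longrightarrow> rmul B x idn = x"
proof -
  have "is_addsub B {x \<in> rcarrier B. rmul B x idn = x}"
    by (rule B.addsub_equalizer[OF B.addhom_rmul[OF one_closed] addhom_id B.nu])
  then have "rcarrier B \<subseteq> {x \<in> rcarrier B. rmul B x idn = x}"
    by (rule generated) (auto simp: gen_closed gen_rules u unit_bimod one_closed B.mul_assoc)
  then show "x \<in> rcarrier B \<Longrightarrow> rmul B x idn = x" by auto
qed

lemma one_grading: "idn \<in> g 0"
  using gen_grading u by auto

text \<open>A word of positive degree has a letter from \<open>Q\<close>; the first one is split off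
  after absorbing a leading coefficient. If nothing remains, then \<open>k = 0\<close> and
  \<open>idn\<close> takes the place of the missing word.\<close>

lemma normal_word_pos:
  assumes w: "w \<in> normal_words R P Q (int (Suc k))"
  shows "\<exists>q\<in>mcar Q. \<exists>y\<in>g (int k). wp w = rmul B (T q) y"
proof -
  have vg: "set (qp_word qs ps :: ('r,'p,'q) fgen list) \<subseteq> gens R P Q" if "set qs \<subseteq> mcar Q" "set ps \<subseteq> mcar P" for qs ps
    using that by (auto simp: gens_def)
  have *: "\<exists>q\<in>mcar Q. \<exists>y\<in>g (int k). wp (Inr (Inr q0) # qp_word qs ps) = rmul B (T q) y"
    if h: "q0 \<in> mcar Q" "set qs \<subseteq> mcar Q" "set ps \<subseteq> mcar P" "int (length qs) - int (length ps) = int k" for q0 qs ps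
  proof (cases "qp_word qs ps = ([] :: ('r,'p,'q) fgen list)")
    case True
    then have "wp (Inr (Inr q0) # qp_word qs ps) = rmul B (T q0) idn" "k = 0"
      using mul_one gen_closed h by auto
    then show ?thesis using h one_grading by auto
  next
    case False
    then have "wp (qp_word qs ps) \<in> g (int k)" using h by (intro wp_in_grading normal_wordsI) auto
    then show ?thesis using h False by (auto simp: wp_Cons)
  qed
  from w consider (a) qs ps where "w = qp_word qs ps" "set qs \<subseteq> mcar Q" "set ps \<subseteq> mcar P" 
      "int (length qs) - int (length ps) = int (Suc k)"
    | (b) r qs ps where "w = Inl r # qp_word qs ps" "r \<in> rcarrier R" "set qs \<subseteq> mcar Q" "set ps \<subseteq> mcar P"
      "int (length qs) - int (length ps) = int (Suc k)"
    unfolding normal_words_def by blast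
  then show ?thesis
  proof cases
    case a
    then obtain q0 qs' where "qs = q0 # qs'" by (cases qs) auto
    then show ?thesis using *[of q0 qs' ps] a by auto
  next
    case b
    then obtain q0 qs' where q: "qs = q0 # qs'" by (cases qs) auto
    have "rmul B (ev (Inl r)) (wp (Inr (Inr q0) # qp_word qs' ps)) = wp (Inr (Inr (lact Q r q0)) # qp_word qs' ps)"
      by (rule wp_merge) (use b q vg[of qs' ps] in \<open>auto simp: gen_rules gens_def\<close>)
    then have "wp w = wp (Inr (Inr (lact Q r q0)) # qp_word qs' ps)" using b q by (simp add: wp_Cons)
    then show ?thesis using *[of "lact Q r q0" qs' ps] b q by (auto simp: bimod_closed)
  qed
qed

text \<open>Mirror image: the last letter from \<open>P\<close> is split off on the right, and a
  leading coefficient simply stays with the remaining word.\<close>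

lemma normal_word_neg:
  assumes w: "w \<in> normal_words R P Q (- int (Suc k))"
  shows "\<exists>p\<in>mcar P. \<exists>y\<in>g (- int k). wp w = rmul B y (S p)"
proof -
  have vg: "set (qp_word qs ps :: ('r,'p,'q) fgen list) \<subseteq> gens R P Q" if "set qs \<subseteq> mcar Q" "set ps \<subseteq> mcar P" for qs ps
    using that by (auto simp: gens_def)
  from w consider (a) qs ps where "w = qp_word qs ps" "set qs \<subseteq> mcar Q" "set ps \<subseteq> mcar P" 
      "int (length qs) - int (length ps) = - int (Suc k)"
    | (b) r qs ps where "w = Inl r # qp_word qs ps" "r \<in> rcarrier R" "set qs \<subseteq> mcar Q" "set ps \<subseteq> mcar P"
      "int (length qs) - int (length ps) = - int (Suc k)"
    unfolding normal_words_def by blast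
  then show ?thesis
  proof cases
    case a
    then obtain p0 ps' where p: "ps = ps' @ [p0]" by (cases ps rule: rev_cases) auto
    show ?thesis
    proof (cases "qp_word qs ps' = ([] :: ('r,'p,'q) fgen list)")
      case True
      then have "wp w = rmul B idn (S p0)" "k = 0"
        using one_mul gen_closed p a by auto
      then show ?thesis using p a one_grading by auto
    next
      case False
      have "wp w = rmul B (wp (qp_word qs ps')) (wp [Inr (Inl p0)])"
        unfolding a(1) p using a p wp_append[OF False, of "[Inr (Inl p0)]"] vg[of qs ps'] by (simp add: gens_def)
      moreover have "wp (qp_word qs ps') \<in> g (- int k)" using False a p by (intro wp_in_grading normal_wordsI) auto
      ultimately show ?thesis using p a by auto
    qed
  next
    case b
    then obtain p0 ps' where p: "ps = ps' @ [p0]" by (cases ps rule: rev_cases) auto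
    have "wp w = rmul B (wp (Inl r # qp_word qs ps')) (wp [Inr (Inl p0)])"
      unfolding b(1) p using b p wp_append[of "Inl r # qp_word qs ps'" "[Inr (Inl p0)]"] vg[of qs ps'] by (simp add: gens_def)
    moreover have "wp (Inl r # qp_word qs ps') \<in> g (- int k)" using b p by (intro wp_in_grading normal_wordsI) auto
    ultimately show ?thesis using p b by auto
  qed
qed

lemma T_image_carrier: "T ` mcar Q \<subseteq> rcarrier B" and S_image_carrier: "S ` mcar P \<subseteq> rcarrier B"
  using gen_closed by auto

lemma grading_pos: "g (int (Suc k)) \<subseteq> prod_set B (T ` mcar Q) (g (int k))"
proof -
  have "wp ` normal_words R P Q (int (Suc k)) \<subseteq> prod_set B (T ` mcar Q) (g (int k))"
    using normal_word_pos[of _ k] B.prod_setI[of _ "T ` mcar Q" _ "g (int k)"] by fastforce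
  then show ?thesis
    unfolding grading_eq[of "int (Suc k)"] by (intro addsub_gen_least B.is_addsub_prod_set T_image_carrier grading_carrier)
qed

lemma grading_neg: "g (- int (Suc k)) \<subseteq> prod_set B (g (- int k)) (S ` mcar P)"
proof -
  have "wp ` normal_words R P Q (- int (Suc k)) \<subseteq> prod_set B (g (- int k)) (S ` mcar P)"
    using normal_word_neg[of _ k] B.prod_setI[of _ "g (- int k)" _ "S ` mcar P"] by fastforce
  then show ?thesis
    unfolding grading_eq[of "- int (Suc k)"] by (intro addsub_gen_least B.is_addsub_prod_set S_image_carrier grading_carrier)
qed

subsection \<open>Semi-fullness\<close>

text \<open>Ending the product in \<open>idn\<close> gives the empty list a value, so that degree
  zero needs no separate treatment.\<close>

definition Tw :: "'q list \<Rightarrow> ('r,'p,'q) cpelt" where "Tw qs = foldr (\<lambda>q z. rmul B (T q) z) qs idn"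
definition Sw :: "'p list \<Rightarrow> ('r,'p,'q) cpelt" where "Sw ps = foldr (\<lambda>p z. rmul B (S p) z) ps idn"

lemma Tw_simps [simp]: "Tw [] = idn" "Tw (q # qs) = rmul B (T q) (Tw qs)"
  and Sw_simps [simp]: "Sw [] = idn" "Sw (p # ps) = rmul B (S p) (Sw ps)"
  by (auto simp: Tw_def Sw_def)

lemma Tw_closed: "set qs \<subseteq> mcar Q \<Longrightarrow> Tw qs \<in> rcarrier B"
  by (induction qs) (auto simp: one_closed gen_closed)

lemma Sw_closed: "set ps \<subseteq> mcar P \<Longrightarrow> Sw ps \<in> rcarrier B"
  by (induction ps) (auto simp: one_closed gen_closed)

lemma Tw_grading: "set qs \<subseteq> mcar Q \<Longrightarrow> Tw qs \<in> g (int (length qs))"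
proof (induction qs)
  case (Cons q qs)
  then show ?case using grading_mul[OF gen_grading(3), of q "Tw qs" "int (length qs)"] by simp
qed (simp add: one_grading)

lemma Sw_grading: "set ps \<subseteq> mcar P \<Longrightarrow> Sw ps \<in> g (- int (length ps))"
proof (induction ps)
  case (Cons q qs)
  then show ?case using grading_mul[OF gen_grading(2), of q "Sw qs" "- int (length qs)"] by simp
qed (simp add: one_grading)

lemma Tw_snoc: "set qs \<subseteq> mcar Q \<Longrightarrow> q \<in> mcar Q \<Longrightarrow> Tw (qs @ [q]) = rmul B (Tw qs) (T q)"
  by (induction qs) (simp_all add: gen_closed one_mul mul_one B.mul_assoc Tw_closed)

lemma Sw_snoc: "set ps \<subseteq> mcar P \<Longrightarrow> p \<in> mcar P \<Longrightarrow> Sw (ps @ [p]) = rmul B (Sw ps) (S p)"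
  by (induction ps) (simp_all add: gen_closed one_mul mul_one B.mul_assoc Sw_closed)

text \<open>Iterating \<open>grading_pos\<close> strips \<open>k\<close> factors from
  \<open>Q\<close> and leaves an element of degree zero.\<close>

lemma grading_pos_words: "g (int k) \<subseteq> prod_set B {Tw qs | qs. set qs \<subseteq> mcar Q \<and> length qs = k} (g 0)"
proof (induction k)
  case 0
  show ?case using B.prod_setI[of idn "{Tw qs | qs. set qs \<subseteq> mcar Q \<and> length qs = 0}" _ "g 0"] one_mul grading_carrier
    by (fastforce simp: subset_iff)
next
  case (Suc k)
  let ?W = "\<lambda>k. {Tw qs | qs. set qs \<subseteq> mcar Q \<and> length qs = k}"
  have Wc: "?W k \<subseteq> rcarrier B" for k using Tw_closed by auto
  note H = B.is_addsub_prod_set[OF Wc grading_carrier, of "Suc k" 0]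
  have "rmul B (T q) y \<in> prod_set B (?W (Suc k)) (g 0)" if q: "q \<in> mcar Q" and y: "y \<in> g (int k)" for q y
  proof (rule B.prod_set_memI[OF subsetD[OF Suc y] Wc grading_carrier B.nu B.addhom_lmul[OF gen_closed(3)[OF q]] H])
    fix a z assume a: "a \<in> ?W k" and z: "z \<in> g 0"
    then obtain qs where qs: "a = Tw qs" "set qs \<subseteq> mcar Q" "length qs = k" by auto
    have "rmul B (T q) (rmul B a z) = rmul B (Tw (q # qs)) z"
      using qs z q grading_carrier[of 0] by (auto simp: B.mul_assoc gen_closed Tw_closed)
    then show "rmul B (T q) (rmul B a z) \<in> prod_set B (?W (Suc k)) (g 0)"
      using z qs q by (auto intro!: B.prod_setI exI[of _ "q # qs"] simp del: Tw_simps)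
  qed
  then have "prod_set B (T ` mcar Q) (g (int k)) \<subseteq> prod_set B (?W (Suc k)) (g 0)" by (intro B.prod_set_least H) auto
  then show ?case using grading_pos[of k] by blast
qed

lemma grading_neg_words: "g (- int k) \<subseteq> prod_set B (g 0) {Sw ps | ps. set ps \<subseteq> mcar P \<and> length ps = k}"
proof (induction k)
  case 0
  show ?case using B.prod_setI[of _ "g 0" idn "{Sw qs | qs. set qs \<subseteq> mcar P \<and> length qs = 0}"] mul_one grading_carrier
    by (fastforce simp: subset_iff)
next
  case (Suc k)
  let ?W = "\<lambda>k. {Sw ps | ps. set ps \<subseteq> mcar P \<and> length ps = k}"
  have Wc: "?W k \<subseteq> rcarrier B" for k using Sw_closed by auto
  note H = B.is_addsub_prod_set[OF grading_carrier Wc, of 0 "Suc k"]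
  have "rmul B y (S q) \<in> prod_set B (g 0) (?W (Suc k))" if q: "q \<in> mcar P" and y: "y \<in> g (- int k)" for q y
  proof (rule B.prod_set_memI[OF subsetD[OF Suc y] grading_carrier Wc B.nu B.addhom_rmul[OF gen_closed(2)[OF q]] H])
    fix a z assume a: "a \<in> ?W k" and z: "z \<in> g 0"
    then obtain qs where qs: "a = Sw qs" "set qs \<subseteq> mcar P" "length qs = k" by auto
    have "rmul B (rmul B z a) (S q) = rmul B z (Sw (qs @ [q]))"
      using qs z q grading_carrier[of 0] by (auto simp: B.mul_assoc gen_closed Sw_closed Sw_snoc)
    then show "rmul B (rmul B z a) (S q) \<in> prod_set B (g 0) (?W (Suc k))"
      using z qs q by (auto intro!: B.prod_setI exI[of _ "qs @ [q]"])
  qed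
  then have "prod_set B (g (- int k)) (S ` mcar P) \<subseteq> prod_set B (g 0) (?W (Suc k))" by (intro B.prod_set_least H) auto
  then show ?case using grading_neg[of k] by blast
qed

text \<open>\<open>psik\<close> peels the first \<open>p\<close> and the last \<open>q\<close>, so
  its image is built from the middle outwards as \<open>S(p_1) ... S(p_k) T(x_1) ... T(x_k)\<close>;
  hence the list of \<open>q\<close> is split at its end.\<close>

lemma psik_words:
  assumes "set ps \<subseteq> mcar P" "set qs \<subseteq> mcar Q" "length ps = length qs" "ps \<noteq> []"
  shows "psik psi (ract P) ps qs \<in> rcarrier R \<and> \<sigma> (psik psi (ract P) ps qs) = rmul B (Sw ps) (Tw qs)"
  using assms
proof (induction ps arbitrary: qs rule: induct_list012)
  case (2 p)
  then obtain q where "qs = [q]" by (cases qs) auto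
  then show ?case using 2 by (simp add: bimod_closed gen_rules gen_closed mul_one)
next
  case (3 p p' ps)
  then obtain qs' q where qs: "qs = qs' @ [q]" by (cases qs rule: rev_cases) auto
  let ?c = "psik psi (ract P) (p' # ps) qs'"
  have c: "?c \<in> rcarrier R" "\<sigma> ?c = rmul B (Sw (p' # ps)) (Tw qs')" using 3 qs by auto
  have cl: "S p \<in> rcarrier B" "Sw (p' # ps) \<in> rcarrier B" "Tw qs' \<in> rcarrier B" "T q \<in> rcarrier B"
    using 3 qs gen_closed Sw_closed[of "p' # ps"] Tw_closed by auto
  have pq: "p \<in> mcar P" "q \<in> mcar Q" "ract P p ?c \<in> mcar P" "set qs' \<subseteq> mcar Q" using 3 qs c bimod_closed by auto
  have "\<sigma> (psi (ract P p ?c) q) = rmul B (rmul B (S p) (\<sigma> ?c)) (T q)"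
    using pq c(1) by (simp add: gen_rules)
  also have "\<dots> = rmul B (Sw (p # p' # ps)) (Tw qs)"
    using cl c(2) qs pq unfolding qs Tw_snoc[OF pq(4,2)] Sw_simps(2)[of p "p' # ps"]
    by (simp add: B.mul_assoc del: Sw_simps)
  finally show ?case using pq qs by (simp add: bimod_closed)
qed auto

lemma psi_vals_words:
  "{rmul B (Sw ps) (Tw qs) | ps qs. set ps \<subseteq> mcar P \<and> set qs \<subseteq> mcar Q \<and> length ps = k \<and> length qs = k} \<subseteq> \<sigma> ` psi_vals R P Q psi k"
proof (cases "k = 0")
  case True
  \<comment> \<open>In degree zero both lists are empty, and the only product is the image of the
    value of \<open>psi_0\<close> at \<open>u\<close> and \<open>u\<close>.\<close>
  have "rmul B idn idn = \<sigma> (rmul R u u)" using u by (simp add: gen_rules)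
  then show ?thesis using True u(1) by (auto simp: psi_vals_def intro!: image_eqI)
next
  case False
  then show ?thesis using psik_words by (fastforce simp: psi_vals_def)
qed

lemma sigma_psi_vals: "\<sigma> ` psi_vals R P Q psi k \<subseteq> prod_set B (g (- int k)) (g (int k))"
proof (cases "k = 0")
  case True
  have "\<sigma> (rmul R r r') \<in> prod_set B (g 0) (g 0)" if "r \<in> rcarrier R" "r' \<in> rcarrier R" for r r'
    using that B.prod_setI[OF gen_grading(1) gen_grading(1), of r r'] by (simp add: gen_rules)
  then show ?thesis using True by (auto simp: psi_vals_def)
next
  case False
  have "\<sigma> (psik psi (ract P) ps qs) \<in> prod_set B (g (- int k)) (g (int k))"
    if h: "set ps \<subseteq> mcar P" "set qs \<subseteq> mcar Q" "length ps = k" "length qs = k" for ps qs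
  proof -
    have "\<sigma> (psik psi (ract P) ps qs) = rmul B (Sw ps) (Tw qs)" using psik_words[of ps qs] h False by auto
    then show ?thesis using B.prod_setI[OF Sw_grading Tw_grading, of ps qs] h by simp
  qed
  then show ?thesis using False by (auto simp: psi_vals_def)
qed

text \<open>Elements of degree \<open>-k\<close> and \<open>k\<close> are sums of
  \<open>z S(ps)\<close> and of \<open>T(qs) z'\<close> with \<open>z\<close>, \<open>z'\<close> of
  degree zero. The middle factor \<open>S(ps) T(qs)\<close> of a product is the image of a value of
  \<open>psi_k\<close>, so the product lies in the ideal generated by these values.\<close>

lemma semi_full:
  "prod_set B (g (- int k)) (g (int k)) = ideal_gen (B\<lparr>rcarrier := g 0\<rparr>) (\<sigma> ` psi_vals R P Q psi k)"
  (is "?I = ?H")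
proof
  show "?H \<subseteq> ?I" by (rule ideal_gen_least[OF prod_set_opposite_ideal sigma_psi_vals])
  interpret Z: nuring "B\<lparr>rcarrier := g 0\<rparr>" by (standard, rule nu_ring_degree_zero)
  have "?I \<subseteq> g 0" using grading_prod_set[of "- int k" "int k"] by simp
  then have id: "is_ideal (B\<lparr>rcarrier := g 0\<rparr>) ?H" using sigma_psi_vals[of k] by (intro Z.is_ideal_gen) auto
  note H = addsub_degree_zero[OF is_ideal_addsub[OF id]]
  have Wc: "{Sw ps | ps. set ps \<subseteq> mcar P \<and> length ps = k} \<subseteq> rcarrier B"
    "{Tw qs | qs. set qs \<subseteq> mcar Q \<and> length qs = k} \<subseteq> rcarrier B" using Sw_closed Tw_closed by auto
  show "?I \<subseteq> ?H"
  proof (rule B.prod_set_least[OF H])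
    fix x y assume x: "x \<in> g (- int k)" and y: "y \<in> g (int k)"
    have yc: "y \<in> rcarrier B" using y grading_carrier by auto
    show "rmul B x y \<in> ?H"
    proof (rule B.prod_set_memI[OF subsetD[OF grading_neg_words x] grading_carrier Wc(1) B.nu B.addhom_rmul[OF yc] H])
      fix z a assume z: "z \<in> g 0" and a: "a \<in> {Sw ps | ps. set ps \<subseteq> mcar P \<and> length ps = k}"
      have zc: "z \<in> rcarrier B" "a \<in> rcarrier B" using z grading_carrier a Wc by auto
      then have za: "rmul B z a \<in> rcarrier B" by auto
      show "rmul B (rmul B z a) y \<in> ?H"
      proof (rule B.prod_set_memI[OF subsetD[OF grading_pos_words y] Wc(2) grading_carrier B.nu B.addhom_lmul[OF za] H])
        fix b z' assume z': "z' \<in> g 0" and b: "b \<in> {Tw qs | qs. set qs \<subseteq> mcar Q \<and> length qs = k}"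
        have c: "z' \<in> rcarrier B" "b \<in> rcarrier B" using z' grading_carrier b Wc by auto
        have "rmul B a b \<in> ?H"
          using a b psi_vals_words[of k] ideal_gen_incl[of "\<sigma> ` psi_vals R P Q psi k" "B\<lparr>rcarrier := g 0\<rparr>"] by blast
        then have "rmul B z (rmul B a b) \<in> ?H" using id z unfolding is_ideal_def by simp
        then have "rmul B (rmul B z (rmul B a b)) z' \<in> ?H" using id z' unfolding is_ideal_def by simp
        then show "rmul B (rmul B z a) (rmul B b z') \<in> ?H" using c zc by (simp add: B.mul_assoc)
      qed
    qed
  qed
qed

subsection \<open>Local units in positive and negative degrees\<close>

text \<open>Sandwiching between one factor from \<open>Q\<close> and one from \<open>P\<close>
  shifts the degrees of both factors; sums of such terms are the units of the next degree.\<close>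

lemma prod_set_step:
  assumes a: "a \<in> prod_set B (g (int k)) (g (- int k))" and q: "q \<in> mcar Q" and p: "p \<in> mcar P"
  shows "rmul B (rmul B (T q) a) (S p) \<in> prod_set B (g (int (Suc k))) (g (- int (Suc k)))"
proof -
  let ?H = "prod_set B (g (int (Suc k))) (g (- int (Suc k)))"
  have H: "is_addsub B ?H" by (intro B.is_addsub_prod_set grading_carrier)
  have h: "addhom B B (\<lambda>a. rmul B (rmul B (T q) a) (S p))"
    by (rule addhom_comp[OF B.addhom_lmul B.addhom_rmul]) (use gen_closed p q in auto)
  show ?thesis
  proof (rule B.prod_set_memI[OF a grading_carrier grading_carrier B.nu h H])
    fix x y assume x: "x \<in> g (int k)" and y: "y \<in> g (- int k)"
    have c: "x \<in> rcarrier B" "y \<in> rcarrier B" "T q \<in> rcarrier B" "S p \<in> rcarrier B" using x y grading_carrier gen_closed p q by auto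
    have "rmul B (T q) x \<in> g (int (Suc k))" using grading_mul[OF gen_grading(3)[OF q] x] by simp
    moreover have "rmul B y (S p) \<in> g (- int (Suc k))" using grading_mul[OF y gen_grading(2)[OF p]] by (simp add: algebra_simps)
    ultimately have "rmul B (rmul B (T q) x) (rmul B y (S p)) \<in> ?H" by (rule B.prod_setI)
    then show "rmul B (rmul B (T q) (rmul B x y)) (S p) \<in> ?H" using c by (simp add: B.mul_assoc)
  qed
qed

lemma mul_rsum: "x \<in> rcarrier B \<Longrightarrow> set ys \<subseteq> rcarrier B \<Longrightarrow> rmul B x (rsum B ys) = rsum B (map (rmul B x) ys)"
  using B.addhom_rsum[OF B.addhom_lmul B.nu] by blast

lemma rsum_mul: "x \<in> rcarrier B \<Longrightarrow> set ys \<subseteq> rcarrier B \<Longrightarrow> rmul B (rsum B ys) x = rsum B (map (\<lambda>y. rmul B y x) ys)"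
  using B.addhom_rsum[OF B.addhom_rmul B.nu] by blast

context
  assumes FS': "cond_FS' R P Q psi"
begin

text \<open>With \<open>e\<close> the sum of \<open>T(q_j) a S(p_j)\<close>, the product
  \<open>e T(q) y\<close> is the sum of \<open>T(q_j) a \<sigma>(psi(p_j, q)) y\<close>. Once
  \<open>a\<close> is dropped, this is \<open>T\<close> of the sum of
  \<open>q_j psi(p_j, q)\<close>, times \<open>y\<close>, and that sum is \<open>q\<close>.\<close>

lemma left_unit_pos: "\<exists>a\<in>prod_set B (g (int k)) (g (- int k)). \<forall>x\<in>g (int k). rmul B a x = x"
proof (induction k)
  case 0
  have "rmul B idn idn \<in> prod_set B (g 0) (g 0)" using one_grading by (intro B.prod_setI)
  then have "idn \<in> prod_set B (g 0) (g 0)" by (simp add: one_mul one_closed)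
  then show ?case using one_mul grading_carrier[of 0] by (auto intro!: bexI[of _ idn])
next
  case (Suc k)
  then obtain a where a: "a \<in> prod_set B (g (int k)) (g (- int k))" "\<And>x. x \<in> g (int k) \<Longrightarrow> rmul B a x = x" by auto
  \<comment> \<open>One list serves all \<open>q\<close> at once: this uniformity is what (FS') adds
    to (FS), and it makes \<open>e\<close> a unit for the whole component.\<close>
  obtain l where l: "set l \<subseteq> mcar Q \<times> mcar P" "\<And>q. q \<in> mcar Q \<Longrightarrow> msum Q (map (\<lambda>(q',p). ract Q q' (psi p q)) l) = q"
    using FS' unfolding cond_FS'_def in_FPQ_def by metis
  have ac: "a \<in> rcarrier B" using prod_set_carrier[OF a(1)] .
  define e where "e = rsum B (map (\<lambda>(q,p). rmul B (rmul B (T q) a) (S p)) l)"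
  have e: "e \<in> prod_set B (g (int (Suc k))) (g (- int (Suc k)))" unfolding e_def
    by (rule B.rsum_in_addsub[OF B.is_addsub_prod_set[OF grading_carrier grading_carrier]])
      (use l(1) prod_set_step[OF a(1)] in auto)
  then have ec: "e \<in> rcarrier B" by (rule prod_set_carrier)
  have lc: "set (map (\<lambda>(q,p). rmul B (rmul B (T q) a) (S p)) l) \<subseteq> rcarrier B"
    using l(1) ac gen_closed by auto
  have "rmul B e x = x" if x: "x \<in> g (int (Suc k))" for x
  proof (rule B.prod_set_eqI[OF subsetD[OF grading_pos x] T_image_carrier grading_carrier B.nu B.addhom_lmul[OF ec] addhom_id])
    fix t y assume t: "t \<in> T ` mcar Q" and y: "y \<in> g (int k)"
    then obtain q where q: "t = T q" "q \<in> mcar Q" by auto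
    have yc: "y \<in> rcarrier B" using y grading_carrier by auto
    have tc: "t \<in> rcarrier B" using t T_image_carrier by auto
    have *: "rmul B (rmul B (rmul B (T q') a) (S p)) (rmul B t y) = rmul B (T (ract Q q' (psi p q))) y"
      if "q' \<in> mcar Q" "p \<in> mcar P" for q' p
    proof -
      have c: "T q' \<in> rcarrier B" "S p \<in> rcarrier B" "\<sigma> (psi p q) \<in> rcarrier B" "psi p q \<in> rcarrier R"
        using that q gen_closed bimod_closed by auto
      \<comment> \<open>Multiplication by a coefficient keeps \<open>y\<close> in degree
        \<open>k\<close>, where \<open>a\<close> acts as a left identity by the induction
        hypothesis.\<close>
      have "rmul B (\<sigma> (psi p q)) y \<in> g (int k)" using grading_mul[OF gen_grading(1)[OF c(4)] y] by simp
      then have ay: "rmul B a (rmul B (\<sigma> (psi p q)) y) = rmul B (\<sigma> (psi p q)) y" by (rule a(2))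
      have "rmul B (S p) (rmul B t y) = rmul B (\<sigma> (psi p q)) y"
        using c tc yc q that gen_rules(6)[of p q] by (simp flip: B.mul_assoc)
      then have "rmul B (rmul B (rmul B (T q') a) (S p)) (rmul B t y) = rmul B (T q') (rmul B (\<sigma> (psi p q)) y)"
        using c tc yc ac ay by (simp add: B.mul_assoc)
      also have "\<dots> = rmul B (T (ract Q q' (psi p q))) y"
        using c yc that gen_rules(4)[of q' "psi p q"] by (simp flip: B.mul_assoc)
      finally show ?thesis .
    qed
    have Tc: "set (map T (map (\<lambda>(q',p). ract Q q' (psi p q)) l)) \<subseteq> rcarrier B"
      and mc: "set (map (\<lambda>(q',p). ract Q q' (psi p q)) l) \<subseteq> mcar Q"
      using l(1) q bimod_closed gen_closed by auto
    have "rmul B e (rmul B t y) = rsum B (map (\<lambda>(q',p). rmul B (T (ract Q q' (psi p q))) y) l)"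
      unfolding e_def rsum_mul[OF B.mul_closed[OF tc yc] lc] map_map
      by (intro arg_cong[of _ _ "rsum B"] map_cong[OF refl]) (use l(1) * in \<open>clarsimp, blast\<close>)
    also have "\<dots> = rmul B (rsum B (map T (map (\<lambda>(q',p). ract Q q' (psi p q)) l))) y"
      unfolding rsum_mul[OF yc Tc] unfolding map_map by (intro arg_cong[of _ _ "rsum B"] map_cong[OF refl]) clarsimp
    also have "\<dots> = rmul B t y" using T_msum[OF mc] l(2)[OF q(2)] q(1) by simp
    finally show "rmul B e (rmul B t y) = rmul B t y" .
  qed
  then show ?case using e by blast
qed

text \<open>The unit has the same shape \<open>T(q) a S(p)\<close>, but its list comes from the
  operator on \<open>P\<close>, and the last factor from \<open>P\<close> is the one that is
  reproduced.\<close>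

lemma right_unit_neg: "\<exists>b\<in>prod_set B (g (int k)) (g (- int k)). \<forall>y\<in>g (- int k). rmul B y b = y"
proof (induction k)
  case 0
  have "rmul B idn idn \<in> prod_set B (g 0) (g 0)" using one_grading by (intro B.prod_setI)
  then have "idn \<in> prod_set B (g 0) (g 0)" by (simp add: one_mul one_closed)
  then show ?case using mul_one grading_carrier[of 0] by (auto intro!: bexI[of _ idn])
next
  case (Suc k)
  then obtain a where a: "a \<in> prod_set B (g (int k)) (g (- int k))" "\<And>x. x \<in> g (- int k) \<Longrightarrow> rmul B x a = x" by auto
  obtain l where l: "set l \<subseteq> mcar P \<times> mcar Q" "\<And>p. p \<in> mcar P \<Longrightarrow> msum P (map (\<lambda>(p',q). lact P (psi p q) p') l) = p"
    using FS' unfolding cond_FS'_def in_FQP_def by metis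
  have ac: "a \<in> rcarrier B" using prod_set_carrier[OF a(1)] .
  define e where "e = rsum B (map (\<lambda>(p,q). rmul B (rmul B (T q) a) (S p)) l)"
  have e: "e \<in> prod_set B (g (int (Suc k))) (g (- int (Suc k)))" unfolding e_def
    by (rule B.rsum_in_addsub[OF B.is_addsub_prod_set[OF grading_carrier grading_carrier]])
      (use l(1) prod_set_step[OF a(1)] in auto)
  then have ec: "e \<in> rcarrier B" by (rule prod_set_carrier)
  have lc: "set (map (\<lambda>(p,q). rmul B (rmul B (T q) a) (S p)) l) \<subseteq> rcarrier B"
    using l(1) ac gen_closed by auto
  have "rmul B x e = x" if x: "x \<in> g (- int (Suc k))" for x
  proof (rule B.prod_set_eqI[OF subsetD[OF grading_neg x] grading_carrier S_image_carrier B.nu B.addhom_rmul[OF ec] addhom_id])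
    fix t y assume t: "t \<in> S ` mcar P" and y: "y \<in> g (- int k)"
    then obtain p where p: "t = S p" "p \<in> mcar P" by auto
    have yc: "y \<in> rcarrier B" using y grading_carrier by auto
    have tc: "t \<in> rcarrier B" using t S_image_carrier by auto
    have *: "rmul B (rmul B y t) (rmul B (rmul B (T q) a) (S p')) = rmul B y (S (lact P (psi p q) p'))"
      if "p' \<in> mcar P" "q \<in> mcar Q" for q p'
    proof -
      have c: "S p' \<in> rcarrier B" "T q \<in> rcarrier B" "\<sigma> (psi p q) \<in> rcarrier B" "psi p q \<in> rcarrier R"
        using that p gen_closed bimod_closed by auto
      have "rmul B y (\<sigma> (psi p q)) \<in> g (- int k)" using grading_mul[OF y gen_grading(1)[OF c(4)]] by simp
      then have ay: "rmul B (rmul B y (\<sigma> (psi p q))) a = rmul B y (\<sigma> (psi p q))" by (rule a(2))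
      have "rmul B (rmul B y t) (rmul B (rmul B (T q) a) (S p')) = rmul B (rmul B (rmul B y (rmul B t (T q))) a) (S p')"
        using c tc yc ac by (simp add: B.mul_assoc)
      also have "\<dots> = rmul B (rmul B y (\<sigma> (psi p q))) (S p')" using ay gen_rules(6)[of p q] p that by simp
      also have "\<dots> = rmul B y (S (lact P (psi p q) p'))"
        using c yc that gen_rules(3)[of p' "psi p q"] by (simp add: B.mul_assoc)
      finally show ?thesis .
    qed
    have Sc: "set (map S (map (\<lambda>(p',q). lact P (psi p q) p') l)) \<subseteq> rcarrier B"
      and mc: "set (map (\<lambda>(p',q). lact P (psi p q) p') l) \<subseteq> mcar P"
      using l(1) p bimod_closed gen_closed by auto
    have "rmul B (rmul B y t) e = rsum B (map (\<lambda>(p',q). rmul B y (S (lact P (psi p q) p'))) l)"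
      unfolding e_def mul_rsum[OF B.mul_closed[OF yc tc] lc] map_map
      by (intro arg_cong[of _ _ "rsum B"] map_cong[OF refl]) (use l(1) * in \<open>clarsimp, blast\<close>)
    also have "\<dots> = rmul B y (rsum B (map S (map (\<lambda>(p',q). lact P (psi p q) p') l)))"
      unfolding mul_rsum[OF yc Sc] unfolding map_map by (intro arg_cong[of _ _ "rsum B"] map_cong[OF refl]) clarsimp
    also have "\<dots> = rmul B y t" using S_msum[OF mc] l(2)[OF p(2)] p(1) by simp
    finally show "rmul B (rmul B y t) e = rmul B y t" .
  qed
  then show ?case using e by blast
qed

text \<open>For \<open>x\<close> of degree \<open>k\<close>, \<open>x = a x\<close> is a sum of
  terms \<open>s (t x)\<close> with \<open>t x\<close> in the product of degrees \<open>-k\<close>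
  and \<open>k\<close>. The identity \<open>e\<close> of that product therefore fixes
  \<open>x\<close> from the right, although it was only known to act on degree zero. Degree
  \<open>-k\<close> is symmetric, with \<open>b\<close> in place of \<open>a\<close>.\<close>

lemma eps_strongly_gradedI:
  assumes un: "\<And>k. unital_ideal B (prod_set B (g (- int k)) (g (int k)))"
  shows "eps_strongly_graded B g"
proof -
  have c: "x \<in> g i \<Longrightarrow> x \<in> rcarrier B" for x i using grading_carrier by auto
  have main: "\<exists>a\<in>prod_set B (g (int k)) (g (- int k)). \<exists>b\<in>prod_set B (g (int k)) (g (- int k)). \<exists>e\<in>prod_set B (g (- int k)) (g (int k)).
      (\<forall>x\<in>g (int k). rmul B a x = x \<and> rmul B x e = x) \<and> (\<forall>y\<in>g (- int k). rmul B e y = y \<and> rmul B y b = y)" for k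
  proof -
    obtain a where a: "a \<in> prod_set B (g (int k)) (g (- int k))" "\<And>x. x \<in> g (int k) \<Longrightarrow> rmul B a x = x"
      using left_unit_pos[of k] by auto
    obtain b where b: "b \<in> prod_set B (g (int k)) (g (- int k))" "\<And>x. x \<in> g (- int k) \<Longrightarrow> rmul B x b = x"
      using right_unit_neg[of k] by auto
    obtain e where e: "e \<in> prod_set B (g (- int k)) (g (int k))"
      "\<And>x. x \<in> prod_set B (g (- int k)) (g (int k)) \<Longrightarrow> rmul B e x = x \<and> rmul B x e = x"
      using un[of k] by (auto simp: unital_ideal_def)
    have ec: "e \<in> rcarrier B" using prod_set_carrier[OF e(1)] .
    have "rmul B x e = x" if x: "x \<in> g (int k)" for x
    proof -
      have "rmul B (rmul B z x) e = rmul B z x" if z: "z \<in> prod_set B (g (int k)) (g (- int k))" for z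
      proof (rule B.prod_set_eqI[OF z grading_carrier grading_carrier B.nu 
            addhom_comp[OF B.addhom_rmul[OF c[OF x]] B.addhom_rmul[OF ec]] B.addhom_rmul[OF c[OF x]]])
        fix s t assume st: "s \<in> g (int k)" "t \<in> g (- int k)"
        have "rmul B (rmul B t x) e = rmul B t x" using e(2) B.prod_setI[OF st(2) x] by auto
        then show "rmul B (rmul B (rmul B s t) x) e = rmul B (rmul B s t) x"
          using st[THEN c] c[OF x] ec by (simp add: B.mul_assoc)
      qed
      from this[OF a(1)] show ?thesis using a(2)[OF x] by simp
    qed
    moreover have "rmul B e y = y" if y: "y \<in> g (- int k)" for y
    proof -
      have "rmul B e (rmul B y z) = rmul B y z" if z: "z \<in> prod_set B (g (int k)) (g (- int k))" for z
      proof (rule B.prod_set_eqI[OF z grading_carrier grading_carrier B.nu 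
            addhom_comp[OF B.addhom_lmul[OF c[OF y]] B.addhom_lmul[OF ec]] B.addhom_lmul[OF c[OF y]]])
        fix s t assume st: "s \<in> g (int k)" "t \<in> g (- int k)"
        have "rmul B e (rmul B y s) = rmul B y s" using e(2) B.prod_setI[OF y st(1)] by auto
        then show "rmul B e (rmul B y (rmul B s t)) = rmul B y (rmul B s t)"
          using st[THEN c] c[OF y] ec by (simp flip: B.mul_assoc)
      qed
      from this[OF b(1)] show ?thesis using b(2)[OF y] by simp
    qed
    ultimately show ?thesis using a b e by (intro bexI[of _ a] bexI[of _ b] bexI[of _ e]) auto
  qed
  show ?thesis unfolding eps_strongly_graded_def
  proof
    fix i :: int
    show "\<exists>a\<in>prod_set B (g i) (g (- i)). \<exists>b\<in>prod_set B (g (- i)) (g i). \<forall>x\<in>g i. rmul B a x = x \<and> rmul B x b = x"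
    proof (cases i rule: int_cases2)
      case (nonneg n)
      then show ?thesis using main[of n] by auto
    next
      \<comment> \<open>In degree \<open>-n\<close> the identity \<open>e\<close> becomes the left
        unit and \<open>b\<close> the right one.\<close>
      case (nonpos n)
      then show ?thesis using main[of n] by auto
    qed
  qed
qed

end

end

section \<open>Epsilon-strongly graded Cuntz--Pimsner rings\<close>

text \<open>Here \<open>\<kappa>\<close> is additive only on \<open>H\<close>, as are the maps of
  the new system, which are defined on single graded components.\<close>

lemma (in nuring) addsub_partial_equalizer:
  assumes H: "is_addsub A H" and C: "nu_ring C" and f: "addhom A C f"
    and k: "\<And>x. x \<in> H \<Longrightarrow> \<kappa> x \<in> rcarrier C" "\<And>x y. x \<in> H \<Longrightarrow> y \<in> H \<Longrightarrow> \<kappa> (x \<boxplus> y) = radd C (\<kappa> x) (\<kappa> y)"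
  shows "is_addsub A {x \<in> H. f x = \<kappa> x}"
proof -
  interpret C: nuring C by standard fact
  have h: "\<And>x. x \<in> H \<Longrightarrow> x \<in> rcarrier A" "rzero A \<in> H" "\<And>x y. x \<in> H \<Longrightarrow> y \<in> H \<Longrightarrow> x \<boxplus> y \<in> H"
    "\<And>x. x \<in> H \<Longrightarrow> \<boxminus> x \<in> H" using H by (auto simp: is_addsub_def)
  have z: "\<kappa> (rzero A) = rzero C" using k(2)[OF h(2) h(2)] by (intro C.idem_zero k h) simp
  have n: "\<kappa> (\<boxminus> x) = rneg C (\<kappa> x)" if "x \<in> H" for x
    using k(2)[of x "\<boxminus> x"] that z h by (intro C.neg_unique k h) simp_all
  have "{x \<in> H. f x = \<kappa> x} \<subseteq> rcarrier A" using h by auto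
  then show ?thesis unfolding is_addsub_def
    using h k z n C.addhom_zero[OF f nu] C.addhom_neg[OF f nu] addhom_add[OF f] by simp
qed

text \<open>Units go to units because \<open>f\<close> is onto in every degree and maps products of
  components into products of components.\<close>

lemma eps_strongly_graded_image:
  assumes A: "nu_ring A" and C: "nu_ring C" and f: "rhom A C f"
    and gA: "\<And>i. gA i \<subseteq> rcarrier A" and gC: "\<And>i. f ` gA i = gC i" and e: "eps_strongly_graded A gA"
  shows "eps_strongly_graded C gC"
proof -
  interpret A: nuring A by standard fact
  interpret C: nuring C by standard fact
  have fp: "f x \<in> prod_set C (gC i) (gC j)" if x: "x \<in> prod_set A (gA i) (gA j)" for x i j
  proof (rule A.prod_set_memI[OF x gA gA C rhom_addhom[OF f]])
    have "gC i \<subseteq> rcarrier C" for i using rhom_closed[OF f] gA unfolding gC[symmetric] by blast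
    then show "is_addsub C (prod_set C (gC i) (gC j))" by (intro C.is_addsub_prod_set)
    fix y z assume yz: "y \<in> gA i" "z \<in> gA j"
    then have "f y \<in> gC i" "f z \<in> gC j" using gC by auto
    moreover have "f (rmul A y z) = rmul C (f y) (f z)" using yz gA by (intro rhom_mul[OF f]) auto
    ultimately show "f (rmul A y z) \<in> prod_set C (gC i) (gC j)" by (simp add: C.prod_setI)
  qed
  have pc: "x \<in> rcarrier A" if "x \<in> prod_set A (gA i) (gA j)" for x i j
    using that A.is_addsub_prod_set[OF gA gA, of i j] by (auto simp: is_addsub_def)
  show ?thesis unfolding eps_strongly_graded_def
  proof
    fix i
    obtain a b where ab: "a \<in> prod_set A (gA i) (gA (-i))" "b \<in> prod_set A (gA (-i)) (gA i)"
      "\<And>x. x \<in> gA i \<Longrightarrow> rmul A a x = x \<and> rmul A x b = x"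
      using e[unfolded eps_strongly_graded_def, rule_format, of i] by auto
    have "rmul C (f a) x = x \<and> rmul C x (f b) = x" if xC: "x \<in> gC i" for x
    proof -
      obtain y where y: "y \<in> gA i" "x = f y" using xC unfolding gC[of i, symmetric] by auto
      then have "y \<in> rcarrier A" using gA by auto
      then show ?thesis using ab(3)[OF y(1)] y(2) rhom_mul[OF f, of a y] rhom_mul[OF f, of y b] pc[OF ab(1)] pc[OF ab(2)] by simp
    qed
    then show "\<exists>a\<in>prod_set C (gC i) (gC (- i)). \<exists>b\<in>prod_set C (gC (- i)) (gC i). \<forall>x\<in>gC i. rmul C a x = x \<and> rmul C x b = x"
      using fp[OF ab(1)] fp[OF ab(2)] by (intro bexI[of _ "f a"] bexI[of _ "f b"]) simp_all
  qed
qed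

text \<open>A left unit \<open>a\<close> of degree \<open>-i\<close> and a right unit
  \<open>b\<close> of degree \<open>i\<close> both lie in the product; evaluating \<open>a b\<close>
  in two ways shows that they coincide.\<close>

lemma (in relcp) unital_prod_set:
  assumes e: "eps_strongly_graded B g"
  shows "unital_ideal B (prod_set B (g (- i)) (g i))"
proof -
  let ?I = "prod_set B (g (- i)) (g i)"
  have c: "x \<in> g i \<Longrightarrow> x \<in> rcarrier B" for x i using grading_carrier by auto
  obtain a where a: "a \<in> ?I" "\<And>x. x \<in> g (-i) \<Longrightarrow> rmul B a x = x"
    using e[unfolded eps_strongly_graded_def, rule_format, of "-i"] by auto
  obtain b where b: "b \<in> ?I" "\<And>x. x \<in> g i \<Longrightarrow> rmul B x b = x"
    using e[unfolded eps_strongly_graded_def, rule_format, of i] by auto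
  note ac = prod_set_carrier[OF a(1)] and bc = prod_set_carrier[OF b(1)]
  have az: "rmul B a z = z" if z: "z \<in> ?I" for z
    by (rule B.prod_set_eqI[OF z grading_carrier grading_carrier B.nu B.addhom_lmul[OF ac] addhom_id])
      (simp add: ac c a(2) flip: B.mul_assoc)
  have zb: "rmul B z b = z" if z: "z \<in> ?I" for z
    by (rule B.prod_set_eqI[OF z grading_carrier grading_carrier B.nu B.addhom_rmul[OF bc] addhom_id])
      (simp add: bc c b(2) B.mul_assoc)
  have "a = b" using az[OF b(1)] zb[OF a(1)] by simp
  then show ?thesis using a(1) az zb unfolding unital_ideal_def by (intro bexI[of _ a]) simp_all
qed

locale eps_relcp = relcp R P Q psi J
  for R :: "'r rng" and P :: "('r,'p) bimod" and Q :: "('r,'q) bimod" and psi :: "'p \<Rightarrow> 'q \<Rightarrow> 'r" and J +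
  assumes eps: "eps_strongly_graded B g"
begin

section \<open>The ring of degree zero, its identity, and the ideal \<open>I\<close> with its
  identity\<close>

definition R0 :: "('r,'p,'q) cpelt rng" where "R0 = B\<lparr>rcarrier := g 0\<rparr>"

definition M :: "int \<Rightarrow> (('r,'p,'q) cpelt, ('r,'p,'q) cpelt) bimod" where
  "M i = \<lparr>mcar = g i, madd = radd B, mzero = rzero B, mneg = rneg B, lact = rmul B, ract = rmul B\<rparr>"

definition I where "I = prod_set B (g 1) (g (-1))"

lemma R0_simps [simp]: "rcarrier R0 = g 0" "radd R0 = radd B" "rmul R0 = rmul B" "rzero R0 = rzero B" "rneg R0 = rneg B"
  by (simp_all add: R0_def)

lemma M_simps [simp]: "mcar (M i) = g i" "madd (M i) = radd B" "mzero (M i) = rzero B" "mneg (M i) = rneg B"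
  "lact (M i) = rmul B" "ract (M i) = rmul B"
  by (simp_all add: M_def)

lemma msum_M [simp]: "msum (M i) = rsum B"
  by (auto simp: msum_def rsum_def)

lemma gc: "x \<in> g i \<Longrightarrow> x \<in> rcarrier B"
  using grading_carrier by auto

lemma grading_mul':
  "x \<in> g 0 \<Longrightarrow> y \<in> g j \<Longrightarrow> rmul B x y \<in> g j"
  "x \<in> g j \<Longrightarrow> y \<in> g 0 \<Longrightarrow> rmul B x y \<in> g j"
  "x \<in> g (-1) \<Longrightarrow> y \<in> g 1 \<Longrightarrow> rmul B x y \<in> g 0"
  "x \<in> g 1 \<Longrightarrow> y \<in> g (-1) \<Longrightarrow> rmul B x y \<in> g 0"
  using grading_mul[of x 0 y j] grading_mul[of x j y 0] grading_mul[of x "-1" y 1] grading_mul[of x 1 y "-1"] by simp_all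

lemma grading_addsub': "rzero B \<in> g i" "x \<in> g i \<Longrightarrow> y \<in> g i \<Longrightarrow> radd B x y \<in> g i" "x \<in> g i \<Longrightarrow> rneg B x \<in> g i"
  using grading_addsub[of i] by (auto simp: is_addsub_def)

text \<open>The identity \<open>e\<close> of \<open>O_0 O_0\<close> acts on all of
  \<open>O_0\<close>, because degree-zero elements are fixed by some \<open>a0\<close> of
  \<open>O_0\<close>. In degree \<open>i\<close>, \<open>x = a x\<close> with \<open>a\<close> of
  degree zero gives \<open>e x = (e a) x = x\<close>, and similarly on the right.\<close>

lemma degree_zero_unit: "\<exists>e\<in>g 0. \<forall>i. \<forall>x\<in>g i. rmul B e x = x \<and> rmul B x e = x"
proof -
  have pz: "x \<in> prod_set B (g i) (g (-i)) \<Longrightarrow> x \<in> g 0" "x \<in> prod_set B (g (-i)) (g i) \<Longrightarrow> x \<in> g 0" for x i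
    using grading_prod_set[of i "-i"] grading_prod_set[of "-i" i] by auto
  obtain e where e: "e \<in> prod_set B (g 0) (g 0)" "\<And>x. x \<in> prod_set B (g 0) (g 0) \<Longrightarrow> rmul B e x = x \<and> rmul B x e = x"
    using unital_prod_set[OF eps, of 0] by (auto simp: unital_ideal_def)
  have ez: "e \<in> g 0" using e(1) pz[of e 0] by simp
  obtain a0 b0 where ab0: "a0 \<in> prod_set B (g 0) (g 0)" "b0 \<in> prod_set B (g 0) (g 0)"
    "\<And>x. x \<in> g 0 \<Longrightarrow> rmul B a0 x = x \<and> rmul B x b0 = x"
    using eps[unfolded eps_strongly_graded_def, rule_format, of 0] by auto
  have ab0z: "a0 \<in> g 0" "b0 \<in> g 0" using ab0 pz[of _ 0] by auto
  have e0: "rmul B e x = x" "rmul B x e = x" if "x \<in> g 0" for x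
    using ab0(3)[OF that] e(2)[of x] B.prod_setI[of a0 "g 0" x "g 0"] ab0z that by auto
  have "rmul B e x = x \<and> rmul B x e = x" if x: "x \<in> g i" for x i
  proof -
    obtain a b where ab: "a \<in> prod_set B (g i) (g (-i))" "b \<in> prod_set B (g (-i)) (g i)" "rmul B a x = x" "rmul B x b = x"
      using eps[unfolded eps_strongly_graded_def, rule_format, of i] x by auto
    have "rmul B (rmul B e a) x = rmul B e (rmul B a x)" "rmul B x (rmul B b e) = rmul B (rmul B x b) e"
      using B.mul_assoc[of e a x] B.mul_assoc[of x b e] ab(1,2)[THEN prod_set_carrier] gc[OF x] gc[OF ez] by simp_all
    then show ?thesis using ab e0 pz by simp
  qed
  then show ?thesis using ez by (intro bexI[of _ e]) simp_all
qed

text \<open>The identity of \<open>I\<close> acts on \<open>O_1\<close> and \<open>O_{-1}\<close>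
  because their elements are fixed by elements of \<open>I\<close>: \<open>x = a x\<close> implies
  \<open>e x = (e a) x = x\<close>.\<close>

lemma I_unit: "\<exists>e\<in>I. (\<forall>x\<in>g 1. rmul B e x = x) \<and> (\<forall>y\<in>g (-1). rmul B y e = y) \<and> (\<forall>z\<in>I. rmul B e z = z \<and> rmul B z e = z)"
proof -
  obtain e where e: "e \<in> I" "\<And>z. z \<in> I \<Longrightarrow> rmul B e z = z \<and> rmul B z e = z"
    using unital_prod_set[OF eps, of "-1"] by (auto simp: unital_ideal_def I_def)
  have ec: "e \<in> rcarrier B" using e(1) prod_set_carrier by (auto simp: I_def)
  have "rmul B e x = x" if x: "x \<in> g 1" for x
  proof -
    obtain a where a: "a \<in> I" "rmul B a x = x"
      using eps[unfolded eps_strongly_graded_def, rule_format, of 1] x unfolding I_def by auto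
    have "rmul B (rmul B e a) x = rmul B e (rmul B a x)"
      using B.mul_assoc[of e a x] a(1)[unfolded I_def, THEN prod_set_carrier] ec gc[OF x] by simp
    then show ?thesis using a e by simp
  qed
  moreover have "rmul B y e = y" if y: "y \<in> g (-1)" for y
  proof -
    obtain b where b: "b \<in> I" "rmul B y b = y"
      using eps[unfolded eps_strongly_graded_def, rule_format, of "-1"] y unfolding I_def by auto
    have "rmul B y (rmul B b e) = rmul B (rmul B y b) e"
      using B.mul_assoc[of y b e] b(1)[unfolded I_def, THEN prod_set_carrier] ec gc[OF y] by simp
    then show ?thesis using b e by simp
  qed
  ultimately show ?thesis using e by (intro bexI[of _ e]) simp_all
qed

definition E :: "('r,'p,'q) cpelt" where "E = (SOME e. e \<in> I \<and> (\<forall>x\<in>g 1. rmul B e x = x) \<and> (\<forall>y\<in>g (-1). rmul B y e = y) \<and> (\<forall>z\<in>I. rmul B e z = z \<and> rmul B z e = z))"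

lemma E: "E \<in> I" "x \<in> g 1 \<Longrightarrow> rmul B E x = x" "y \<in> g (-1) \<Longrightarrow> rmul B y E = y"
  "z \<in> I \<Longrightarrow> rmul B E z = z" "z \<in> I \<Longrightarrow> rmul B z E = z"
proof -
  have "E \<in> I \<and> (\<forall>x\<in>g 1. rmul B E x = x) \<and> (\<forall>y\<in>g (-1). rmul B y E = y) \<and> (\<forall>z\<in>I. rmul B E z = z \<and> rmul B z E = z)"
    unfolding E_def by (rule someI_ex) (use I_unit[unfolded Bex_def] in assumption)
  then show "E \<in> I" "x \<in> g 1 \<Longrightarrow> rmul B E x = x" "y \<in> g (-1) \<Longrightarrow> rmul B y E = y"
    "z \<in> I \<Longrightarrow> rmul B E z = z" "z \<in> I \<Longrightarrow> rmul B z E = z" by simp_all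
qed

lemma I_sub: "I \<subseteq> g 0"
  using grading_prod_set[of 1 "-1"] by (simp add: I_def)

lemma I_ideal: "is_ideal R0 I"
  using prod_set_opposite_ideal[of "-1"] by (simp add: I_def R0_def)

lemma I_addsub: "is_addsub B I"
  unfolding I_def by (intro B.is_addsub_prod_set grading_carrier)

lemma I_list:
  assumes "z \<in> I"
  obtains l where "set l \<subseteq> g 1 \<times> g (-1)" "z = rsum B (map (\<lambda>(q,p). rmul B q p) l)"
  using B.prod_set_list[OF grading_addsub grading_carrier assms[unfolded I_def]] by blast

lemma list_in_I: "set l \<subseteq> g 1 \<times> g (-1) \<Longrightarrow> rsum B (map (\<lambda>(q,p). rmul B q p) l) \<in> I"
  by (rule B.rsum_in_addsub[OF I_addsub]) (auto simp: I_def intro!: B.prod_setI)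

lemma list_mul:
  assumes "set l \<subseteq> g 1 \<times> g (-1)" "y \<in> rcarrier B"
  shows "rmul B (rsum B (map (\<lambda>(q,p). rmul B q p) l)) y = rsum B (map (\<lambda>(q,p). rmul B q (rmul B p y)) l)"
  using assms(1)
proof (induction l)
  case (Cons a l)
  obtain q p where a: "a = (q, p)" by (cases a)
  have c: "q \<in> rcarrier B" "p \<in> rcarrier B" "rsum B (map (\<lambda>(q,p). rmul B q p) l) \<in> rcarrier B"
    using Cons.prems a gc list_in_I[of l] I_sub by auto
  show ?case using Cons c assms(2) a by (simp add: B.distr B.mul_assoc)
qed (use assms(2) in simp)

lemma mul_list:
  assumes "set l \<subseteq> g 1 \<times> g (-1)" "y \<in> rcarrier B"
  shows "rmul B y (rsum B (map (\<lambda>(q,p). rmul B q p) l)) = rsum B (map (\<lambda>(q,p). rmul B (rmul B y q) p) l)"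
  using assms(1)
proof (induction l)
  case (Cons a l)
  obtain q p where a: "a = (q, p)" by (cases a)
  have c: "q \<in> rcarrier B" "p \<in> rcarrier B" "rsum B (map (\<lambda>(q,p). rmul B q p) l) \<in> rcarrier B"
    using Cons.prems a gc list_in_I[of l] I_sub by auto
  show ?case using Cons c assms(2) a by (simp add: B.distl B.mul_assoc)
qed (use assms(2) in simp)

text \<open>\<open>x = x E\<close>, and \<open>E\<close> is a sum of products \<open>q p\<close>, so
  \<open>x\<close> is recovered from the elements \<open>x q\<close>. This injectivity is what makes
  the inclusions into \<open>B\<close> covariant.\<close>

lemma I_faithful:
  assumes x: "x \<in> I" and x': "x' \<in> I" and e: "\<And>q. q \<in> g 1 \<Longrightarrow> rmul B x q = rmul B x' q"
  shows "x = x'"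
proof -
  have xc: "x \<in> rcarrier B" "x' \<in> rcarrier B" using x x' I_sub gc by auto
  have "rmul B x E = rmul B x' E"
    by (rule B.prod_set_eqI[OF E(1)[unfolded I_def] grading_carrier grading_carrier B.nu B.addhom_lmul[OF xc(1)] B.addhom_lmul[OF xc(2)]])
      (simp add: xc gc e flip: B.mul_assoc)
  then show ?thesis using E x x' by simp
qed

subsection \<open>The system of degree \<open>-1\<close>, \<open>0\<close>, \<open>1\<close> components\<close>

lemma bimodule_M: "bimodule R0 (M i)"
  unfolding bimodule_def
  by (simp add: gc grading_mul' grading_addsub' B.add_ac B.distl B.distr B.mul_assoc)

lemma rsystem_M: "rsystem R0 (M (-1)) (M 1) (rmul B)"
proof -
  have "nu_ring R0" unfolding R0_def by (rule nu_ring_degree_zero)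
  then show ?thesis unfolding rsystem_def
    by (simp add: bimodule_M gc grading_mul' grading_addsub' B.distl B.distr B.mul_assoc)
qed

lemma unital_M: "unital_system R0 (M (-1)) (M 1)"
proof -
  obtain e where "e \<in> g 0" "\<forall>i. \<forall>x\<in>g i. rmul B e x = x \<and> rmul B x e = x" using degree_zero_unit by blast
  then show ?thesis unfolding unital_system_def unital_rng_def unital_bimod_def
    by (intro conjI bexI[of _ e]) simp_all
qed

text \<open>A single expression of \<open>E\<close> as a sum of products \<open>q p\<close> supplies
  both operators; for the one on \<open>O_{-1}\<close> the pairs are swapped.\<close>

lemma FS'_M: "cond_FS' R0 (M (-1)) (M 1) (rmul B)"
proof -
  obtain l where l: "set l \<subseteq> g 1 \<times> g (-1)" "E = rsum B (map (\<lambda>(q,p). rmul B q p) l)"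
    using I_list[OF E(1)] .
  have "in_FPQ R0 (M (-1)) (M 1) (rmul B) (\<lambda>x. rmul B E x)"
    unfolding in_FPQ_def using l list_mul[OF l(1)] gc by (intro exI[of _ l]) auto
  moreover have "in_FQP R0 (M (-1)) (M 1) (rmul B) (\<lambda>y. rmul B y E)"
    unfolding in_FQP_def
  proof (intro exI[of _ "map prod.swap l"] conjI ballI)
    show "set (map prod.swap l) \<subseteq> mcar (M (-1)) \<times> mcar (M 1)" using l(1) by auto
    fix y assume "y \<in> mcar (M (-1))"
    then show "rmul B y E = msum (M (-1)) (map (\<lambda>(p,q). lact (M (-1)) (rmul B y q) p) (map prod.swap l))"
      using mul_list[OF l(1), of y] gc l(2) by (simp add: case_prod_unfold comp_def)
  qed
  ultimately show ?thesis unfolding cond_FS'_def using E(2,3)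
    by (intro exI[of _ "\<lambda>x. rmul B E x"] exI[of _ "\<lambda>y. rmul B y E"]) simp
qed

text \<open>An expression of \<open>x\<close> as a sum of products \<open>q p\<close> is at the same
  time a presentation of left multiplication by \<open>x\<close> as a sum of operators
  \<open>theta_{q,p}\<close>.\<close>

lemma I_compatible: "psi_compatible R0 (M (-1)) (M 1) (rmul B) I"
  unfolding psi_compatible_def
proof (intro conjI ballI I_ideal)
  fix x assume "x \<in> I"
  then obtain l where l: "set l \<subseteq> g 1 \<times> g (-1)" "x = rsum B (map (\<lambda>(q,p). rmul B q p) l)"
    using I_list by blast
  then show "in_FPQ R0 (M (-1)) (M 1) (rmul B) (lact (M 1) x)"
    unfolding in_FPQ_def using list_mul[OF l(1)] gc by (intro exI[of _ l]) auto
qed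

lemma I_faithful_ideal: "faithful_ideal R0 (M 1) I"
  unfolding faithful_ideal_def
proof (intro ballI impI)
  fix x assume x: "x \<in> I" "\<forall>q\<in>mcar (M 1). lact (M 1) x q = mzero (M 1)"
  have "rzero B \<in> I" using I_addsub by (simp add: is_addsub_def)
  then show "x = rzero R0" using I_faithful[OF x(1)] x(2) gc by simp
qed

text \<open>For \<open>x\<close> in \<open>L\<close>, the element \<open>x - x E\<close> lies in
  \<open>L\<close> and annihilates \<open>O_1\<close> from the left, since \<open>E\<close> fixes
  \<open>O_1\<close>. Faithfulness gives \<open>x = x E\<close>, which lies in
  \<open>I\<close>.\<close>

lemma faithful_sub_I:
  assumes L: "is_ideal R0 L" "faithful_ideal R0 (M 1) L" shows "L \<subseteq> I"
proof
  fix x assume x: "x \<in> L"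
  have Ez: "E \<in> g 0" using E(1) I_sub by auto
  have Lc: "L \<subseteq> g 0" using L by (auto simp: is_ideal_def)
  have c: "x \<in> rcarrier B" "E \<in> rcarrier B" using x Lc Ez gc by auto
  have xE: "rmul B x E \<in> L" using L x Ez by (auto simp: is_ideal_def)
  then have d: "radd B x (rneg B (rmul B x E)) \<in> L" using L x by (auto simp: is_ideal_def)
  have "rmul B (radd B x (rneg B (rmul B x E))) q = rzero B" if q: "q \<in> g 1" for q
    using c gc[OF q] E(2)[OF q] by (simp add: B.distr B.neg_mul B.mul_assoc)
  then have "radd B x (rneg B (rmul B x E)) = rzero B" using L(2) d by (simp add: faithful_ideal_def)
  then have "x = rmul B x E" using c by (simp add: B.diff_zero)
  moreover have "rmul B x E \<in> I" using I_ideal E(1) x Lc by (auto simp: is_ideal_def)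
  ultimately show "x \<in> I" by simp
qed

lemma max_cf_iff: "max_cf_ideal R0 (M (-1)) (M 1) (rmul B) L \<longleftrightarrow> L = I"
proof
  assume L: "max_cf_ideal R0 (M (-1)) (M 1) (rmul B) L"
  then have "L \<subseteq> I" using faithful_sub_I by (auto simp: max_cf_ideal_def psi_compatible_def)
  then show "L = I" using L I_compatible I_faithful_ideal by (auto simp: max_cf_ideal_def)
next
  assume "L = I"
  then show "max_cf_ideal R0 (M (-1)) (M 1) (rmul B) L"
    using I_compatible I_faithful_ideal faithful_sub_I by (auto simp: max_cf_ideal_def psi_compatible_def)
qed

lemma cp_well_defined_M: "cp_well_defined R0 (M (-1)) (M 1) (rmul B)"
  unfolding cp_well_defined_def max_cf_iff by simp

lemma cp_ideal_M: "cp_ideal R0 (M (-1)) (M 1) (rmul B) = I"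
  unfolding cp_ideal_def max_cf_iff by simp

section \<open>Comparison with the Cuntz-Pimsner ring \<open>N.B\<close> of the new system\<close>

interpretation N: unital_relcp R0 "M (-1)" "M 1" "rmul B" I
  using rsystem_M unital_M I_sub by unfold_locales auto

text \<open>The covariance relation for the element \<open>q p\<close> of \<open>I\<close>, read off
  from its one-term presentation.\<close>

lemma N_mul_pos_neg:
  assumes "q \<in> g 1" "p \<in> g (-1)" shows "rmul N.B (N.T q) (N.S p) = N.\<sigma> (rmul B q p)"
proof -
  have qp: "rmul B q p \<in> I" unfolding I_def using assms by (rule B.prod_setI)
  have "\<forall>y\<in>g 1. rmul B (rmul B q p) y = rsum B (map (\<lambda>(q,p). rmul B q (rmul B p y)) [(q,p)])"
    using assms gc by (auto simp: B.mul_assoc)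
  then have "N.\<sigma> (rmul B q p) = rsum N.B (map (\<lambda>(q,p). rmul N.B (N.T q) (N.S p)) [(q,p)])"
    using N.covariant[unfolded cp_covariant_def, rule_format, OF qp, of "[(q,p)]"] assms by simp
  then show ?thesis using assms N.gen_closed by simp
qed

lemma N_rules:
  "r \<in> g 0 \<Longrightarrow> s \<in> g 0 \<Longrightarrow> rmul N.B (N.\<sigma> r) (N.\<sigma> s) = N.\<sigma> (rmul B r s)"
  "p \<in> g (-1) \<Longrightarrow> r \<in> g 0 \<Longrightarrow> rmul N.B (N.S p) (N.\<sigma> r) = N.S (rmul B p r)"
  "p \<in> g (-1) \<Longrightarrow> r \<in> g 0 \<Longrightarrow> rmul N.B (N.\<sigma> r) (N.S p) = N.S (rmul B r p)"
  "q \<in> g 1 \<Longrightarrow> r \<in> g 0 \<Longrightarrow> rmul N.B (N.T q) (N.\<sigma> r) = N.T (rmul B q r)"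
  "q \<in> g 1 \<Longrightarrow> r \<in> g 0 \<Longrightarrow> rmul N.B (N.\<sigma> r) (N.T q) = N.T (rmul B r q)"
  "p \<in> g (-1) \<Longrightarrow> q \<in> g 1 \<Longrightarrow> rmul N.B (N.S p) (N.T q) = N.\<sigma> (rmul B p q)"
  using N.gen_rules by auto

lemma N_add:
  "r \<in> g 0 \<Longrightarrow> r' \<in> g 0 \<Longrightarrow> radd N.B (N.\<sigma> r) (N.\<sigma> r') = N.\<sigma> (radd B r r')"
  "p \<in> g (-1) \<Longrightarrow> p' \<in> g (-1) \<Longrightarrow> radd N.B (N.S p) (N.S p') = N.S (radd B p p')"
  "q \<in> g 1 \<Longrightarrow> q' \<in> g 1 \<Longrightarrow> radd N.B (N.T q) (N.T q') = N.T (radd B q q')"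
  using N.gen_add by auto

lemma N_closed:
  "r \<in> g 0 \<Longrightarrow> N.\<sigma> r \<in> rcarrier N.B" "p \<in> g (-1) \<Longrightarrow> N.S p \<in> rcarrier N.B" "q \<in> g 1 \<Longrightarrow> N.T q \<in> rcarrier N.B"
  using N.gen_closed by auto

text \<open>For \<open>x\<close> in \<open>J\<close>, covariance in \<open>B\<close> already writes
  \<open>\<sigma> x\<close> as a sum of products \<open>T(q) S(p)\<close>. Hence
  \<open>\<sigma> x\<close> lies in \<open>I\<close>, and the same list serves for the covariance
  relation in \<open>N.B\<close>.\<close>

lemma hom_forward:
  "\<exists>f. rhom B N.B f \<and> (\<forall>r\<in>rcarrier R. f (\<sigma> r) = N.\<sigma> (\<sigma> r)) \<and>
    (\<forall>p\<in>mcar P. f (S p) = N.S (S p)) \<and> (\<forall>q\<in>mcar Q. f (T q) = N.T (T q))"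
proof (rule universal[OF N.B.nu])
  show "cov_rep R P Q psi N.B (\<lambda>r. N.\<sigma> (\<sigma> r)) (\<lambda>p. N.S (S p)) (\<lambda>q. N.T (T q))"
    unfolding cov_rep_def rhom_def addhom_def
    by (simp add: N_closed N_rules N_add gen_grading gen_rules gen_add)
  show "cp_covariant P Q psi J N.B (\<lambda>r. N.\<sigma> (\<sigma> r)) (\<lambda>p. N.S (S p)) (\<lambda>q. N.T (T q))"
    unfolding cp_covariant_def
  proof (intro ballI allI impI)
    fix x l assume x: "x \<in> J" and l: "set l \<subseteq> mcar Q \<times> mcar P"
      "\<forall>y\<in>mcar Q. lact Q x y = msum Q (map (\<lambda>(q,p). ract Q q (psi p y)) l)"
    let ?l = "map (\<lambda>(q,p). (T q, S p)) l"
    have l': "set ?l \<subseteq> g 1 \<times> g (-1)" using l(1) gen_grading by auto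
    have "\<sigma> x = rsum B (map (\<lambda>(q,p). rmul B (T q) (S p)) l)"
      using covariant x l unfolding cp_covariant_def by blast
    also have "map (\<lambda>(q,p). rmul B (T q) (S p)) l = map (\<lambda>(q,p). rmul B q p) ?l" by auto
    finally have sx: "\<sigma> x = rsum B (map (\<lambda>(q,p). rmul B q p) ?l)" .
    have sI: "\<sigma> x \<in> I" unfolding sx by (rule list_in_I[OF l'])
    have "\<forall>y\<in>mcar (M 1). lact (M 1) (\<sigma> x) y = msum (M 1) (map (\<lambda>(q,p). ract (M 1) q (rmul B p y)) ?l)"
      unfolding sx M_simps msum_M using list_mul[OF l'] gc by blast
    then have "N.\<sigma> (\<sigma> x) = rsum N.B (map (\<lambda>(q,p). rmul N.B (N.T q) (N.S p)) ?l)"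
      using N.covariant[unfolded cp_covariant_def, rule_format, OF sI, of ?l] l' by simp
    also have "map (\<lambda>(q,p). rmul N.B (N.T q) (N.S p)) ?l = map (\<lambda>(q,p). rmul N.B (N.T (T q)) (N.S (S p))) l"
      by auto
    finally show "N.\<sigma> (\<sigma> x) = rsum N.B (map (\<lambda>(q,p). rmul N.B (N.T (T q)) (N.S (S p))) l)" .
  qed
qed

text \<open>Covariance of the inclusions asks that a list acting on \<open>O_1\<close> like
  \<open>x\<close> also sums to \<open>x\<close>; this is \<open>I_faithful\<close>.\<close>

lemma hom_backward:
  "\<exists>h. rhom N.B B h \<and> (\<forall>r\<in>g 0. h (N.\<sigma> r) = r) \<and> (\<forall>p\<in>g (-1). h (N.S p) = p) \<and> (\<forall>q\<in>g 1. h (N.T q) = q)"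
proof -
  have "cov_rep R0 (M (-1)) (M 1) (rmul B) B (\<lambda>r. r) (\<lambda>p. p) (\<lambda>q. q)"
    unfolding cov_rep_def rhom_def addhom_def by (simp add: gc)
  moreover have "cp_covariant (M (-1)) (M 1) (rmul B) I B (\<lambda>r. r) (\<lambda>p. p) (\<lambda>q. q)"
    unfolding cp_covariant_def M_simps msum_M
  proof (intro ballI allI impI)
    fix x l assume x: "x \<in> I" and l: "set l \<subseteq> g 1 \<times> g (-1)"
      "\<forall>y\<in>g 1. rmul B x y = rsum B (map (\<lambda>(q,p). rmul B q (rmul B p y)) l)"
    show "x = rsum B (map (\<lambda>(q,p). rmul B q p) l)"
      by (rule I_faithful[OF x list_in_I[OF l(1)]]) (use l list_mul[OF l(1)] gc in auto)
  qed
  ultimately show ?thesis using N.universal[OF B.nu] by simp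
qed

lemma qp_word_gens: "set qs \<subseteq> mcar Q \<Longrightarrow> set ps \<subseteq> mcar P \<Longrightarrow> set (qp_word qs ps :: ('r,'p,'q) fgen list) \<subseteq> gens R P Q"
  by (auto simp: gens_def)

text \<open>The values of \<open>f\<close> are prescribed only on the images of \<open>R\<close>,
  \<open>P\<close> and \<open>Q\<close>; here they are computed on whole components, as needed to
  compose \<open>f\<close> with the inverse map on the generators of \<open>N.B\<close>.\<close>

lemma hom_forward_components:
  assumes f: "rhom B N.B f" and fg: "\<And>r. r \<in> rcarrier R \<Longrightarrow> f (\<sigma> r) = N.\<sigma> (\<sigma> r)"
    "\<And>p. p \<in> mcar P \<Longrightarrow> f (S p) = N.S (S p)" "\<And>q. q \<in> mcar Q \<Longrightarrow> f (T q) = N.T (T q)"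
  shows "x \<in> g 0 \<Longrightarrow> f x = N.\<sigma> x" "x \<in> g 1 \<Longrightarrow> f x = N.T x" "x \<in> g (-1) \<Longrightarrow> f x = N.S x"
proof -
  have fm: "f (rmul B x y) = rmul N.B (f x) (f y)" if "x \<in> g i" "y \<in> g j" for x y i j
    using rhom_mul[OF f] that gc by blast
  have pq: "Inr (Inl p) \<in> gens R P Q" "Inr (Inr q) \<in> gens R P Q" if "p \<in> mcar P" "q \<in> mcar Q" for p q
    using that by (auto simp: gens_def)
  have wg: "wp (qp_word qs ps) \<in> g i"
    if "set qs \<subseteq> mcar Q" "set ps \<subseteq> mcar P" "qp_word qs ps \<noteq> ([] :: ('r,'p,'q) fgen list)" "int (length qs) - int (length ps) = i" for qs ps i
    using that by (intro wp_in_grading normal_wordsI) auto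
  \<comment> \<open>A word of degree zero is bracketed as \<open>q (m p)\<close> with
    \<open>m\<close> again of degree zero. Then \<open>m p\<close> lies in \<open>O_{-1}\<close>,
    and \<open>N_mul_pos_neg\<close> merges \<open>q\<close> with it.\<close>
  have w0: "f (wp (qp_word qs ps)) = N.\<sigma> (wp (qp_word qs ps))"
    if "set qs \<subseteq> mcar Q" "set ps \<subseteq> mcar P" "length qs = length ps" "qs \<noteq> []" for qs ps
    using that
  proof (induction qs arbitrary: ps)
    case (Cons q qs)
    then obtain ps' p where ps: "ps = ps' @ [p]" by (cases ps rule: rev_cases) auto
    have h: "q \<in> mcar Q" "p \<in> mcar P" "set qs \<subseteq> mcar Q" "set ps' \<subseteq> mcar P" "length qs = length ps'" using Cons.prems ps by auto
    let ?m = "qp_word qs ps' :: ('r,'p,'q) fgen list"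
    show ?case
    proof (cases "qs = []")
      case True
      then have e: "wp (qp_word (q # qs) ps) = rmul B (T q) (S p)" using ps h by (simp add: wp_Cons)
      show ?thesis unfolding e fm[OF gen_grading(3)[OF h(1)] gen_grading(2)[OF h(2)]] fg(3)[OF h(1)] fg(2)[OF h(2)]
        by (rule N_mul_pos_neg[OF gen_grading(3)[OF h(1)] gen_grading(2)[OF h(2)]])
    next
      case False
      then have ne: "?m \<noteq> []" by simp
      have "wp (?m @ [Inr (Inl p)]) = rmul B (wp ?m) (S p)"
        using wp_append[OF ne, of "[Inr (Inl p)]"] qp_word_gens[OF h(3,4)] pq[OF h(2,1)] by simp
      then have e: "wp (qp_word (q # qs) ps) = rmul B (T q) (rmul B (wp ?m) (S p))"
        using ps wp_Cons[of "?m @ [Inr (Inl p)]" "Inr (Inr q)"] by simp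
      have m0: "wp ?m \<in> g 0" using wg[OF h(3,4) ne] h(5) by simp
      have mp: "rmul B (wp ?m) (S p) \<in> g (-1)" using grading_mul'(1)[OF m0 gen_grading(2)[OF h(2)]] .
      have IH: "f (wp ?m) = N.\<sigma> (wp ?m)" using Cons.IH h False by blast
      have "f (wp (qp_word (q # qs) ps)) = rmul N.B (N.T (T q)) (N.S (rmul B (wp ?m) (S p)))"
        unfolding e fm[OF gen_grading(3)[OF h(1)] mp] fm[OF m0 gen_grading(2)[OF h(2)]] IH
        using fg h N_rules(3)[OF gen_grading(2)[OF h(2)] m0] by simp
      then show ?thesis unfolding e using N_mul_pos_neg[OF gen_grading(3)[OF h(1)] mp] by simp
    qed
  qed simp
  \<comment> \<open>Removing the first letter from \<open>Q\<close> leaves degree zero, where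
    \<open>w0\<close> applies; for degree \<open>-1\<close> the last letter from \<open>P\<close> is
    removed instead.\<close>
  have w1: "f (wp (qp_word qs ps)) = N.T (wp (qp_word qs ps))"
    if "set qs \<subseteq> mcar Q" "set ps \<subseteq> mcar P" "length qs = Suc (length ps)" for qs ps
  proof -
    obtain q qs' where qs: "qs = q # qs'" using \<open>length qs = Suc (length ps)\<close> by (cases qs) auto
    have h: "q \<in> mcar Q" "set qs' \<subseteq> mcar Q" "length qs' = length ps" using that qs by auto
    let ?m = "qp_word qs' ps :: ('r,'p,'q) fgen list"
    show ?thesis
    proof (cases "qs' = []")
      case True
      then show ?thesis using h qs fg by simp
    next
      case False
      then have ne: "?m \<noteq> []" by simp
      have e: "wp (qp_word qs ps) = rmul B (T q) (wp ?m)" using qs wp_Cons[OF ne, of "Inr (Inr q)"] by simp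
      have m0: "wp ?m \<in> g 0" using wg[OF h(2) that(2) ne] h(3) by simp
      show ?thesis unfolding e fm[OF gen_grading(3)[OF h(1)] m0] w0[OF h(2) that(2) h(3) False] fg(3)[OF h(1)]
        using N_rules(4)[OF gen_grading(3)[OF h(1)] m0] .
    qed
  qed
  have wm: "f (wp (qp_word qs ps)) = N.S (wp (qp_word qs ps))"
    if "set qs \<subseteq> mcar Q" "set ps \<subseteq> mcar P" "length ps = Suc (length qs)" for qs ps
  proof -
    obtain p ps' where ps: "ps = ps' @ [p]" using \<open>length ps = Suc (length qs)\<close> by (cases ps rule: rev_cases) auto
    have h: "p \<in> mcar P" "set ps' \<subseteq> mcar P" "length qs = length ps'" using that ps by auto
    let ?m = "qp_word qs ps' :: ('r,'p,'q) fgen list"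
    show ?thesis
    proof (cases "qs = []")
      case True
      then show ?thesis using h ps fg by simp
    next
      case False
      then have ne: "?m \<noteq> []" by simp
      have "Inr (Inl p) \<in> gens R P Q" using h(1) by (auto simp: gens_def)
      then have e: "wp (qp_word qs ps) = rmul B (wp ?m) (S p)"
        using ps wp_append[OF ne, of "[Inr (Inl p)]"] qp_word_gens[OF that(1) h(2)] by simp
      have m0: "wp ?m \<in> g 0" using wg[OF that(1) h(2) ne] h(3) by simp
      show ?thesis unfolding e fm[OF m0 gen_grading(2)[OF h(1)]] w0[OF that(1) h(2) h(3) False] fg(2)[OF h(1)]
        using N_rules(3)[OF gen_grading(2)[OF h(1)] m0] .
    qed
  qed
  \<comment> \<open>A common extension from words to components, with \<open>\<kappa>\<close>
    standing for \<open>N.\<sigma>\<close>, \<open>N.T\<close> or \<open>N.S\<close>. Assumption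
    \<open>kr\<close> handles a leading coefficient, and \<open>k0\<close> the word that is only a
    coefficient, which occurs in degree zero.\<close>
  have ext: "f x = \<kappa> x" if x: "x \<in> g i"
    and kc: "\<And>x. x \<in> g i \<Longrightarrow> \<kappa> x \<in> rcarrier N.B"
    and ka: "\<And>x y. x \<in> g i \<Longrightarrow> y \<in> g i \<Longrightarrow> \<kappa> (radd B x y) = radd N.B (\<kappa> x) (\<kappa> y)"
    and kr: "\<And>r x. r \<in> rcarrier R \<Longrightarrow> x \<in> g i \<Longrightarrow> \<kappa> (rmul B (\<sigma> r) x) = rmul N.B (N.\<sigma> (\<sigma> r)) (\<kappa> x)"
    and k0: "\<And>r. r \<in> rcarrier R \<Longrightarrow> i = 0 \<Longrightarrow> \<kappa> (\<sigma> r) = N.\<sigma> (\<sigma> r)"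
    and kw: "\<And>qs ps. set qs \<subseteq> mcar Q \<Longrightarrow> set ps \<subseteq> mcar P \<Longrightarrow> qp_word qs ps \<noteq> ([] :: ('r,'p,'q) fgen list) \<Longrightarrow>
        int (length qs) - int (length ps) = i \<Longrightarrow> f (wp (qp_word qs ps)) = \<kappa> (wp (qp_word qs ps))" for x i \<kappa>
  proof -
    have H: "is_addsub B {x \<in> g i. f x = \<kappa> x}"
      by (rule B.addsub_partial_equalizer[OF grading_addsub N.B.nu rhom_addhom[OF f]]) (simp_all add: kc ka)
    have "f (wp w) = \<kappa> (wp w)" if w: "w \<in> normal_words R P Q i" for w
    proof -
      from w consider (a) qs ps where "w = qp_word qs ps" "set qs \<subseteq> mcar Q" "set ps \<subseteq> mcar P" "qp_word qs ps \<noteq> ([] :: ('r,'p,'q) fgen list)"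
          "int (length qs) - int (length ps) = i"
        | (b) r qs ps where "w = Inl r # qp_word qs ps" "r \<in> rcarrier R" "set qs \<subseteq> mcar Q" "set ps \<subseteq> mcar P"
          "int (length qs) - int (length ps) = i"
        unfolding normal_words_def by fastforce
      then show ?thesis
      proof cases
        case a
        then show ?thesis using kw by simp
      next
        case b
        let ?v = "qp_word qs ps :: ('r,'p,'q) fgen list"
        show ?thesis
        proof (cases "?v = []")
          case True
          then show ?thesis using b k0 fg by simp
        next
          case False
          have e: "wp w = rmul B (\<sigma> r) (wp ?v)" using b(1) wp_Cons[OF False, of "Inl r"] by simp
          have vg: "wp ?v \<in> g i" using wg[OF b(3,4) False b(5)] .
          show ?thesis unfolding e fm[OF gen_grading(1)[OF b(2)] vg] kr[OF b(2) vg] fg(1)[OF b(2)] kw[OF b(3,4) False b(5)] ..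
        qed
      qed
    qed
    then have "wp ` normal_words R P Q i \<subseteq> {x \<in> g i. f x = \<kappa> x}" using wp_in_grading by auto
    then have "addsub_gen B (wp ` normal_words R P Q i) \<subseteq> {x \<in> g i. f x = \<kappa> x}"
      by (rule addsub_gen_least[OF H])
    then show ?thesis using x by (auto simp flip: grading_eq)
  qed
  show "x \<in> g 0 \<Longrightarrow> f x = N.\<sigma> x"
    by (rule ext[where i = 0]) (simp_all add: N_closed N_add N_rules gen_grading, (rule w0; auto)?)
  show "x \<in> g 1 \<Longrightarrow> f x = N.T x"
    by (rule ext[where i = 1]) (simp_all add: N_closed N_add N_rules gen_grading, (rule w1; auto)?)
  show "x \<in> g (-1) \<Longrightarrow> f x = N.S x"
    by (rule ext[where i = "-1"]) (simp_all add: N_closed N_add N_rules gen_grading, (rule wm; auto)?)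
qed

text \<open>Each composite is a ring homomorphism fixing generators: those of \<open>B\<close> by
  the prescribed values, those of \<open>N.B\<close> by
  \<open>hom_forward_components\<close>.\<close>

lemma graded_iso:
  "\<exists>f. rhom B N.B f \<and> bij_betw f (rcarrier B) (rcarrier N.B) \<and> (\<forall>i. f ` g i = N.g i)"
proof -
  obtain f where f: "rhom B N.B f" and fg: "\<And>r. r \<in> rcarrier R \<Longrightarrow> f (\<sigma> r) = N.\<sigma> (\<sigma> r)"
    "\<And>p. p \<in> mcar P \<Longrightarrow> f (S p) = N.S (S p)" "\<And>q. q \<in> mcar Q \<Longrightarrow> f (T q) = N.T (T q)"
    using hom_forward by (elim exE conjE) simp
  obtain h where h: "rhom N.B B h" and hg: "\<And>r. r \<in> g 0 \<Longrightarrow> h (N.\<sigma> r) = r"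
    "\<And>p. p \<in> g (-1) \<Longrightarrow> h (N.S p) = p" "\<And>q. q \<in> g 1 \<Longrightarrow> h (N.T q) = q"
    using hom_backward by (elim exE conjE) simp
  note fc = hom_forward_components[OF f fg]
  note hf = rhom_comp[OF f h] and fh = rhom_comp[OF h f]
  have "rcarrier B \<subseteq> {x \<in> rcarrier B. h (f x) = x}"
    by (rule generated[OF B.addsub_equalizer[OF rhom_addhom[OF hf] addhom_id B.nu]])
      (simp_all add: rhom_mul[OF hf] gen_closed fg hg gen_grading)
  then have hf_id: "h (f x) = x" if "x \<in> rcarrier B" for x using that by auto
  have "rcarrier N.B \<subseteq> {x \<in> rcarrier N.B. f (h x) = x}"
    by (rule N.generated[OF N.B.addsub_equalizer[OF rhom_addhom[OF fh] addhom_id N.B.nu]])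
      (simp_all add: rhom_mul[OF fh] N_closed fc hg)
  then have fh_id: "f (h x) = x" if "x \<in> rcarrier N.B" for x using that by auto
  have "bij_betw f (rcarrier B) (rcarrier N.B)"
    by (rule bij_betw_byWitness[of _ h]) (use hf_id fh_id rhom_closed[OF f] rhom_closed[OF h] in auto)
  moreover have "f ` g i = N.g i" for i
  proof
    have "f x \<in> N.g i" if "x \<in> g i" for x
      by (rule graded_hom[where G = N.g, OF f N.B.nu N.grading_addsub N.grading_mul _ _ _ that]) (simp_all add: fg N.gen_grading gen_grading)
    then show "f ` g i \<subseteq> N.g i" by auto
    \<comment> \<open>Surjectivity in degree \<open>i\<close>: the inverse map preserves degrees
      too, so preimages can be taken in the same degree.\<close>
    have "h x \<in> g i" if "x \<in> N.g i" for x
      by (rule N.graded_hom[where G = g, OF h B.nu grading_addsub grading_mul _ _ _ that]) (simp_all add: hg)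
    moreover have "x = f (h x)" if "x \<in> N.g i" for x using fh_id that N.grading_carrier by (simp add: subset_iff)
    ultimately show "N.g i \<subseteq> f ` g i" by (intro subsetI image_eqI)
  qed
  ultimately show ?thesis using f by (intro exI[of _ f]) simp
qed

text \<open>With epsilon-strongness carried over, \<open>unital_prod_set\<close> applies to the new
  ring and provides the identities required in (d).\<close>

lemma N_eps: "eps_strongly_graded N.B N.g"
proof -
  obtain f where f: "rhom B N.B f" "\<And>i. f ` g i = N.g i" using graded_iso by (elim exE conjE) simp
  show ?thesis by (rule eps_strongly_graded_image[OF B.nu N.B.nu f(1) grading_carrier f(2) eps])
qed

lemma N_semi_full: "cp_semi_full R0 (M (-1)) (M 1) (rmul B)"
  unfolding cp_semi_full_def cp_Ik_def cp_ring_def cp_grading_def cp_iotaR_def cp_ideal_M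
  by (intro allI N.semi_full)

lemma N_unital_Ik: "unital_ideal (cp_ring R0 (M (-1)) (M 1) (rmul B)) (cp_Ik R0 (M (-1)) (M 1) (rmul B) k)"
  using N.unital_prod_set[OF N_eps, of "int k"]
  unfolding N_semi_full[unfolded cp_semi_full_def, rule_format, symmetric]
  unfolding cp_ring_def cp_grading_def cp_ideal_M .

lemma N_gr_iso: "gr_iso B g (cp_ring R0 (M (-1)) (M 1) (rmul B)) (cp_grading R0 (M (-1)) (M 1) (rmul B))"
  unfolding cp_ring_def cp_grading_def cp_ideal_M gr_iso_def
  using graded_iso by (elim exE conjE, intro exI conjI ballI) (assumption | simp add: rhom_add rhom_mul)+

end

text \<open>The definite description in \<open>cp_ideal\<close> yields the maximal ideal because
  well-definedness supplies existence and uniqueness.\<close>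

lemma relcp_cp_ideal:
  assumes "rsystem R P Q psi" "cp_well_defined R P Q psi"
  shows "relcp R P Q psi (cp_ideal R P Q psi)"
proof -
  have "max_cf_ideal R P Q psi (cp_ideal R P Q psi)"
    using theI'[OF assms(2)[unfolded cp_well_defined_def]] unfolding cp_ideal_def .
  then show ?thesis using assms(1) by unfold_locales (auto simp: max_cf_ideal_def psi_compatible_def is_ideal_def)
qed

theorem mainTheorem2:
  fixes R :: "'r rng" and P :: "('r,'p) bimod" and Q :: "('r,'q) bimod" and psi :: "'p \<Rightarrow> 'q \<Rightarrow> 'r"
    and R2 :: "'s rng" and P2 :: "('s,'u) bimod" and Q2 :: "('s,'v) bimod" and psi2 :: "'u \<Rightarrow> 'v \<Rightarrow> 's"
  shows
   "(rsystem R P Q psi \<and> cond_FS R P Q psi \<and> cp_well_defined R P Q psi \<and>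
     eps_strongly_graded (cp_ring R P Q psi) (cp_grading R P Q psi) \<and>
     ann0 (cp_ring R P Q psi) (cp_grading R P Q psi) \<inter>
       perp0 (cp_ring R P Q psi) (cp_grading R P Q psi) (ann0 (cp_ring R P Q psi) (cp_grading R P Q psi))
       = {rzero (cp_ring R P Q psi)}
    \<longrightarrow> (\<exists>(R' :: ('r,'p,'q) cpelt rng) (P' :: (('r,'p,'q) cpelt, ('r,'p,'q) cpelt) bimod)
          (Q' :: (('r,'p,'q) cpelt, ('r,'p,'q) cpelt) bimod) psi'.
          rsystem R' P' Q' psi' \<and> cp_well_defined R' P' Q' psi' \<and>
          unital_system R' P' Q' \<and>
          cp_semi_full R' P' Q' psi' \<and>
          cond_FS' R' P' Q' psi' \<and>
          (\<forall>k. unital_ideal (cp_ring R' P' Q' psi') (cp_Ik R' P' Q' psi' k)) \<and>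
          gr_iso (cp_ring R P Q psi) (cp_grading R P Q psi) (cp_ring R' P' Q' psi') (cp_grading R' P' Q' psi')))
  \<and>
   (rsystem R2 P2 Q2 psi2 \<and> cp_well_defined R2 P2 Q2 psi2 \<and>
     unital_system R2 P2 Q2 \<and> cp_semi_full R2 P2 Q2 psi2 \<and> cond_FS' R2 P2 Q2 psi2 \<and>
     (\<forall>k. unital_ideal (cp_ring R2 P2 Q2 psi2) (cp_Ik R2 P2 Q2 psi2 k))
    \<longrightarrow> eps_strongly_graded (cp_ring R2 P2 Q2 psi2) (cp_grading R2 P2 Q2 psi2))"
proof (intro conjI impI; elim conjE)
  assume sys: "rsystem R P Q psi" "cp_well_defined R P Q psi"
    and e: "eps_strongly_graded (cp_ring R P Q psi) (cp_grading R P Q psi)"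
  interpret relcp R P Q psi "cp_ideal R P Q psi" by (rule relcp_cp_ideal[OF sys])
  interpret eps_relcp R P Q psi "cp_ideal R P Q psi"
    by unfold_locales (use e in \<open>simp add: cp_ring_def cp_grading_def\<close>)
  show "\<exists>(R' :: ('r,'p,'q) cpelt rng) (P' :: (('r,'p,'q) cpelt, ('r,'p,'q) cpelt) bimod)
          (Q' :: (('r,'p,'q) cpelt, ('r,'p,'q) cpelt) bimod) psi'.
          rsystem R' P' Q' psi' \<and> cp_well_defined R' P' Q' psi' \<and>
          unital_system R' P' Q' \<and>
          cp_semi_full R' P' Q' psi' \<and>
          cond_FS' R' P' Q' psi' \<and>
          (\<forall>k. unital_ideal (cp_ring R' P' Q' psi') (cp_Ik R' P' Q' psi' k)) \<and>
          gr_iso (cp_ring R P Q psi) (cp_grading R P Q psi) (cp_ring R' P' Q' psi') (cp_grading R' P' Q' psi')"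
    by (intro exI conjI allI, rule rsystem_M, rule cp_well_defined_M, rule unital_M, rule N_semi_full, rule FS'_M,
        rule N_unital_Ik, unfold cp_ring_def[of R P Q psi] cp_grading_def[of R P Q psi], rule N_gr_iso)
next
  assume sys: "rsystem R2 P2 Q2 psi2" "cp_well_defined R2 P2 Q2 psi2" and u: "unital_system R2 P2 Q2"
    and sf: "cp_semi_full R2 P2 Q2 psi2" and fs: "cond_FS' R2 P2 Q2 psi2"
    and un: "\<forall>k. unital_ideal (cp_ring R2 P2 Q2 psi2) (cp_Ik R2 P2 Q2 psi2 k)"
  interpret relcp R2 P2 Q2 psi2 "cp_ideal R2 P2 Q2 psi2" by (rule relcp_cp_ideal[OF sys])
  interpret unital_relcp R2 P2 Q2 psi2 "cp_ideal R2 P2 Q2 psi2" by unfold_locales (rule u)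
  \<comment> \<open>Semi-fullness turns the identities of the ideals in (d) into identities of the
    products of degrees \<open>-k\<close> and \<open>k\<close>, the form expected by
    \<open>eps_strongly_gradedI\<close>.\<close>
  show "eps_strongly_graded (cp_ring R2 P2 Q2 psi2) (cp_grading R2 P2 Q2 psi2)"
    using eps_strongly_gradedI[OF fs] un sf unfolding cp_semi_full_def cp_ring_def cp_grading_def by simp
qed

end
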